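(* Let $\Bbbk$ be a field, let $\mathcal{X}$ and $\mathcal{Y}$ be pointed metric spaces, and let $\theta$ be a ($\Bbbk$-)linear cohomology operation. Equip the wedge sum $\mathcal{X}\vee\mathcal{Y}$ with the gluing metric. Then there are isomorphisms of persistence modules $$\mathrm{Im}_\theta^{\mathrm{VR}}(\mathcal{X}\vee\mathcal{Y})\cong \mathrm{Im}_\theta^{\mathrm{VR}}(\mathcal{X})\oplus \mathrm{Im}_\theta^{\mathrm{VR}}(\mathcal{Y}),\qquad \mathrm{Ker}_\theta^{\mathrm{VR}}(\mathcal{X}\vee\mathcal{Y})\cong \mathrm{Ker}_\theta^{\mathrm{VR}}(\mathcal{X})\oplus \mathrm{Ker}_\theta^{\mathrm{VR}}(\mathcal{Y}).$$
   Context: Cohomology $\mathrm{H}^*$ is reduced singular cohomology with coefficients in the field $\Bbbk$ (zero, in degrees $\ge 0$, for the empty space). A linear cohomology operation $\theta\in\mathcal{O}(\ell,m)$ ($\ell,m\in\mathbb{N}$) is a family of $\Bbbk$-linear maps $\theta_{X}\colon \mathrm{H}^\ell(X)\to \mathrm{H}^m(X)$, one for each CW complex $X$, with $f^*\theta_{Y}=\theta_{X}f^*$ for every continuous map $f\colon X\to Y$. A cellular $\mathbb{R}$-space is a functor $X$ from the poset $\mathbb{R}$ to topological spaces, with each $X_r$ a CW complex. For such $X$, $\mathrm{Im}_\theta(X)$ and $\mathrm{Ker}_\theta(X)$ are the persistence modules (functors $\mathbb{R}^{\mathrm{op}}\to\mathrm{Vec}_\Bbbk$) $r\mapsto \mathrm{Im}(\theta_{X_r})\subseteq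 \mathrm{H}^m(X_r)$ and $r\mapsto\mathrm{Ker}(\theta_{X_r})\subseteq \mathrm{H}^\ell(X_r)$, with structure maps the restrictions of the maps $\mathrm{H}^*(X_t)\to \mathrm{H}^*(X_s)$, $s\le t$. For a metric space $\mathcal{X}$ and $r>0$, $\mathrm{VR}_r(\mathcal{X})$ is the geometric realization of the simplicial complex with vertices the points of $\mathcal{X}$ and simplices the finite subsets of diameter strictly less than $r$; $\mathrm{VR}_r(\mathcal{X})=\emptyset$ for $r\le 0$. With inclusions this is a cellular $\mathbb{R}$-space $\mathrm{VR}(\mathcal{X})$. Put $\mathrm{Im}_\theta^{\mathrm{VR}}(\mathcal{X})=\mathrm{Im}_\theta(\mathrm{VR}(\mathcal{X}))$ and $\mathrm{Ker}_\theta^{\mathrm{VR}}(\mathcal{X})=\mathrm{Ker}_\theta(\mathrm{VR}(\mathcal{X}))$. The gluing metric on the wedge of pointed metric spaces $(\mathcal{X},x_0)$ and $(\mathcal{Y},y_0)$ restricts to the given metrics on $\mathcal{X}$ and $\mathcal{Y}$, and $d(x,y)=d_{\mathcal{X}}(x,x_0)+d_{\mathcal{Y}}(y,y_0)$ for $x\in\mathcal{X}$, $y\in\mathcal{Y}$. *)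

theory Defs
  imports "HOL-Analysis.Analysis" "HOL-Homology.Homology" "HOL-Algebra.Module" "HOL-Algebra.QuotRing"
begin

section \<open>Vector spaces\<close>

text \<open>
  A vector space over a field, given as a type of class \<^class>\<open>field\<close>, is a module in the sense of
  \<open>HOL-Algebra\<close> over the associated ring record. The fields \<open>mult\<close> and \<open>one\<close>, which the
  record type \<open>module\<close> inherits from \<open>ring\<close>, play no role for a module and are left undefined.
\<close>

definition field_record :: "'k::field ring" where
  "field_record = \<lparr>carrier = UNIV, mult = (*), one = 1, zero = 0, add = (+)\<rparr>"

lemma field_field_record: "field (field_record :: 'k::field ring)"
proof -
  have "\<exists>y. x * y = 1" if "x \<noteq> 0" for x :: 'k
    using that by (intro exI[of _ "inverse x"]) simp
  moreover have "\<exists>y. x + y = 0" for x :: 'k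
    by (rule exI[of _ "- x"]) simp
  moreover have "\<exists>y. y + x = 0 \<and> x + y = 0" for x :: 'k
    by (rule exI[of _ "- x"]) simp
  ultimately show ?thesis
    unfolding field_record_def
    by unfold_locales (auto simp: algebra_simps Units_def)
qed

definition vspace :: "('k::field, 'v) module \<Rightarrow> bool" where
  "vspace V \<longleftrightarrow> Module.module (field_record :: 'k ring) V"

definition linear_map ::
  "('k::field, 'v) module \<Rightarrow> ('k, 'w) module \<Rightarrow> ('v \<Rightarrow> 'w) \<Rightarrow> bool" where
  "linear_map V W f \<longleftrightarrow>
     f \<in> carrier V \<rightarrow> carrier W \<and>
     (\<forall>x\<in>carrier V. \<forall>y\<in>carrier V. f (x \<oplus>\<^bsub>V\<^esub> y) = f x \<oplus>\<^bsub>W\<^esub> f y) \<and>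
     (\<forall>a. \<forall>x\<in>carrier V. f (a \<odot>\<^bsub>V\<^esub> x) = a \<odot>\<^bsub>W\<^esub> f x)"

definition module_sum ::
  "('k, 'v) module \<Rightarrow> ('k, 'w) module \<Rightarrow> ('k, 'v \<times> 'w) module" where
  "module_sum V W =
     \<lparr>carrier = carrier V \<times> carrier W, mult = undefined, one = undefined,
      zero = (\<zero>\<^bsub>V\<^esub>, \<zero>\<^bsub>W\<^esub>),
      add = (\<lambda>(x, y) (x', y'). (x \<oplus>\<^bsub>V\<^esub> x', y \<oplus>\<^bsub>W\<^esub> y')),
      smult = (\<lambda>a (x, y). (a \<odot>\<^bsub>V\<^esub> x, a \<odot>\<^bsub>W\<^esub> y))\<rparr>"

text \<open>The quotient by a submodule, following \<^const>\<open>FactRing\<close>.\<close>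

definition quot_module :: "('k, 'v) module \<Rightarrow> 'v set \<Rightarrow> ('k, 'v set) module" where
  "quot_module V N =
     \<lparr>carrier = a_rcosets\<^bsub>V\<^esub> N, mult = undefined, one = undefined,
      zero = N, add = set_add V,
      smult = (\<lambda>a A. \<Union>x\<in>A. N +>\<^bsub>V\<^esub> (a \<odot>\<^bsub>V\<^esub> x))\<rparr>"


section \<open>Reduced singular cohomology with field coefficients\<close>

text \<open>
  An \<open>n\<close>-cochain of \<open>X\<close> is a function on the singular \<open>n\<close>-simplices of \<open>X\<close>, represented by
  its extension by zero.
\<close>

type_synonym ('a, 'k) cochain = "((nat \<Rightarrow> real) \<Rightarrow> 'a) \<Rightarrow> 'k"

definition cochain_module :: "nat \<Rightarrow> 'a topology \<Rightarrow> ('k::field, ('a, 'k) cochain) module" where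
  "cochain_module n X =
     \<lparr>carrier = {c. \<forall>s. \<not> singular_simplex n X s \<longrightarrow> c s = 0}, mult = undefined, one = undefined,
      zero = (\<lambda>s. 0), add = (\<lambda>c d s. c s + d s), smult = (\<lambda>a c s. a * c s)\<rparr>"

definition coboundary :: "nat \<Rightarrow> 'a topology \<Rightarrow> ('a, 'k::field) cochain \<Rightarrow> ('a, 'k) cochain" where
  "coboundary n X c =
     (\<lambda>s. if singular_simplex (Suc n) X s
          then \<Sum>k\<le>Suc n. (-1) ^ k * c (singular_face (Suc n) k s) else 0)"

definition cocycle_module :: "nat \<Rightarrow> 'a topology \<Rightarrow> ('k::field, ('a, 'k) cochain) module" where
  "cocycle_module n X =
     (cochain_module n X)
       \<lparr>carrier := {c \<in> carrier (cochain_module n X). coboundary n X c = (\<lambda>s. 0)}\<rparr>"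

text \<open>
  Reduced cohomology is the cohomology of the cochain complex augmented by the field in degree
  \<open>-1\<close>; the augmentation sends a scalar to the corresponding constant \<open>0\<close>-cochain. In
  degrees \<open>\<ge> 0\<close> this gives zero for the empty space.
\<close>

definition reduced_coboundaries :: "nat \<Rightarrow> 'a topology \<Rightarrow> ('a, 'k::field) cochain set" where
  "reduced_coboundaries n X =
     (case n of
        0 \<Rightarrow> range (\<lambda>a s. if singular_simplex 0 X s then a else 0)
      | Suc p \<Rightarrow> coboundary p X ` carrier (cochain_module p X))"

definition cohomology :: "nat \<Rightarrow> 'a topology \<Rightarrow> ('k::field, ('a, 'k) cochain set) module" where
  "cohomology n X = quot_module (cocycle_module n X) (reduced_coboundaries n X)"

definition pullback_cochain ::
  "nat \<Rightarrow> 'a topology \<Rightarrow> ('a \<Rightarrow> 'b) \<Rightarrow> ('b, 'k::field) cochain \<Rightarrow> ('a, 'k) cochain" where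
  "pullback_cochain n X f c =
     (\<lambda>s. if singular_simplex n X s then c (simplex_map n f s) else 0)"

text \<open>
  For a continuous map \<open>f\<close> from \<open>X\<close> to \<open>Y\<close>, the induced map \<open>f\<^sup>*\<close> from the cohomology of
  \<open>Y\<close> to that of \<open>X\<close>. The union is over the representatives of the class \<open>A\<close>; all the
  cosets in it coincide.
\<close>

definition cohomology_map ::
  "nat \<Rightarrow> 'a topology \<Rightarrow> ('a \<Rightarrow> 'b) \<Rightarrow> ('b, 'k::field) cochain set \<Rightarrow> ('a, 'k) cochain set" where
  "cohomology_map n X f A =
     (\<Union>c\<in>A. reduced_coboundaries n X +>\<^bsub>cocycle_module n X\<^esub> pullback_cochain n X f c)"


section \<open>CW complexes and linear cohomology operations\<close>

definition disk :: "nat \<Rightarrow> (nat \<Rightarrow> real) topology" where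
  "disk n = subtopology (Euclidean_space n) {x. (\<Sum>i<n. x i ^ 2) \<le> 1}"

definition open_disk :: "nat \<Rightarrow> (nat \<Rightarrow> real) topology" where
  "open_disk n = subtopology (Euclidean_space n) {x. (\<Sum>i<n. x i ^ 2) < 1}"

definition disk_boundary :: "nat \<Rightarrow> (nat \<Rightarrow> real) set" where
  "disk_boundary n = {x \<in> topspace (Euclidean_space n). (\<Sum>i<n. x i ^ 2) = 1}"

text \<open>
  The spaces that admit the structure of a CW complex. \<open>E\<close> is the set of open cells, \<open>dim e\<close>
  the dimension and \<open>\<Phi> e\<close> the characteristic map of the cell \<open>e\<close>. The last two conditions are
  closure finiteness and the weak topology. Only the existence of a cell structure matters for
  cohomology operations: they are natural for all continuous maps, in particular for the identity
  map between two CW structures on the same space. The cells are disjoint and nonempty, so indexing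
  by the cells themselves loses no generality.
\<close>

definition cw_complex :: "'a topology \<Rightarrow> bool" where
  "cw_complex X \<longleftrightarrow> Hausdorff_space X \<and>
     (\<exists>(E :: 'a set set) (dim :: 'a set \<Rightarrow> nat) (\<Phi> :: 'a set \<Rightarrow> (nat \<Rightarrow> real) \<Rightarrow> 'a).
        pairwise disjnt E \<and> \<Union>E = topspace X \<and>
        (\<forall>e\<in>E. continuous_map (disk (dim e)) X (\<Phi> e) \<and>
               homeomorphic_map (open_disk (dim e)) (subtopology X e) (\<Phi> e)) \<and>
        (\<forall>e\<in>E. \<exists>F\<subseteq>E. finite F \<and> (\<forall>e'\<in>F. dim e' < dim e) \<and>
               \<Phi> e ` disk_boundary (dim e) \<subseteq> \<Union>F) \<and>
        (\<forall>A\<subseteq>topspace X.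
           (\<forall>e\<in>E. closedin (disk (dim e)) {x \<in> topspace (disk (dim e)). \<Phi> e x \<in> A}) \<longrightarrow>
           closedin X A))"

text \<open>
  A linear cohomology operation from degree \<open>l\<close> to degree \<open>m\<close>, on the CW complexes whose
  points are taken from the type \<open>'u\<close>.
\<close>

definition linear_cohomology_operation ::
  "nat \<Rightarrow> nat \<Rightarrow> ('u topology \<Rightarrow> ('u, 'k::field) cochain set \<Rightarrow> ('u, 'k) cochain set) \<Rightarrow> bool" where
  "linear_cohomology_operation l m \<theta> \<longleftrightarrow>
     (\<forall>X. cw_complex X \<longrightarrow> linear_map (cohomology l X) (cohomology m X) (\<theta> X)) \<and>
     (\<forall>X Y f. cw_complex X \<and> cw_complex Y \<and> continuous_map X Y f \<longrightarrow>
        (\<forall>A\<in>carrier (cohomology l Y).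
           cohomology_map m X f (\<theta> Y A) = \<theta> X (cohomology_map l X f A)))"


section \<open>Persistence modules\<close>

text \<open>
  The structure map \<open>pmap M s t\<close> goes from \<open>pobj M t\<close> to \<open>pobj M s\<close>; it is meaningful for
  \<open>s \<le> t\<close>.
\<close>

record ('k, 'v) pmodule =
  pobj :: "real \<Rightarrow> ('k, 'v) module"
  pmap :: "real \<Rightarrow> real \<Rightarrow> 'v \<Rightarrow> 'v"

definition persistence_module :: "('k::field, 'v) pmodule \<Rightarrow> bool" where
  "persistence_module M \<longleftrightarrow>
     (\<forall>r. vspace (pobj M r)) \<and>
     (\<forall>s t. s \<le> t \<longrightarrow> linear_map (pobj M t) (pobj M s) (pmap M s t)) \<and>
     (\<forall>r. \<forall>x\<in>carrier (pobj M r). pmap M r r x = x) \<and>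
     (\<forall>r s t. r \<le> s \<and> s \<le> t \<longrightarrow>
        (\<forall>x\<in>carrier (pobj M t). pmap M r s (pmap M s t x) = pmap M r t x))"

definition pmodule_sum :: "('k, 'v) pmodule \<Rightarrow> ('k, 'w) pmodule \<Rightarrow> ('k, 'v \<times> 'w) pmodule" where
  "pmodule_sum M N =
     \<lparr>pobj = (\<lambda>r. module_sum (pobj M r) (pobj N r)),
      pmap = (\<lambda>s t. map_prod (pmap M s t) (pmap N s t))\<rparr>"

definition pmodule_iso :: "('k::field, 'v) pmodule \<Rightarrow> ('k, 'w) pmodule \<Rightarrow> bool" where
  "pmodule_iso M N \<longleftrightarrow> persistence_module M \<and> persistence_module N \<and>
     (\<exists>\<phi>. (\<forall>r. linear_map (pobj M r) (pobj N r) (\<phi> r) \<and>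
               bij_betw (\<phi> r) (carrier (pobj M r)) (carrier (pobj N r))) \<and>
          (\<forall>s t. s \<le> t \<longrightarrow>
             (\<forall>x\<in>carrier (pobj M t). \<phi> s (pmap M s t x) = pmap N s t (\<phi> t x))))"


section \<open>Image and kernel persistence modules of a cellular R-space\<close>

text \<open>A functor from the poset of reals to spaces; \<open>rmap X s t\<close> is meaningful for \<open>s \<le> t\<close>.\<close>

record 'u rspace =
  robj :: "real \<Rightarrow> 'u topology"
  rmap :: "real \<Rightarrow> real \<Rightarrow> 'u \<Rightarrow> 'u"

definition cellular_rspace :: "'u rspace \<Rightarrow> bool" where
  "cellular_rspace X \<longleftrightarrow>
     (\<forall>r. cw_complex (robj X r)) \<and>
     (\<forall>s t. s \<le> t \<longrightarrow> continuous_map (robj X s) (robj X t) (rmap X s t)) \<and>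
     (\<forall>r. \<forall>x\<in>topspace (robj X r). rmap X r r x = x) \<and>
     (\<forall>r s t. r \<le> s \<and> s \<le> t \<longrightarrow>
        (\<forall>x\<in>topspace (robj X r). rmap X s t (rmap X r s x) = rmap X r t x))"

definition im_pmodule ::
  "nat \<Rightarrow> nat \<Rightarrow> ('u topology \<Rightarrow> ('u, 'k::field) cochain set \<Rightarrow> ('u, 'k) cochain set) \<Rightarrow>
   'u rspace \<Rightarrow> ('k, ('u, 'k) cochain set) pmodule" where
  "im_pmodule l m \<theta> X =
     \<lparr>pobj = (\<lambda>r. (cohomology m (robj X r))
                   \<lparr>carrier := \<theta> (robj X r) ` carrier (cohomology l (robj X r))\<rparr>),
      pmap = (\<lambda>s t. cohomology_map m (robj X s) (rmap X s t))\<rparr>"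

definition ker_pmodule ::
  "nat \<Rightarrow> nat \<Rightarrow> ('u topology \<Rightarrow> ('u, 'k::field) cochain set \<Rightarrow> ('u, 'k) cochain set) \<Rightarrow>
   'u rspace \<Rightarrow> ('k, ('u, 'k) cochain set) pmodule" where
  "ker_pmodule l m \<theta> X =
     \<lparr>pobj = (\<lambda>r. (cohomology l (robj X r))
                   \<lparr>carrier := {A \<in> carrier (cohomology l (robj X r)).
                                  \<theta> (robj X r) A = \<zero>\<^bsub>cohomology m (robj X r)\<^esub>}\<rparr>),
      pmap = (\<lambda>s t. cohomology_map l (robj X s) (rmap X s t))\<rparr>"


section \<open>Vietoris--Rips complexes\<close>

text \<open>
  A simplicial complex \<open>K\<close> is a family of finite nonempty sets closed under nonempty subsets. A point
  of its geometric realization is given by its barycentric coordinates. The realization carries the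
  weak (coherent) topology, so that it is a CW complex also when \<open>K\<close> is not locally finite.
\<close>

definition realized_simplex :: "'v set \<Rightarrow> ('v \<Rightarrow> real) set" where
  "realized_simplex \<sigma> = {\<alpha>. (\<forall>v. 0 \<le> \<alpha> v) \<and> (\<forall>v. v \<notin> \<sigma> \<longrightarrow> \<alpha> v = 0) \<and> sum \<alpha> \<sigma> = 1}"

definition geometric_realization :: "'v set set \<Rightarrow> ('v \<Rightarrow> real) topology" where
  "geometric_realization K = topology (\<lambda>U.
     U \<subseteq> (\<Union>\<sigma>\<in>K. realized_simplex \<sigma>) \<and>
     (\<forall>\<sigma>\<in>K. openin (subtopology (powertop_real UNIV) (realized_simplex \<sigma>))
                     (U \<inter> realized_simplex \<sigma>)))"

lemma openin_geometric_realization: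
  "openin (geometric_realization K) U \<longleftrightarrow>
     U \<subseteq> (\<Union>\<sigma>\<in>K. realized_simplex \<sigma>) \<and>
     (\<forall>\<sigma>\<in>K. openin (subtopology (powertop_real UNIV) (realized_simplex \<sigma>))
                     (U \<inter> realized_simplex \<sigma>))"
proof -
  let ?P = "\<lambda>U. U \<subseteq> (\<Union>\<sigma>\<in>K. realized_simplex \<sigma>) \<and>
     (\<forall>\<sigma>\<in>K. openin (subtopology (powertop_real UNIV) (realized_simplex \<sigma>))
                     (U \<inter> realized_simplex \<sigma>))"
  have "istopology ?P"
    unfolding istopology_def
  proof (rule conjI; intro allI impI)
    fix S T assume S: "?P S" and T: "?P T"
    have "(S \<inter> T) \<inter> realized_simplex \<sigma>
            = (S \<inter> realized_simplex \<sigma>) \<inter> (T \<inter> realized_simplex \<sigma>)" for \<sigma>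
      by blast
    then show "?P (S \<inter> T)"
      using S T by (auto simp: openin_Int)
  next
    fix \<U> assume \<U>: "\<forall>S\<in>\<U>. ?P S"
    have "\<Union>\<U> \<inter> realized_simplex \<sigma> = (\<Union>S\<in>\<U>. S \<inter> realized_simplex \<sigma>)" for \<sigma>
      by blast
    moreover have "openin (subtopology (powertop_real UNIV) (realized_simplex \<sigma>))
                     (\<Union>S\<in>\<U>. S \<inter> realized_simplex \<sigma>)" if "\<sigma> \<in> K" for \<sigma>
      using \<U> that by (intro openin_Union) auto
    ultimately show "?P (\<Union>\<U>)"
      using \<U> by (metis (no_types, lifting) Union_least)
  qed
  then show ?thesis
    by (simp add: geometric_realization_def topology_inverse')
qed

lemma topspace_geometric_realization:
  "topspace (geometric_realization K) = (\<Union>\<sigma>\<in>K. realized_simplex \<sigma>)"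
proof -
  have "openin (geometric_realization K) (\<Union>\<sigma>\<in>K. realized_simplex \<sigma>)"
    unfolding openin_geometric_realization
  proof (intro conjI ballI)
    fix \<tau> assume "\<tau> \<in> K"
    then have "(\<Union>\<sigma>\<in>K. realized_simplex \<sigma>) \<inter> realized_simplex \<tau> = realized_simplex \<tau>"
      by blast
    then show "openin (subtopology (powertop_real UNIV) (realized_simplex \<tau>))
                 ((\<Union>\<sigma>\<in>K. realized_simplex \<sigma>) \<inter> realized_simplex \<tau>)"
      by (simp add: openin_subtopology_refl)
  qed simp
  then show ?thesis
    by (metis openin_geometric_realization openin_subset openin_topspace subset_antisym)
qed

definition mdiameter :: "'v metric \<Rightarrow> 'v set \<Rightarrow> real" where
  "mdiameter X \<sigma> = (SUP (x, y) \<in> \<sigma> \<times> \<sigma>. mdist X x y)"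

definition vr_simplices :: "'v metric \<Rightarrow> real \<Rightarrow> 'v set set" where
  "vr_simplices X r = {\<sigma>. finite \<sigma> \<and> \<sigma> \<noteq> {} \<and> \<sigma> \<subseteq> mspace X \<and> mdiameter X \<sigma> < r}"

text \<open>No case distinction on the sign of \<open>r\<close> is needed.\<close>

lemma vr_simplices_nonpos:
  assumes "r \<le> 0"
  shows "vr_simplices X r = {}"
proof -
  have "\<not> mdiameter X \<sigma> < r" if "finite \<sigma>" and x: "x \<in> \<sigma>" for \<sigma> x
  proof -
    have "mdist X x x \<le> mdiameter X \<sigma>"
      unfolding mdiameter_def
      by (rule cSUP_upper2[of _ _ "(x, x)"]) (use that in \<open>auto intro!: bdd_above_finite\<close>)
    moreover have "0 \<le> mdist X x x"
      by simp
    ultimately show ?thesis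
      using assms by linarith
  qed
  then show ?thesis
    by (auto simp: vr_simplices_def)
qed

definition VR :: "'v metric \<Rightarrow> ('v \<Rightarrow> real) rspace" where
  "VR X = \<lparr>robj = (\<lambda>r. geometric_realization (vr_simplices X r)), rmap = (\<lambda>s t. id)\<rparr>"


section \<open>Wedge sums of metric spaces\<close>

fun gluing_dist :: "'a metric \<Rightarrow> 'a \<Rightarrow> 'b metric \<Rightarrow> 'b \<Rightarrow> 'a + 'b \<Rightarrow> 'a + 'b \<Rightarrow> real" where
  "gluing_dist X x0 Y y0 (Inl x) (Inl x') = mdist X x x'"
| "gluing_dist X x0 Y y0 (Inr y) (Inr y') = mdist Y y y'"
| "gluing_dist X x0 Y y0 (Inl x) (Inr y) = mdist X x x0 + mdist Y y y0"
| "gluing_dist X x0 Y y0 (Inr y) (Inl x) = mdist X x x0 + mdist Y y y0"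

text \<open>
  In the wedge sum the base point \<open>y0\<close> is identified with \<open>x0\<close>; the common base point is
  represented by \<open>Inl x0\<close>.
\<close>

definition wedge_metric :: "'a metric \<Rightarrow> 'a \<Rightarrow> 'b metric \<Rightarrow> 'b \<Rightarrow> ('a + 'b) metric" where
  "wedge_metric X x0 Y y0 =
     metric (Inl ` mspace X \<union> Inr ` (mspace Y - {y0}), gluing_dist X x0 Y y0)"

lemma Metric_space_gluing:
  assumes x0: "x0 \<in> mspace X" and y0: "y0 \<in> mspace Y"
  shows "Metric_space (Inl ` mspace X \<union> Inr ` (mspace Y - {y0})) (gluing_dist X x0 Y y0)"
proof
  show "0 \<le> gluing_dist X x0 Y y0 p q" for p q
    by (cases p; cases q) auto
  show "gluing_dist X x0 Y y0 p q = gluing_dist X x0 Y y0 q p" for p q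
    by (cases p; cases q) (auto simp: mdist_commute)
  show "gluing_dist X x0 Y y0 p q = 0 \<longleftrightarrow> p = q"
    if "p \<in> Inl ` mspace X \<union> Inr ` (mspace Y - {y0})"
       "q \<in> Inl ` mspace X \<union> Inr ` (mspace Y - {y0})" for p q
    using that x0 y0 by (auto simp: add_nonneg_eq_0_iff)
  have tX: "mdist X a c \<le> 2 * e + (mdist X a x0 + mdist X c x0)"
    if "a \<in> mspace X" "c \<in> mspace X" "0 \<le> e" for a c e
    using mdist_triangle[OF that(1) x0 that(2)] that(3) by (simp add: mdist_commute)
  have tY: "mdist Y b d \<le> 2 * e + (mdist Y b y0 + mdist Y d y0)"
    if "b \<in> mspace Y" "d \<in> mspace Y" "0 \<le> e" for b d e
    using mdist_triangle[OF that(1) y0 that(2)] that(3) by (simp add: mdist_commute)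
  have sX: "mdist X c x0 \<le> mdist X a c + mdist X a x0" if "a \<in> mspace X" "c \<in> mspace X" for a c
    using mdist_triangle[OF that(2,1) x0] by (simp add: mdist_commute)
  have sY: "mdist Y d y0 \<le> mdist Y b d + mdist Y b y0" if "b \<in> mspace Y" "d \<in> mspace Y" for b d
    using mdist_triangle[OF that(2,1) y0] by (simp add: mdist_commute)
  show "gluing_dist X x0 Y y0 p u \<le> gluing_dist X x0 Y y0 p q + gluing_dist X x0 Y y0 q u"
    if p: "p \<in> Inl ` mspace X \<union> Inr ` (mspace Y - {y0})"
      and q: "q \<in> Inl ` mspace X \<union> Inr ` (mspace Y - {y0})"
      and u: "u \<in> Inl ` mspace X \<union> Inr ` (mspace Y - {y0})" for p q u
  proof (cases p)
    case (Inl a)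
    note p' = this
    show ?thesis
    proof (cases q)
      case (Inl a')
      then show ?thesis
        using p q u p' x0 mdist_triangle[of a X a'] by (cases u) (auto simp: add.assoc)
    next
      case (Inr b)
      note q' = this
      show ?thesis
      proof (cases u)
        case (Inl c)
        then show ?thesis
          using p u p' q' tX[of a c "mdist Y b y0"] by auto
      next
        case (Inr d)
        then show ?thesis
          using q u p' q' sY[of b d] by auto
      qed
    qed
  next
    case (Inr b)
    note p' = this
    show ?thesis
    proof (cases q)
      case (Inl a)
      note q' = this
      show ?thesis
      proof (cases u)
        case (Inl c)
        then show ?thesis
          using q u p' q' sX[of a c] by auto
      next
        case (Inr d)
        then show ?thesis
          using p u p' q' tY[of b d "mdist X a x0"] by auto
      qed
    next
      case (Inr b')
      then show ?thesis
        using p q u p' y0 mdist_triangle[of b Y b'] by (cases u) (auto simp: add.assoc)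
    qed
  qed
qed

lemma mspace_wedge_metric:
  "x0 \<in> mspace X \<Longrightarrow> y0 \<in> mspace Y \<Longrightarrow>
     mspace (wedge_metric X x0 Y y0) = Inl ` mspace X \<union> Inr ` (mspace Y - {y0})"
  by (simp add: wedge_metric_def Metric_space.mspace_metric[OF Metric_space_gluing])

lemma mdist_wedge_metric:
  "x0 \<in> mspace X \<Longrightarrow> y0 \<in> mspace Y \<Longrightarrow>
     mdist (wedge_metric X x0 Y y0) = gluing_dist X x0 Y y0"
  by (simp add: wedge_metric_def Metric_space.mdist_metric[OF Metric_space_gluing])

definition isometric :: "'a metric \<Rightarrow> 'b metric \<Rightarrow> bool" where
  "isometric X Y \<longleftrightarrow>
     (\<exists>f. bij_betw f (mspace X) (mspace Y) \<and>
          (\<forall>x\<in>mspace X. \<forall>x'\<in>mspace X. mdist Y (f x) (f x') = mdist X x x'))"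

end

theory Submission
  imports Defs
begin

text \<open>
  Restriction to the two subcomplexes is, on reduced cohomology, a bijection from the complex of the
  wedge onto the product, natural in the scale and, by the naturality of the operation, compatible
  with it; the images and kernels then split as well. It is surjective because the collapse onto one
  summand restricts to the identity on that summand and to a constant map on the other. For
  injectivity, a simplex that meets both summands can be enlarged by the base point. Hence the set
  of points with mass less than 1 off one summand deforms linearly, inside the whole complex, to its
  image under the collapse onto that summand. The two such sets form an open cover whose
  intersection contracts linearly to the base point, and the Mayer--Vietoris argument shows that a
  cocycle restricting to coboundaries on both is a coboundary. All spaces involved are CW complexes,
  because a closed simplex is a disk.
\<close>

section \<open>Cochains as functionals on singular chains\<close>

text \<open>The complex of the wedge is in general larger than the wedge of the two complexes, since
  it also has simplices with points of both summands away from the base point. What remains is a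
  combinatorial cone condition, and it suffices because it is used only for straight lines inside
  single simplices. The operation \<theta> is applied to the three complexes alone; the open sets of
  the cover serve a computation with cochains and need no cell structure. Reducedness is essential
  to the splitting: a class pulled back through the collapse restricts to the other summand along a
  constant map, and only in reduced cohomology does this vanish in degree 0 as well. The bijection
  is needed both in the source and in the target degree of \<theta>: for the image, a pair of
  preimages is lifted in the source degree, and injectivity in the target degree identifies the
  resulting classes. At scales \<le> 0 all complexes are empty and there is no base vertex, but
  there all reduced cohomology vanishes.\<close>

abbreviation cocycles :: "nat \<Rightarrow> 'a topology \<Rightarrow> ('a, 'k::field) cochain set" where
  "cocycles n X \<equiv> carrier (cocycle_module n X)"

text \<open>Chains have integer coefficients and cochains have values in a field, hence
  \<open>of_int\<close>. Extending a cochain additively to chains lets chain homotopies act on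
  cochains by composition.\<close>

definition cochain_eval :: "('a, 'k::field) cochain \<Rightarrow> 'a chain \<Rightarrow> 'k" where
  "cochain_eval c x = (\<Sum>s\<in>Poly_Mapping.keys x. of_int (Poly_Mapping.lookup x s) * c s)"

lemma cochain_eval_superset:
  assumes "finite A" "Poly_Mapping.keys x \<subseteq> A"
  shows "cochain_eval c x = (\<Sum>s\<in>A. of_int (Poly_Mapping.lookup x s) * c s)"
  unfolding cochain_eval_def
  by (rule sum.mono_neutral_left) (use assms in \<open>auto simp: in_keys_iff\<close>)

lemma cochain_eval_0 [simp]: "cochain_eval c 0 = 0"
  by (simp add: cochain_eval_def)

lemma cochain_eval_of [simp]: "cochain_eval c (frag_of s) = c s"
  by (simp add: cochain_eval_def)

lemma cochain_eval_add: "cochain_eval c (x + y) = cochain_eval c x + cochain_eval c y"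
proof -
  let ?A = "Poly_Mapping.keys x \<union> Poly_Mapping.keys y"
  have "Poly_Mapping.keys (x + y) \<subseteq> ?A"
    by (rule Poly_Mapping.keys_add)
  then show ?thesis
    by (simp add: cochain_eval_superset[of ?A] lookup_add algebra_simps sum.distrib)
qed

lemma cochain_eval_minus: "cochain_eval c (- x) = - cochain_eval c x"
  using cochain_eval_add[of c x "- x"] by (simp add: eq_neg_iff_add_eq_0 add.commute)

lemma cochain_eval_diff: "cochain_eval c (x - y) = cochain_eval c x - cochain_eval c y"
  using cochain_eval_add[of c x "- y"] by (simp add: cochain_eval_minus)

lemma cochain_eval_add_left: "cochain_eval (\<lambda>s. c s + d s) x = cochain_eval c x + cochain_eval d x"
  and cochain_eval_diff_left: "cochain_eval (\<lambda>s. c s - d s) x = cochain_eval c x - cochain_eval d x"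
  and cochain_eval_cmul_left: "cochain_eval (\<lambda>s. a * c s) x = a * cochain_eval c x"
  by (simp_all add: cochain_eval_def algebra_simps sum.distrib sum_subtractf sum_distrib_left)

lemma cochain_eval_cmul: "cochain_eval c (frag_cmul a x) = of_int a * cochain_eval c x"
proof -
  have "Poly_Mapping.keys (frag_cmul a x) \<subseteq> Poly_Mapping.keys x"
    by (rule keys_cmul)
  then show ?thesis
    by (simp add: cochain_eval_superset[of "Poly_Mapping.keys x"] sum_distrib_left mult.assoc)
qed

lemma cochain_eval_sum: "cochain_eval c (sum f I) = (\<Sum>i\<in>I. cochain_eval c (f i))"
  by (induction I rule: infinite_finite_induct) (auto simp: cochain_eval_add)

lemma cochain_eval_eq_0:
  assumes "\<And>s. s \<in> Poly_Mapping.keys x \<Longrightarrow> c s = 0"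
  shows "cochain_eval c x = 0"
  by (simp add: cochain_eval_def assms)

lemma additive_sum:
  fixes T :: "'a::ab_group_add \<Rightarrow> 'b::ab_group_add"
  assumes "T 0 = 0" "\<And>x y. T (x - y) = T x - T y"
  shows "T (sum f I) = (\<Sum>i\<in>I. T (f i))"
proof -
  have "T (x + y) = T x + T y" for x y
    using assms(2)[of "x + y" y] by simp
  then show ?thesis
    by (induction I rule: infinite_finite_induct) (auto simp: assms(1))
qed

text \<open>A cochain composed with an additive operator is determined by its values on simplices.
  Primitives of coboundaries are later written down in this form.\<close>

lemma cochain_eval_additive:
  assumes "T 0 = 0" "\<And>x y. T (x - y) = T x - T y"
  shows "cochain_eval (\<lambda>s. cochain_eval c (T (frag_of s))) x = cochain_eval c (T x)"
  by (rule frag_induction[of x UNIV]) (auto simp: assms cochain_eval_diff)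

lemma coboundary_eq_cochain_eval:
  assumes "singular_simplex (Suc n) X s"
  shows "coboundary n X c s = cochain_eval c (chain_boundary (Suc n) (frag_of s))"
  using assms by (simp add: coboundary_def chain_boundary_of cochain_eval_sum cochain_eval_cmul
      del: sum.atMost_Suc)

lemma cochain_eval_coboundary:
  assumes "singular_chain (Suc n) X x"
  shows "cochain_eval (coboundary n X c) x = cochain_eval c (chain_boundary (Suc n) x)"
  using assms unfolding singular_chain_def
  by (induction x rule: frag_induction)
     (auto simp: coboundary_eq_cochain_eval cochain_eval_diff chain_boundary_diff)

text \<open>A cocycle is a functional that kills boundaries. The condition ranges over all chains
  because it is applied to chains produced by homotopy operators.\<close>

lemma cocycle_iff:
  "c \<in> cocycles n X \<longleftrightarrow>
     (\<forall>s. \<not> singular_simplex n X s \<longrightarrow> c s = 0) \<and>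
     (\<forall>x. singular_chain (Suc n) X x \<longrightarrow> cochain_eval c (chain_boundary (Suc n) x) = 0)"
  (is "_ \<longleftrightarrow> ?A \<and> ?B")
proof -
  have "coboundary n X c = (\<lambda>s. 0) \<longleftrightarrow> ?B"
  proof
    assume "coboundary n X c = (\<lambda>s. 0)"
    then show ?B
      by (metis cochain_eval_coboundary cochain_eval_eq_0)
  next
    assume ?B
    then have "coboundary n X c s = 0" for s
      by (cases "singular_simplex (Suc n) X s")
         (auto simp: coboundary_eq_cochain_eval singular_chain_of, simp add: coboundary_def)
    then show "coboundary n X c = (\<lambda>s. 0)"
      by blast
  qed
  then show ?thesis
    by (auto simp: cocycle_module_def cochain_module_def)
qed

lemma reduced_coboundaries_0_iff:
  "c \<in> reduced_coboundaries 0 X \<longleftrightarrow>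
     (\<forall>s. \<not> singular_simplex 0 X s \<longrightarrow> c s = 0) \<and> (\<exists>a. \<forall>s. singular_simplex 0 X s \<longrightarrow> c s = a)"
  by (auto simp: reduced_coboundaries_def image_iff fun_eq_iff) 

text \<open>The primitive \<open>b\<close> may take any values off the singular simplices of
  \<open>X\<close>, because the coboundary sees only faces; \<open>b'\<close> is the cut-off.
  Primitives can thus be restricted and extended without adjustment.\<close>

lemma reduced_coboundaries_Suc_iff:
  "c \<in> reduced_coboundaries (Suc n) X \<longleftrightarrow>
     (\<forall>s. \<not> singular_simplex (Suc n) X s \<longrightarrow> c s = 0) \<and>
     (\<exists>b. \<forall>s. singular_simplex (Suc n) X s \<longrightarrow>
            c s = cochain_eval b (chain_boundary (Suc n) (frag_of s)))"
  (is "_ \<longleftrightarrow> ?A \<and> ?B")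
proof
  assume "c \<in> reduced_coboundaries (Suc n) X"
  then obtain b where b: "c = coboundary n X b"
    by (auto simp: reduced_coboundaries_def)
  then show "?A \<and> ?B"
    by (metis coboundary_def coboundary_eq_cochain_eval)
next
  assume *: "?A \<and> ?B"
  then obtain b where b: "\<And>s. singular_simplex (Suc n) X s \<Longrightarrow>
            c s = cochain_eval b (chain_boundary (Suc n) (frag_of s))"
    by blast
  define b' where "b' = (\<lambda>s. if singular_simplex n X s then b s else 0)"
  have "c s = coboundary n X b' s" for s
  proof (cases "singular_simplex (Suc n) X s")
    case True
    then have "singular_simplex n X (singular_face (Suc n) k s)" if "k \<le> Suc n" for k
      using singular_simplex_singular_face[OF True, of k] that by simp
    then have "coboundary n X b' s = coboundary n X b s"
      unfolding coboundary_def b'_def by (auto intro!: sum.cong)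
    then show ?thesis
      by (simp add: b True coboundary_eq_cochain_eval)
  qed (use * in \<open>simp add: coboundary_def\<close>)
  moreover have "b' \<in> carrier (cochain_module n X)"
    by (simp add: b'_def cochain_module_def)
  ultimately show "c \<in> reduced_coboundaries (Suc n) X"
    by (auto simp: reduced_coboundaries_def)
qed

lemma reduced_coboundaries_subset_cocycles:
  "reduced_coboundaries n X \<subseteq> cocycles n X"
proof
  fix c :: "('a, 'b) cochain" assume c: "c \<in> reduced_coboundaries n X"
  show "c \<in> cocycles n X"
  proof (cases n)
    case 0
    then obtain a where a: "\<And>s. singular_simplex 0 X s \<Longrightarrow> c s = a"
      using c by (auto simp: reduced_coboundaries_0_iff)
    have "cochain_eval c (chain_boundary (Suc 0) x) = 0" if "singular_chain (Suc 0) X x" for x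
      using that unfolding singular_chain_def
    proof (induction x rule: frag_induction)
      case (one s)
      then have s: "singular_simplex (Suc 0) X s"
        by simp
      have "singular_simplex 0 X (singular_face (Suc 0) k s)" if "k \<le> Suc 0" for k
        using singular_simplex_singular_face[OF s, of k] that by simp
      then show ?case
        by (simp add: chain_boundary_of cochain_eval_add cochain_eval_minus cochain_eval_cmul
            cochain_eval_diff a)
    qed (auto simp: cochain_eval_diff chain_boundary_diff)
    then show ?thesis
      using c 0 by (auto simp: cocycle_iff reduced_coboundaries_0_iff)
  next
    case (Suc p)
    then obtain b where b: "c = coboundary p X b"
      using c by (auto simp: reduced_coboundaries_def)
    have "cochain_eval c (chain_boundary (Suc n) x) = 0" if x: "singular_chain (Suc n) X x" for x
      using cochain_eval_coboundary[of p X "chain_boundary (Suc n) x" b]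
        singular_chain_boundary[OF x] chain_boundary_boundary[OF x]
      by (simp add: b Suc)
    then show ?thesis
      unfolding cocycle_iff using Suc b by (auto simp: coboundary_def)
  qed
qed

text \<open>Dual of a chain homotopy: the cocycle \<open>c\<close> kills the term in which the
  boundary comes last, so \<open>c\<close> after \<open>F\<close> is the coboundary of
  \<open>c\<close> after \<open>D\<close>. In degree 0 the other term is zero as well and the
  cochain vanishes. No naturality of \<open>D\<close> is asked for; the subdivision operator used
  later has a length that varies with the simplex.\<close>

lemma homotopy_operator_coboundary:
  fixes D :: "nat \<Rightarrow> 'a chain \<Rightarrow> 'b chain" and c :: "('b, 'k::field) cochain"
  assumes D0: "\<And>q. D q 0 = 0" and Ddiff: "\<And>q x y. D q (x - y) = D q x - D q y"
    and D: "\<And>q s. singular_simplex q X s \<Longrightarrow> singular_chain (Suc q) Y (D q (frag_of s))"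
    and F: "\<And>s. singular_simplex n X s \<Longrightarrow>
        chain_boundary (Suc n) (D n (frag_of s)) + D (n - 1) (chain_boundary n (frag_of s)) = F s"
    and c: "c \<in> cocycles n Y"
  shows "(\<lambda>s. if singular_simplex n X s then cochain_eval c (F s) else 0)
           \<in> reduced_coboundaries n X" (is "?f \<in> _")
proof -
  have *: "cochain_eval c (F s) = cochain_eval c (D (n - 1) (chain_boundary n (frag_of s)))"
    if s: "singular_simplex n X s" for s
    using c D[OF s] by (simp add: F[OF s, symmetric] cochain_eval_add cocycle_iff)
  show ?thesis
  proof (cases n)
    case 0
    then show ?thesis
      by (auto simp: reduced_coboundaries_0_iff * chain_boundary_def D0 intro!: exI[of _ 0])
  next
    case (Suc p)
    have "?f s = cochain_eval (\<lambda>t. cochain_eval c (D p (frag_of t)))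
            (chain_boundary n (frag_of s))" if "singular_simplex n X s" for s
      using that by (simp add: * cochain_eval_additive[of "D p"] D0 Ddiff Suc)
    then show ?thesis
      unfolding Suc reduced_coboundaries_Suc_iff by auto
  qed
qed


section \<open>Homotopy invariance\<close>

text \<open>A contraction makes \<open>R\<close> homologous to its image at one point, and cycles of
  positive degree in a point bound. In degree 0 every chain is a cycle, so a difference of two
  simplices is required: its image at the point is 0.\<close>

lemma contractible_cycle_is_boundary:
  assumes Z: "contractible_space Z" and R: "singular_chain q Z R" "chain_boundary q R = 0"
    and q0: "q = 0 \<Longrightarrow> \<exists>a b. R = frag_of a - frag_of b"
  obtains e where "singular_chain (Suc q) Z e" "chain_boundary (Suc q) e = R"
proof (cases "topspace Z = {}")
  case True
  then have "R = 0"
    using R singular_chain_empty by blast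
  then show ?thesis
    using that[of 0] by simp
next
  case False
  obtain a where h: "homotopic_with (\<lambda>x. True) Z Z id (\<lambda>x. a)"
    using Z by (auto simp: contractible_space_def)
  have "continuous_map Z Z (\<lambda>x. a)"
    using homotopic_with_imp_continuous_maps[OF h] by blast
  then have a: "a \<in> topspace Z"
    using False by (auto simp: continuous_map_def)
  have cyc: "singular_relcycle q Z {} R"
    using R by (simp add: singular_cycle)
  have hom: "homologous_rel q Z {} (chain_map q id R) (chain_map q (\<lambda>x. a) R)"
    by (rule homotopic_imp_homologous_rel_chain_maps[where T = "{}", OF _ cyc])
       (use h in simp)
  let ?A = "subtopology Z {a}"
  have top: "topspace ?A = {a}"
    using a by auto
  have cA: "continuous_map Z ?A (\<lambda>x. a)"
    using a by (simp add: continuous_map_in_subtopology)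
  have "singular_relcycle q ?A {} (chain_map q (\<lambda>x. a) R)"
    using singular_relcycle_chain_map[OF cyc cA, of "{}"] by simp
  then have bA: "singular_relboundary q ?A {} (chain_map q (\<lambda>x. a) R)"
  proof (cases "q = 0")
    case True
    then obtain u v where uv: "R = frag_of u - frag_of v"
      using q0 by blast
    have "simplex_map q (\<lambda>x. a) u = simplex_map q (\<lambda>x. a) v"
      by (simp add: simplex_map_def o_def)
    then show ?thesis
      by (simp add: uv chain_map_diff)
  qed (use singular_boundary_eq_cycle_singleton[OF top, of q] in simp)
  have "singular_relboundary q Z {} (chain_map q (\<lambda>x. a) R)"
    using bA singular_boundary_mono[of "{a}" "topspace Z" q Z] a by (simp add: subtopology_topspace)
  with hom have "singular_relboundary q Z {} R"
    using singular_relboundary_add[of q Z "{}" "R - chain_map q (\<lambda>x. a) R" "chain_map q (\<lambda>x. a) R"] R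
    by (simp add: homologous_rel_def chain_map_ident)
  then show ?thesis
    using that by (auto simp: singular_boundary)
qed

text \<open>
  A chain \<open>d\<close> in the prism over the standard simplex induces an operator from the chains of any
  space \<open>X\<close> to the chains of the cylinder on \<open>X\<close>, natural in \<open>X\<close>. Choosing \<open>d\<close> in each degree
  by acyclicity of the prisms gives the prism operator.
\<close>

definition cylinder :: "'a topology \<Rightarrow> (real \<times> 'a) topology" where
  "cylinder X = prod_topology (top_of_set {0..1}) X"

definition simplex_space :: "nat \<Rightarrow> (nat \<Rightarrow> real) topology" where
  "simplex_space q = subtopology (powertop_real UNIV) (standard_simplex q)"

definition prism_op :: "(real \<times> (nat \<Rightarrow> real)) chain \<Rightarrow> nat \<Rightarrow> 'a chain \<Rightarrow> (real \<times> 'a) chain" where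
  "prism_op d q = frag_extend (\<lambda>s. chain_map (Suc q) (map_prod id s) d)"

lemma prism_op_0 [simp]: "prism_op d q 0 = 0"
  and prism_op_diff: "prism_op d q (x - y) = prism_op d q x - prism_op d q y"
  and prism_op_of [simp]: "prism_op d q (frag_of s) = chain_map (Suc q) (map_prod id s) d"
  by (simp_all add: prism_op_def frag_extend_diff)

lemma continuous_map_cylinder:
  "continuous_map X Y g \<Longrightarrow> continuous_map (cylinder X) (cylinder Y) (map_prod id g)"
  unfolding cylinder_def continuous_map_prod_top map_prod_def by simp

lemma continuous_map_cylinder_end:
  "t \<in> {0..1} \<Longrightarrow> continuous_map X (cylinder X) (Pair t)"
  unfolding cylinder_def by (simp add: continuous_map_pairwise o_def)

lemma singular_chain_prism_op:
  assumes d: "singular_chain (Suc q) (cylinder (simplex_space q)) d" and x: "singular_chain q X x"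
  shows "singular_chain (Suc q) (cylinder X) (prism_op d q x)"
  unfolding prism_op_def
proof (rule singular_chain_extend)
  fix s assume "s \<in> Poly_Mapping.keys x"
  then have "continuous_map (simplex_space q) X s"
    using x by (auto simp: singular_chain_def singular_simplex_def simplex_space_def)
  then show "singular_chain (Suc q) (cylinder X) (chain_map (Suc q) (map_prod id s) d)"
    using singular_chain_chain_map[OF d continuous_map_cylinder] by blast
qed

lemma prism_op_chain_map:
  assumes d: "singular_chain (Suc q) (cylinder (simplex_space q)) d"
  shows "prism_op d q (chain_map q g x) = chain_map (Suc q) (map_prod id g) (prism_op d q x)"
proof (rule frag_induction[of x UNIV])
  fix s
  have "chain_map (Suc q) (map_prod id (simplex_map q g s)) d
          = chain_map (Suc q) (map_prod id g \<circ> map_prod id s) d"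
    by (rule chain_map_eq[OF d]) (auto simp: cylinder_def simplex_space_def simplex_map_def)
  then show "prism_op d q (chain_map q g (frag_of s))
               = chain_map (Suc q) (map_prod id g) (prism_op d q (frag_of s))"
    by (simp add: chain_map_compose)
qed (auto simp: prism_op_diff chain_map_diff)

lemma contractible_cylinder_simplex: "contractible_space (cylinder (simplex_space q))"
proof -
  have "contractible_space (top_of_set {0..1::real})"
    by (simp add: convex_imp_contractible)
  moreover have "contractible_space (simplex_space q)"
    unfolding contractible_space_def simplex_space_def
  proof (intro exI)
    let ?D = "subtopology (powertop_real UNIV) (standard_simplex q)"
    define v :: "nat \<Rightarrow> real" where "v = (\<lambda>j. if j = 0 then 1 else 0)"
    have v: "v \<in> standard_simplex q"
      by (simp add: v_def)
    let ?h = "\<lambda>(u, x) i. (1 - u) * x i + u * v i"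
    have "continuous_map (prod_topology (top_of_set {0..1}) ?D) (powertop_real UNIV) ?h"
    proof -
      have "continuous_map (prod_topology (top_of_set {0..1::real}) ?D) euclideanreal
              (\<lambda>z. (1 - fst z) * snd z i + fst z * v i)" for i
      proof -
        have "continuous_map (prod_topology (top_of_set {0..1::real}) ?D) euclideanreal fst"
          using continuous_map_fst continuous_map_into_fulltopology by blast
        moreover have "continuous_map (prod_topology (top_of_set {0..1::real}) ?D) euclideanreal
              (\<lambda>z. snd z i)"
          using continuous_map_compose[OF continuous_map_snd
              continuous_map_from_subtopology[OF continuous_map_product_projection[of i UNIV]]]
          by (simp add: o_def)
        ultimately show ?thesis
          by (intro continuous_intros)
      qed
      then show ?thesis
        by (simp add: continuous_map_componentwise_UNIV case_prod_unfold)
    qed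
    then have "continuous_map (prod_topology (top_of_set {0..1}) ?D) ?D ?h"
      using v by (auto simp: continuous_map_in_subtopology intro!: convex_standard_simplex)
    then show "homotopic_with (\<lambda>x. True) ?D ?D id (\<lambda>x. v)"
      unfolding homotopic_with_def by (intro exI[of _ ?h]) auto
  qed
  ultimately show ?thesis
    by (simp add: cylinder_def contractible_space_prod_topology)
qed

lemma singular_chain_identity:
  "singular_chain q (simplex_space q) (frag_of (restrict id (standard_simplex q)))"
  unfolding singular_chain_of simplex_space_def singular_simplex_def
  by (auto simp: continuous_map_in_subtopology intro: continuous_map_eq[OF continuous_map_id])

text \<open>By naturality one identity suffices: \<open>s\<close> is the image of the identity
  simplex under \<open>s\<close> itself, and \<open>map_prod id s\<close> carries the boundary
  formula assumed for \<open>d\<close> to the formula for \<open>s\<close>.\<close>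

lemma prism_op_boundary:
  fixes d d' :: "(real \<times> (nat \<Rightarrow> real)) chain"
  defines "\<iota> \<equiv> \<lambda>q. frag_of (restrict id (standard_simplex q))"
  assumes d': "q \<noteq> 0 \<Longrightarrow> singular_chain q (cylinder (simplex_space (q - 1))) d'"
    and d: "singular_chain (Suc q) (cylinder (simplex_space q)) d"
    and bd: "chain_boundary (Suc q) d = chain_map q (Pair 1) (\<iota> q) - chain_map q (Pair 0) (\<iota> q)
               - prism_op d' (q - 1) (chain_boundary q (\<iota> q))"
    and x: "singular_chain q X x"
  shows "chain_boundary (Suc q) (prism_op d q x)
           = chain_map q (Pair 1) x - chain_map q (Pair 0) x
             - prism_op d' (q - 1) (chain_boundary q x)"
  using x unfolding singular_chain_def
proof (induction x rule: frag_induction)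
  case (one s)
  then have s: "singular_simplex q X s"
    by simp
  have \<iota>: "singular_chain q (simplex_space q) (\<iota> q)"
    unfolding \<iota>_def by (rule singular_chain_identity)
  have s\<iota>: "chain_map q s (\<iota> q) = frag_of s"
    unfolding \<iota>_def by (rule singular_simplex_chain_map_id[OF s])
  have "chain_map q (map_prod id s) (chain_map q (Pair t) (\<iota> q)) = chain_map q (Pair t) (frag_of s)"
    for t :: real
  proof -
    have "map_prod id s \<circ> Pair t = Pair t \<circ> s"
      by auto
    then show ?thesis
      by (metis chain_map_compose comp_apply s\<iota>)
  qed
  moreover have "chain_map q (map_prod id s) (prism_op d' (q - 1) (chain_boundary q (\<iota> q)))
                   = prism_op d' (q - 1) (chain_boundary q (frag_of s))"
  proof (cases q)
    case (Suc p)
    then show ?thesis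
      using prism_op_chain_map[of p d' s "chain_boundary q (\<iota> q)"] d'
        chain_boundary_chain_map[OF \<iota>, of s] s\<iota> by simp
  qed (simp add: chain_boundary_def)
  ultimately show ?case
    using chain_boundary_chain_map[OF d, of "map_prod id s"] by (simp add: bd chain_map_diff)
qed (auto simp: prism_op_diff chain_boundary_diff chain_map_diff)

lemma prism_chains_exist:
  defines "\<iota> \<equiv> \<lambda>q. frag_of (restrict id (standard_simplex q))"
  obtains d where
    "\<And>q. singular_chain (Suc q) (cylinder (simplex_space q)) (d q)"
    "\<And>q. chain_boundary (Suc q) (d q) = chain_map q (Pair 1) (\<iota> q) - chain_map q (Pair 0) (\<iota> q)
           - prism_op (d (q - 1)) (q - 1) (chain_boundary q (\<iota> q))"
proof -
  let ?Z = "\<lambda>q. cylinder (simplex_space q)"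
  let ?R = "\<lambda>q d'. chain_map q (Pair 1) (\<iota> q) - chain_map q (Pair 0) (\<iota> q)
               - prism_op d' (q - 1) (chain_boundary q (\<iota> q))"
  \<comment> \<open>The next right-hand side is a cycle only if the prism identity holds for the
    boundary of the identity simplex, a cycle in a simplex space. \<open>P\<close> therefore carries
    the identity for cycles of all spaces with that type of points.\<close>
  define P where "P = (\<lambda>q d. singular_chain (Suc q) (?Z q) d \<and>
     (\<forall>(X :: (nat \<Rightarrow> real) topology) x. singular_chain q X x \<and> chain_boundary q x = 0 \<longrightarrow>
        chain_boundary (Suc q) (prism_op d q x) = chain_map q (Pair 1) x - chain_map q (Pair 0) x))"
  have \<iota>: "singular_chain q (simplex_space q) (\<iota> q)" for q
    unfolding \<iota>_def by (rule singular_chain_identity)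
  have ends: "singular_chain q (?Z q) (chain_map q (Pair t) (\<iota> q))" if "t \<in> {0..1}" for q t
    by (rule singular_chain_chain_map[OF \<iota> continuous_map_cylinder_end[OF that]])
  have PI: "P q d" if d': "q \<noteq> 0 \<Longrightarrow> singular_chain q (?Z (q - 1)) d'"
    and d: "singular_chain (Suc q) (?Z q) d" "chain_boundary (Suc q) d = ?R q d'" for q d d'
  proof -
    have "chain_boundary (Suc q) (prism_op d q x) = chain_map q (Pair 1) x - chain_map q (Pair 0) x"
      if "singular_chain q X x" "chain_boundary q x = 0"
      for X :: "(nat \<Rightarrow> real) topology" and x
      using prism_op_boundary[OF d' d(1) _ that(1)] d(2) that(2) by (simp add: \<iota>_def)
    then show ?thesis
      using d(1) unfolding P_def by blast
  qed
  have step: "\<exists>d. singular_chain (Suc (Suc q)) (?Z (Suc q)) d \<and>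
                chain_boundary (Suc (Suc q)) d = ?R (Suc q) d'"
    if d': "P q d'" for q d'
  proof -
    have d'c: "singular_chain (Suc q) (?Z q) d'"
      using d' by (simp add: P_def)
    have b\<iota>: "singular_chain q (simplex_space (Suc q)) (chain_boundary (Suc q) (\<iota> (Suc q)))"
      using singular_chain_boundary[OF \<iota>[of "Suc q"]] by simp
    have b0: "chain_boundary q (chain_boundary (Suc q) (\<iota> (Suc q))) = 0"
      using chain_boundary_boundary[OF \<iota>[of "Suc q"]] by simp
    have "singular_chain (Suc q) (?Z (Suc q)) (?R (Suc q) d')"
      using singular_chain_prism_op[OF d'c b\<iota>] by (simp add: singular_chain_diff ends)
    moreover have "chain_boundary (Suc q) (?R (Suc q) d') = 0"
      using d' b\<iota> b0 chain_boundary_chain_map[OF \<iota>[of "Suc q"], of "Pair (0::real)"]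
        chain_boundary_chain_map[OF \<iota>[of "Suc q"], of "Pair (1::real)"]
      by (auto simp: P_def chain_boundary_diff)
    ultimately show ?thesis
      using contractible_cycle_is_boundary[OF contractible_cylinder_simplex] by blast
  qed
  have "\<exists>d. singular_chain (Suc 0) (?Z 0) d \<and> chain_boundary (Suc 0) d = ?R 0 0"
  proof -
    have "?R 0 0 = frag_of (simplex_map 0 (Pair 1) (restrict id (standard_simplex 0)))
                 - frag_of (simplex_map 0 (Pair 0) (restrict id (standard_simplex 0)))"
      by (simp add: \<iota>_def chain_boundary_def)
    moreover have "singular_chain 0 (?Z 0) (?R 0 0)"
      by (simp add: singular_chain_diff ends chain_boundary_def)
    moreover have "chain_boundary 0 (?R 0 0) = 0"
      by (simp add: chain_boundary_def)
    ultimately show ?thesis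
      using contractible_cycle_is_boundary[OF contractible_cylinder_simplex] by metis
  qed
  then obtain d0 where d0: "singular_chain (Suc 0) (?Z 0) d0" "chain_boundary (Suc 0) d0 = ?R 0 0"
    by blast
  \<comment> \<open>The recursion links \<open>d (Suc q)\<close> to \<open>d q\<close> and leaves
    the formula in degree 0 open, so \<open>d 0\<close> is pinned to \<open>d0\<close>. There
    \<open>q - 1\<close> is 0 again, harmlessly, since the boundary of a 0-simplex is 0.\<close>
  have "\<exists>d. \<forall>q. (P q (d q) \<and> (q = 0 \<longrightarrow> d q = d0)) \<and>
          chain_boundary (Suc (Suc q)) (d (Suc q)) = ?R (Suc q) (d q)"
  proof (rule dependent_nat_choice)
    show "\<exists>d. P 0 d \<and> (0 = (0::nat) \<longrightarrow> d = d0)"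
      using PI[of 0 0 d0] d0 by simp
  next
    fix d' q assume d': "P q d' \<and> (q = 0 \<longrightarrow> d' = d0)"
    then obtain d where d: "singular_chain (Suc (Suc q)) (?Z (Suc q)) d"
      "chain_boundary (Suc (Suc q)) d = ?R (Suc q) d'"
      using step by blast
    have "P (Suc q) d"
      by (rule PI[of "Suc q" d' d]) (use d d' in \<open>auto simp: P_def\<close>)
    then show "\<exists>d. (P (Suc q) d \<and> (Suc q = 0 \<longrightarrow> d = d0)) \<and>
                 chain_boundary (Suc (Suc q)) d = ?R (Suc q) d'"
      using d by auto
  qed
  then obtain d where d: "\<And>q. P q (d q)" "d 0 = d0"
      "\<And>q. chain_boundary (Suc (Suc q)) (d (Suc q)) = ?R (Suc q) (d q)"
    by blast
  have "chain_boundary (Suc q) (d q) = ?R q (d (q - 1))" for q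
    using d(3)[of "q - 1"] d(2) d0(2) by (cases q) (auto simp: chain_boundary_def)
  then show thesis
    using that d(1) by (auto simp: P_def)
qed

text \<open>The homotopy is kept explicit, because the contraction of an intersection of open sets
  is first found in the whole complex and its codomain is narrowed afterwards.\<close>

definition homotopy_between ::
  "'a topology \<Rightarrow> 'b topology \<Rightarrow> ('a \<Rightarrow> 'b) \<Rightarrow> ('a \<Rightarrow> 'b) \<Rightarrow> (real \<times> 'a \<Rightarrow> 'b) \<Rightarrow> bool" where
  "homotopy_between X Y f g H \<longleftrightarrow> continuous_map (cylinder X) Y H \<and>
     (\<forall>x\<in>topspace X. H (0, x) = f x \<and> H (1, x) = g x)"

text \<open>The prism chains pushed forward along \<open>H\<close> form a chain homotopy between the
  chain maps of \<open>f\<close> and \<open>g\<close>; composed with the cocycle it is a primitive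
  of the difference.\<close>

lemma homotopic_pullback_cochain:
  fixes c :: "('b, 'k::field) cochain"
  assumes H: "homotopy_between X Y f g H" and c: "c \<in> cocycles n Y"
  shows "(\<lambda>s. pullback_cochain n X g c s - pullback_cochain n X f c s) \<in> reduced_coboundaries n X"
proof -
  obtain d where d: "\<And>q. singular_chain (Suc q) (cylinder (simplex_space q)) (d q)"
    "\<And>q. chain_boundary (Suc q) (d q) =
           chain_map q (Pair 1) (frag_of (restrict id (standard_simplex q)))
           - chain_map q (Pair 0) (frag_of (restrict id (standard_simplex q)))
           - prism_op (d (q - 1)) (q - 1)
               (chain_boundary q (frag_of (restrict id (standard_simplex q))))"
    using prism_chains_exist by blast
  define D :: "nat \<Rightarrow> 'a chain \<Rightarrow> 'b chain" where
    "D = (\<lambda>q x. chain_map (Suc q) H (prism_op (d q) q x))"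
  have cH: "continuous_map (cylinder X) Y H"
    using H by (simp add: homotopy_between_def)
  have Hend: "simplex_map q H (simplex_map q (Pair 1) s) = simplex_map q g s"
             "simplex_map q H (simplex_map q (Pair 0) s) = simplex_map q f s"
    if "singular_simplex q X s" for q s
  proof -
    have "s x \<in> topspace X" if "x \<in> standard_simplex q" for x
      using \<open>singular_simplex q X s\<close> that by (auto simp: singular_simplex_def continuous_map_def)
    then show "simplex_map q H (simplex_map q (Pair 1) s) = simplex_map q g s"
             "simplex_map q H (simplex_map q (Pair 0) s) = simplex_map q f s"
      using H by (auto simp: simplex_map_def homotopy_between_def fun_eq_iff)
  qed
  have "chain_boundary (Suc n) (D n (frag_of s)) + D (n - 1) (chain_boundary n (frag_of s))
          = frag_of (simplex_map n g s) - frag_of (simplex_map n f s)"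
    if s: "singular_simplex n X s" for s
  proof -
    have s': "singular_chain n X (frag_of s)"
      by (simp add: singular_chain_of s)
    have "chain_boundary (Suc n) (prism_op (d n) n (frag_of s))
           = chain_map n (Pair 1) (frag_of s) - chain_map n (Pair 0) (frag_of s)
             - prism_op (d (n - 1)) (n - 1) (chain_boundary n (frag_of s))"
      by (rule prism_op_boundary[OF _ d(1) d(2) s']) (use d(1)[of "n - 1"] in auto)
    moreover have "chain_map n H (prism_op (d (n - 1)) (n - 1) (chain_boundary n (frag_of s)))
                     = D (n - 1) (chain_boundary n (frag_of s))"
      by (cases n) (auto simp: D_def chain_boundary_def)
    ultimately show ?thesis
      using chain_boundary_chain_map[OF singular_chain_prism_op[OF d(1) s'], of H] Hend[OF s]
      by (simp add: D_def chain_map_diff)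
  qed
  then have "(\<lambda>s. if singular_simplex n X s
         then cochain_eval c (frag_of (simplex_map n g s) - frag_of (simplex_map n f s)) else 0)
           \<in> reduced_coboundaries n X"
    by (intro homotopy_operator_coboundary[of D X Y, OF _ _ _ _ c])
       (auto simp: D_def prism_op_diff chain_map_diff singular_chain_of
             intro!: singular_chain_chain_map[OF _ cH] singular_chain_prism_op d
             simp del: prism_op_of)
  moreover have "(\<lambda>s. pullback_cochain n X g c s - pullback_cochain n X f c s) =
     (\<lambda>s. if singular_simplex n X s
         then cochain_eval c (frag_of (simplex_map n g s) - frag_of (simplex_map n f s)) else 0)"
    by (auto simp: pullback_cochain_def cochain_eval_diff)
  ultimately show ?thesis
    by simp
qed


section \<open>Linear combinations of reduced coboundaries, and pullbacks along constant
  maps\<close>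

lemma sum_alternating_signs: "(\<Sum>k\<le>n. (-1) ^ k :: 'k::ring_1) = (if even n then 1 else 0)"
  by (induction n) auto

lemma reduced_coboundaries_add:
  assumes "c \<in> reduced_coboundaries n X" "d \<in> reduced_coboundaries n X"
  shows "(\<lambda>s. c s + d s) \<in> reduced_coboundaries n X"
proof (cases n)
  case 0
  then show ?thesis
    using assms by (auto simp: reduced_coboundaries_0_iff)
next
  case (Suc p)
  obtain b e where "\<And>s. singular_simplex n X s \<Longrightarrow> c s = cochain_eval b (chain_boundary n (frag_of s))"
    "\<And>s. singular_simplex n X s \<Longrightarrow> d s = cochain_eval e (chain_boundary n (frag_of s))"
    using assms unfolding Suc reduced_coboundaries_Suc_iff by blast
  then have "\<forall>s. singular_simplex n X s \<longrightarrow>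
      c s + d s = cochain_eval (\<lambda>s. b s + e s) (chain_boundary n (frag_of s))"
    by (simp add: cochain_eval_add_left)
  then show ?thesis
    using assms unfolding Suc reduced_coboundaries_Suc_iff by (metis (no_types, lifting) add_0)
qed

lemma reduced_coboundaries_cmul:
  assumes "c \<in> reduced_coboundaries n X"
  shows "(\<lambda>s. a * c s) \<in> reduced_coboundaries n X"
proof (cases n)
  case 0
  then show ?thesis
    using assms by (auto simp: reduced_coboundaries_0_iff)
next
  case (Suc p)
  obtain b where "\<And>s. singular_simplex n X s \<Longrightarrow> c s = cochain_eval b (chain_boundary n (frag_of s))"
    using assms unfolding Suc reduced_coboundaries_Suc_iff by blast
  then have "\<forall>s. singular_simplex n X s \<longrightarrow>
      a * c s = cochain_eval (\<lambda>s. a * b s) (chain_boundary n (frag_of s))"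
    by (simp add: cochain_eval_cmul_left)
  then show ?thesis
    using assms unfolding Suc reduced_coboundaries_Suc_iff by (metis (no_types, lifting) mult_zero_right)
qed

lemma reduced_coboundaries_diff:
  assumes "c \<in> reduced_coboundaries n X" "d \<in> reduced_coboundaries n X"
  shows "(\<lambda>s. c s - d s) \<in> reduced_coboundaries n X"
  using reduced_coboundaries_add[OF assms(1) reduced_coboundaries_cmul[OF assms(2), of "-1"]] by simp

text \<open>The pullback has the constant value \<open>c (\<sigma> n)\<close>. In degree 0 constants
  are reduced coboundaries. For even n > 0 the n + 1 alternating signs add up to 1, so a constant
  cochain is the coboundary of the same constant. For odd n the boundary of
  \<open>\<sigma> (Suc n)\<close> is \<open>\<sigma> n\<close>, and the cocycle vanishes on
  it.\<close>

lemma pullback_const_coboundary: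
  fixes c :: "('b, 'k::field) cochain"
  assumes w: "w \<in> topspace Y" and c: "c \<in> cocycles n Y"
  shows "pullback_cochain n X (\<lambda>x. w) c \<in> reduced_coboundaries n X"
proof -
  define \<sigma> where "\<sigma> = (\<lambda>q. \<lambda>x\<in>standard_simplex q. w)"
  have \<sigma>: "singular_simplex q Y (\<sigma> q)" for q
    using w by (simp add: \<sigma>_def singular_simplex_def)
  have face: "singular_face (Suc q) k (\<sigma> (Suc q)) = \<sigma> q" if "k \<le> Suc q" for k q
    using that by (auto simp: singular_face_def \<sigma>_def simplical_face_in_standard_simplex fun_eq_iff)
  have pb: "pullback_cochain n X (\<lambda>x. w) c s = (if singular_simplex n X s then c (\<sigma> n) else 0)" for s
    by (auto simp: pullback_cochain_def simplex_map_def \<sigma>_def o_def)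
  show ?thesis
  proof (cases "n = 0")
    case True
    then show ?thesis
      unfolding True reduced_coboundaries_0_iff using pb by (auto simp: True)
  next
    case False
    then obtain p where p: "n = Suc p"
      by (cases n) auto
    show ?thesis
    proof (cases "even n")
      case True
      have "cochain_eval (\<lambda>t. c (\<sigma> n)) (chain_boundary n (frag_of s)) = c (\<sigma> n)" for s :: "(nat \<Rightarrow> real) \<Rightarrow> 'a"
        using True p
        by (simp add: chain_boundary_of cochain_eval_sum cochain_eval_cmul sum_alternating_signs
              flip: sum_distrib_right del: sum.atMost_Suc)
      then show ?thesis
        unfolding p reduced_coboundaries_Suc_iff using pb
        by (auto simp: p intro!: exI[of _ "\<lambda>t. c (\<sigma> (Suc p))"])
    next
      case False
      have "0 = cochain_eval c (chain_boundary (Suc n) (frag_of (\<sigma> (Suc n))))"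
        using c \<sigma> by (simp add: cocycle_iff singular_chain_of)
      also have "\<dots> = (\<Sum>k\<le>Suc n. (-1) ^ k * c (\<sigma> n))"
        unfolding chain_boundary_of
        by (auto simp: cochain_eval_sum cochain_eval_cmul face simp del: sum.atMost_Suc intro!: sum.cong)
      also have "\<dots> = c (\<sigma> n)"
        using False by (simp add: sum_alternating_signs flip: sum_distrib_right del: sum.atMost_Suc)
      finally have "pullback_cochain n X (\<lambda>x. w) c = (\<lambda>s. 0)"
        using pb by auto
      then show ?thesis
        by (auto simp: p reduced_coboundaries_Suc_iff intro!: exI[of _ "\<lambda>_. 0"] cochain_eval_eq_0)
    qed
  qed
qed

lemma pullback_cochain_ident:
  assumes "c \<in> cocycles n X" "\<And>x. x \<in> topspace X \<Longrightarrow> f x = x"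
  shows "pullback_cochain n X f c = c"
  using assms by (auto simp: pullback_cochain_def cocycle_iff simplex_map_id_gen)

text \<open>The pullbacks along the identity and along a constant map are cohomologous, and the
  latter is a reduced coboundary in every degree, 0 included.\<close>

lemma contractible_reduced_cohomology:
  fixes c :: "('a, 'k::field) cochain"
  assumes w: "w \<in> topspace Z" and H: "homotopy_between Z Z (\<lambda>x. x) (\<lambda>x. w) H"
    and c: "c \<in> cocycles n Z"
  shows "c \<in> reduced_coboundaries n Z"
  using reduced_coboundaries_diff[OF pullback_const_coboundary[OF w c, of Z]
      homotopic_pullback_cochain[OF H c]]
  by (simp add: pullback_cochain_ident[OF c])

section \<open>Small simplices\<close>

definition small_chain :: "'a set set \<Rightarrow> nat \<Rightarrow> 'a topology \<Rightarrow> 'a chain \<Rightarrow> bool" where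
  "small_chain \<C> p X x \<longleftrightarrow>
     (\<forall>s\<in>Poly_Mapping.keys x. \<exists>V\<in>\<C>. singular_simplex p (subtopology X V) s)"

lemma small_chain_0 [simp]: "small_chain \<C> p X 0"
  by (simp add: small_chain_def)

lemma small_chain_diff:
  "small_chain \<C> p X x \<Longrightarrow> small_chain \<C> p X y \<Longrightarrow> small_chain \<C> p X (x - y)"
  unfolding small_chain_def using keys_diff[of x y] by blast

lemma small_chain_add:
  "small_chain \<C> p X x \<Longrightarrow> small_chain \<C> p X y \<Longrightarrow> small_chain \<C> p X (x + y)"
  unfolding small_chain_def using keys_add[of x y] by blast

lemma small_chain_cmul: "small_chain \<C> p X x \<Longrightarrow> small_chain \<C> p X (frag_cmul a x)"
  unfolding small_chain_def using keys_cmul[of a x] by blast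

lemma small_chain_sum:
  "(\<And>i. i \<in> I \<Longrightarrow> small_chain \<C> p X (f i)) \<Longrightarrow> small_chain \<C> p X (sum f I)"
  by (induction I rule: infinite_finite_induct) (auto intro: small_chain_add)

text \<open>Smallness is tested simplex by simplex, each with its own member of the cover;
  subdivision and its homotopy to the identity never leave that member.\<close>

lemma small_chain_natural_operator:
  assumes "T 0 = 0" "\<And>x y. T (x - y) = T x - T y"
    and T: "\<And>V x. V \<in> \<C> \<Longrightarrow> singular_chain p (subtopology X V) x \<Longrightarrow>
                singular_chain q (subtopology X V) (T x)"
    and x: "small_chain \<C> p X x"
  shows "small_chain \<C> q X (T x)"
proof -
  have "Poly_Mapping.keys x \<subseteq> {s. \<exists>V\<in>\<C>. singular_simplex p (subtopology X V) s}"
    using x by (auto simp: small_chain_def)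
  then show ?thesis
  proof (induction x rule: frag_induction)
    case (one s)
    then obtain V where V: "V \<in> \<C>" "singular_simplex p (subtopology X V) s"
      by blast
    then have "singular_chain q (subtopology X V) (T (frag_of s))"
      using T by (simp add: singular_chain_of)
    then show ?case
      using V(1) by (auto simp: small_chain_def singular_chain_def)
  qed (auto simp: assms(1,2) small_chain_diff)
qed

lemma singular_chain_subdivision_power:
  "singular_chain p X x \<Longrightarrow> singular_chain p X ((singular_subdivision p ^^ m) x)"
  by (induction m) (auto simp: singular_chain_singular_subdivision)

lemma chain_boundary_subdivision_power:
  "singular_chain p X x \<Longrightarrow> chain_boundary p ((singular_subdivision p ^^ m) x)
     = (singular_subdivision (p - Suc 0) ^^ m) (chain_boundary p x)"
  by (induction m)
     (auto simp: chain_boundary_singular_subdivision[OF singular_chain_subdivision_power])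

text \<open>The number of subdivisions must not increase on passing to a face. Adding the bounds of
  all faces to the required number \<open>L p s\<close> forces this recursively.\<close>

fun subdivision_bound ::
  "(nat \<Rightarrow> ((nat \<Rightarrow> real) \<Rightarrow> 'a) \<Rightarrow> nat) \<Rightarrow> nat \<Rightarrow> ((nat \<Rightarrow> real) \<Rightarrow> 'a) \<Rightarrow> nat" where
  "subdivision_bound L 0 s = L 0 s"
| "subdivision_bound L (Suc p) s =
     L (Suc p) s + (\<Sum>k\<le>Suc p. subdivision_bound L p (singular_face (Suc p) k s))"

lemma subdivision_bound_ge: "L p s \<le> subdivision_bound L p s"
  by (cases p) auto

lemma subdivision_bound_face:
  assumes "k \<le> Suc p"
  shows "subdivision_bound L p (singular_face (Suc p) k s) \<le> subdivision_bound L (Suc p) s"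
proof -
  have "subdivision_bound L p (singular_face (Suc p) k s)
          \<le> (\<Sum>k\<le>Suc p. subdivision_bound L p (singular_face (Suc p) k s))"
    by (rule member_le_sum) (use assms in auto)
  then show ?thesis
    by simp
qed

text \<open>
  A simplex \<open>s\<close> is subdivided \<open>N s\<close> times, where \<open>N s\<close> subdivisions make \<open>s\<close> small and
  \<open>N\<close> of a face of \<open>s\<close> is at most \<open>N s\<close>. With \<open>T\<close> a natural chain homotopy from the identity to
  subdivision, \<open>D s = (\<Sum>i<N s. T (Sd\<^sup>i s))\<close> satisfies \<open>\<partial>D s + D\<partial> s = Sd\<^bsup>N s\<^esup> s - s\<close> up to
  the terms \<open>T (Sd\<^sup>i t)\<close> with \<open>t\<close> a face of \<open>s\<close> and \<open>N t \<le> i < N s\<close>, which are small.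
\<close>

lemma cocycle_vanishing_on_small_simplices:
  fixes c :: "('a, 'k::field) cochain"
  assumes op: "\<And>V. V \<in> \<C> \<Longrightarrow> openin X V" and cover: "topspace X \<subseteq> \<Union>\<C>"
    and c: "c \<in> cocycles n X"
    and c0: "\<And>V s. V \<in> \<C> \<Longrightarrow> singular_simplex n (subtopology X V) s \<Longrightarrow> c s = 0"
  shows "c \<in> reduced_coboundaries n X"
proof -
  let ?Sd = "\<lambda>p m. singular_subdivision p ^^ m :: 'a chain \<Rightarrow> 'a chain"
  let ?sm = "\<lambda>p. small_chain \<C> p X"
  obtain T :: "nat \<Rightarrow> 'a chain \<Rightarrow> 'a chain" where T0: "\<And>p. T p 0 = 0"
    and Tdiff: "\<And>p x y. T p (x - y) = T p x - T p y"
    and Tc: "\<And>p Y x. singular_chain p Y x \<Longrightarrow> singular_chain (Suc p) Y (T p x)"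
    and Tb: "\<And>p Y x. singular_chain p Y x \<Longrightarrow>
        chain_boundary (Suc p) (T p x) + T (p - Suc 0) (chain_boundary p x)
          = singular_subdivision p x - x"
    using chain_homotopic_singular_subdivision by metis
  note Tsum = additive_sum[of "T _", OF T0 Tdiff]
  note Sdsum = additive_sum[of "?Sd _ _", OF singular_subdivision_power_0 singular_subdivision_power_diff]
  have Tsm: "?sm (Suc p) (T p x)" if "?sm p x" for p x
    by (rule small_chain_natural_operator[OF T0 Tdiff Tc that])
  have Sdsm: "?sm p (?Sd p m x)" if "?sm p x" for p m x
    by (rule small_chain_natural_operator[OF singular_subdivision_power_0
          singular_subdivision_power_diff singular_chain_subdivision_power that])
  have "\<exists>m. ?sm p (?Sd p m (frag_of s))" if s: "singular_simplex p X s" for p s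
  proof -
    have s': "singular_chain p X (frag_of s)"
      by (simp add: singular_chain_of s)
    obtain m where m: "\<And>k f. \<lbrakk>m \<le> k; f \<in> Poly_Mapping.keys (?Sd p k (frag_of s))\<rbrakk>
                      \<Longrightarrow> \<exists>V \<in> \<C>. f \<in> standard_simplex p \<rightarrow> V"
      using sufficient_iterated_singular_subdivision_exists[OF op cover s'] by blast
    have "singular_simplex p X f" if "f \<in> Poly_Mapping.keys (?Sd p m (frag_of s))" for f
      using singular_chain_subdivision_power[OF s', of m] that
      by (auto simp: singular_chain_def)
    then have "?sm p (?Sd p m (frag_of s))"
      unfolding small_chain_def singular_simplex_subtopology image_subset_iff_funcset
      using m[OF order_refl] by blast
    then show ?thesis ..
  qed
  then obtain L where L: "\<And>p s. singular_simplex p X s \<Longrightarrow> ?sm p (?Sd p (L p s) (frag_of s))"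
    by metis
  define N where "N = subdivision_bound L"
  have N: "?sm p (?Sd p m (frag_of s))" if "singular_simplex p X s" "N p s \<le> m" for p s m
  proof -
    have "m = (m - L p s) + L p s"
      using that(2) subdivision_bound_ge[of L p s] by (simp add: N_def)
    then have "?Sd p m (frag_of s) = ?Sd p (m - L p s) (?Sd p (L p s) (frag_of s))"
      by (metis comp_apply funpow_add)
    then show ?thesis
      using Sdsm[OF L[OF that(1)]] by simp
  qed
  define D where "D = (\<lambda>p. frag_extend (\<lambda>s. \<Sum>i<N p s. T p (?Sd p i (frag_of s))))"
  \<comment> \<open>\<open>Dm\<close> makes the same number of steps on every simplex and is a
    genuine chain homotopy from the identity to iterated subdivision. \<open>D\<close> agrees with
    it on one simplex at a time, with a number of steps depending on that simplex.\<close>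
  define Dm where "Dm = (\<lambda>m p x. \<Sum>i<m. T p (?Sd p i x))"
  have Dm_boundary: "chain_boundary (Suc p) (Dm m p x) + Dm m (p - Suc 0) (chain_boundary p x)
                       = ?Sd p m x - x" if x: "singular_chain p X x" for m p x
  proof (induction m)
    case (Suc m)
    have "chain_boundary (Suc p) (T p (?Sd p m x))
            + T (p - Suc 0) (?Sd (p - Suc 0) m (chain_boundary p x)) = ?Sd p (Suc m) x - ?Sd p m x"
      using Tb[OF singular_chain_subdivision_power[OF x], of m]
      by (simp add: chain_boundary_subdivision_power[OF x])
    moreover have "a + b + (a' + b') = w - v" if "a + a' = u - v" "b + b' = w - u"
      for a b a' b' u v w :: "'a chain"
    proof -
      have "w = b + b' + u" "u = a + a' + v"
        using that by simp_all
      then show ?thesis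
        by (simp add: ac_simps)
    qed
    ultimately have "(chain_boundary (Suc p) (Dm m p x) + chain_boundary (Suc p) (T p (?Sd p m x)))
        + (Dm m (p - Suc 0) (chain_boundary p x)
           + T (p - Suc 0) (?Sd (p - Suc 0) m (chain_boundary p x))) = ?Sd p (Suc m) x - x"
      using Suc.IH by blast
    then show ?case
      by (simp only: Dm_def chain_boundary_add sum.lessThan_Suc)
  qed (simp add: Dm_def)
  define F where "F = (\<lambda>s. chain_boundary (Suc n) (D n (frag_of s))
                             + D (n - 1) (chain_boundary n (frag_of s)))"
  \<comment> \<open>On \<open>s\<close> itself \<open>D\<close> and \<open>Dm (N n s)\<close> agree,
    so \<open>F s\<close> differs from the boundary formula of \<open>Dm\<close> only through the
    faces, which \<open>D\<close> subdivides less often.\<close>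
  have "?sm n (F s + frag_of s)" if s: "singular_simplex n X s" for s
  proof -
    have s': "singular_chain n X (frag_of s)"
      by (simp add: singular_chain_of s)
    let ?b = "chain_boundary n (frag_of s)"
    have "F s + frag_of s = ?Sd n (N n s) (frag_of s) - (Dm (N n s) (n - 1) ?b - D (n - 1) ?b)"
      using Dm_boundary[OF s', of "N n s"]
      by (simp add: F_def D_def Dm_def algebra_simps)
    moreover have "?sm n (Dm (N n s) (n - 1) ?b - D (n - 1) ?b)"
    proof (cases n)
      case 0
      then show ?thesis
        by (simp add: chain_boundary_def Dm_def D_def T0)
    next
      case (Suc p)
      have face: "?sm n (Dm (N n s) p (frag_of t) - D p (frag_of t))"
        if t: "t = singular_face n k s" "k \<le> n" for t k
      proof -
        have t': "singular_simplex p X t"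
          using singular_simplex_singular_face[OF s, of k] t Suc by simp
        have le: "N p t \<le> N n s"
          using subdivision_bound_face[of k p L s] t Suc by (simp add: N_def)
        have "Dm (N n s) p (frag_of t) - D p (frag_of t)
                = (\<Sum>i\<in>{..<N n s} - {..<N p t}. T p (?Sd p i (frag_of t)))"
          by (subst sum_diff) (use le in \<open>auto simp: Dm_def D_def\<close>)
        also have "?sm (Suc p) \<dots>"
          by (intro small_chain_sum Tsm N t') auto
        finally show ?thesis
          by (simp add: Suc)
      qed
      let ?G = "\<lambda>x. Dm (N n s) p x - D p x"
      have "?G 0 = 0"
        by (simp add: Dm_def D_def T0)
      moreover have "?G (x - y) = ?G x - ?G y" for x y
        by (simp add: Dm_def D_def Tdiff singular_subdivision_power_diff frag_extend_diff
            sum_subtractf)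
      ultimately have G: "?G (sum f I) = (\<Sum>i\<in>I. ?G (f i))" for f and I :: "nat set"
        by (rule additive_sum)
      have G': "?G (frag_cmul ((-1) ^ k) x) = frag_cmul ((-1) ^ k) (?G x)" for k x
        using \<open>\<And>x y. ?G (x - y) = ?G x - ?G y\<close>[of 0 x] \<open>?G 0 = 0\<close>
        by (cases "even k") auto
      have "?G ?b = ?G (\<Sum>k\<le>n. frag_cmul ((-1) ^ k) (frag_of (singular_face n k s)))"
        using Suc by (simp add: chain_boundary_of del: sum.atMost_Suc)
      also have "\<dots> = (\<Sum>k\<le>n. ?G (frag_cmul ((-1) ^ k) (frag_of (singular_face n k s))))"
        by (rule G)
      also have "\<dots> = (\<Sum>k\<le>n. frag_cmul ((-1) ^ k) (?G (frag_of (singular_face n k s))))"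
        by (simp only: G')
      also have "?sm n \<dots>"
        by (intro small_chain_sum small_chain_cmul face) auto
      finally show ?thesis
        by (simp add: Suc)
    qed
    ultimately show ?thesis
      using N[OF s] by (simp add: small_chain_diff)
  qed
  then have "cochain_eval c (F s + frag_of s) = 0" if "singular_simplex n X s" for s
    by (intro cochain_eval_eq_0) (use that c0 in \<open>auto simp: small_chain_def\<close>)
  then have "cochain_eval c (F s) + c s = 0" if "singular_simplex n X s" for s
    using that by (simp add: cochain_eval_add)
  then have cF: "cochain_eval c (- F s) = c s" if "singular_simplex n X s" for s
    using that by (simp add: cochain_eval_minus add.inverse_unique)
  \<comment> \<open>The cocycle kills \<open>F s + frag_of s\<close>, hence has the value
    \<open>- c s\<close> on \<open>F s\<close>. Reversing the sign of \<open>D\<close> makes the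
    resulting coboundary equal to \<open>c\<close>.\<close>
  have "(\<lambda>s. if singular_simplex n X s then cochain_eval c (- F s) else 0) \<in> reduced_coboundaries n X"
  proof (rule homotopy_operator_coboundary[where D = "\<lambda>q x. - D q x", OF _ _ _ _ c])
    show "singular_chain (Suc q) X (- D q (frag_of s))" if "singular_simplex q X s" for q s
      using that unfolding D_def
      by (auto simp: singular_chain_minus singular_chain_of
               intro!: singular_chain_sum Tc singular_chain_subdivision_power)
  qed (auto simp: D_def F_def frag_extend_diff chain_boundary_minus)
  moreover have "(\<lambda>s. if singular_simplex n X s then cochain_eval c (- F s) else 0) = c"
    using c by (auto simp: cF cocycle_iff)
  ultimately show ?thesis
    by simp
qed


section \<open>A Mayer--Vietoris argument for two open sets\<close>

text \<open>Primitives on \<open>U\<close> and on \<open>V\<close> differ on the overlap by a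
  cocycle, which bounds there. The correction extends to \<open>U\<close>, so the primitives can be
  made to agree and be glued; the error of the glued primitive vanishes on simplices that lie in
  \<open>U\<close> or in \<open>V\<close>. In degree 0 the primitives are two scalars, compared at a
  point of the overlap, whence \<open>ne\<close>.\<close>

lemma mayer_vietoris_injective:
  fixes c :: "('a, 'k::field) cochain"
  assumes U: "openin X U" and V: "openin X V" and cover: "topspace X \<subseteq> U \<union> V"
    and ne: "U \<inter> V \<noteq> {}"
    and UV: "\<And>q (e :: ('a, 'k) cochain). e \<in> cocycles q (subtopology X (U \<inter> V)) \<Longrightarrow>
                e \<in> reduced_coboundaries q (subtopology X (U \<inter> V))"
    and c: "c \<in> cocycles n X"
    and cU: "pullback_cochain n (subtopology X U) id c \<in> reduced_coboundaries n (subtopology X U)"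
    and cV: "pullback_cochain n (subtopology X V) id c \<in> reduced_coboundaries n (subtopology X V)"
  shows "c \<in> reduced_coboundaries n X"
proof -
  let ?S = "\<lambda>q A s. singular_simplex q (subtopology X A) s"
  let ?ev = "\<lambda>b q s. cochain_eval b (chain_boundary q (frag_of s))"
  have S_Int: "?S q U s \<Longrightarrow> ?S q V s \<Longrightarrow> ?S q (U \<inter> V) s" for q s
    by (auto simp: singular_simplex_subtopology)
  have S_X: "?S q A s \<Longrightarrow> singular_simplex q X s" for q A s
    by (simp add: singular_simplex_subtopology)
  have restr: "pullback_cochain n (subtopology X A) id c s = c s" if "?S n A s" for A s
    using that simplex_map_id_gen[of n "subtopology X A" s id] by (simp add: pullback_cochain_def)
  \<comment> \<open>It suffices to find a reduced coboundary of \<open>X\<close> that agrees with \<open>c\<close> on \<open>U\<close> and on \<open>V\<close>.\<close>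
  have suffices: ?thesis if e: "e \<in> reduced_coboundaries n X"
    and "\<And>A s. A \<in> {U, V} \<Longrightarrow> ?S n A s \<Longrightarrow> c s = e s" for e
  proof -
    let ?c = "\<lambda>s. c s - e s"
    have "e \<in> cocycles n X"
      using e reduced_coboundaries_subset_cocycles by blast
    then have "?c \<in> cocycles n X"
      using c by (simp add: cocycle_iff cochain_eval_diff_left)
    then have "?c \<in> reduced_coboundaries n X"
      by (rule cocycle_vanishing_on_small_simplices[where \<C> = "{U, V}", rotated 2])
         (use U V cover that in auto)
    then show ?thesis
      using reduced_coboundaries_add[OF _ e] by fastforce
  qed
  show ?thesis
  proof (cases n)
    case 0
    obtain a b where a: "\<And>s. ?S 0 U s \<Longrightarrow> c s = a" and b: "\<And>s. ?S 0 V s \<Longrightarrow> c s = b"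
      using cU cV restr unfolding 0 reduced_coboundaries_0_iff by (metis (no_types, lifting))
    obtain w where "w \<in> U \<inter> V" "w \<in> topspace X"
      using ne U openin_subset by blast
    then have "?S 0 (U \<inter> V) (\<lambda>x\<in>standard_simplex 0. w)"
      by (auto simp: singular_simplex_def)
    then have "?S 0 U (\<lambda>x\<in>standard_simplex 0. w)" "?S 0 V (\<lambda>x\<in>standard_simplex 0. w)"
      by (auto intro: singular_simplex_mono)
    then have "a = b"
      using a b by metis
    then show ?thesis
      by (intro suffices[of "\<lambda>s. if singular_simplex 0 X s then a else 0"])
         (auto simp: 0 reduced_coboundaries_0_iff a b S_X)
  next
    case (Suc p)
    obtain a b where a: "\<And>s. ?S n U s \<Longrightarrow> c s = ?ev a n s" and b: "\<And>s. ?S n V s \<Longrightarrow> c s = ?ev b n s"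
      using cU cV restr unfolding Suc reduced_coboundaries_Suc_iff by (metis (no_types, lifting))
    have bd: "singular_chain p (subtopology X A) (chain_boundary n (frag_of s))" if "?S n A s" for A s
      using singular_chain_boundary[of n "subtopology X A" "frag_of s"] that Suc
      by (simp add: singular_chain_of)
    have ev_cong: "cochain_eval f x = cochain_eval g x"
      if "singular_chain p (subtopology X A) x" "\<And>s. ?S p A s \<Longrightarrow> f s = g s"
      for f g :: "('a, 'k) cochain" and A x
      using that unfolding cochain_eval_def singular_chain_def by (intro sum.cong) auto
    define e where "e = (\<lambda>s. if ?S p (U \<inter> V) s then a s - b s else 0)"
    have "e \<in> cocycles p (subtopology X (U \<inter> V))"
      unfolding cocycle_iff
    proof (intro conjI allI impI)
      fix x assume x: "singular_chain (Suc p) (subtopology X (U \<inter> V)) x"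
      then show "cochain_eval e (chain_boundary (Suc p) x) = 0"
        unfolding singular_chain_def
      proof (induction x rule: frag_induction)
        case (one s)
        then have s: "?S n (U \<inter> V) s" "?S n U s" "?S n V s"
          using singular_simplex_mono[of _ X "U \<inter> V" s] by (auto simp: Suc)
        have "?ev e n s = ?ev (\<lambda>s. a s - b s) n s"
          by (rule ev_cong[OF bd[OF s(1)]]) (simp add: e_def)
        also have "\<dots> = ?ev a n s - ?ev b n s"
          by (rule cochain_eval_diff_left)
        also have "\<dots> = 0"
          using a[OF s(2)] b[OF s(3)] by simp
        finally show ?case
          by (simp add: Suc)
      qed (auto simp: chain_boundary_diff cochain_eval_diff)
    qed (simp add: e_def)
    then have eB: "e \<in> reduced_coboundaries p (subtopology X (U \<inter> V))"
      by (rule UV)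
    \<comment> \<open>A cochain on \<open>U\<close> with the coboundary of \<open>a\<close> that agrees with \<open>b\<close> on \<open>U \<inter> V\<close>.\<close>
    obtain a' where a': "\<And>s. ?S n U s \<Longrightarrow> c s = ?ev a' n s" "\<And>s. ?S p (U \<inter> V) s \<Longrightarrow> a' s = b s"
    proof (cases p)
      case 0
      \<comment> \<open>Here the reduced coboundary is a scalar. A constant 0-cochain has zero
        coboundary, so it may be subtracted on all of \<open>U\<close>.\<close>
      obtain k where k: "\<And>s. ?S 0 (U \<inter> V) s \<Longrightarrow> e s = k"
        using eB unfolding 0 reduced_coboundaries_0_iff by blast
      have k0: "?ev (\<lambda>s. k) n s = 0" for s :: "(nat \<Rightarrow> real) \<Rightarrow> 'a"
        by (simp add: Suc 0 chain_boundary_of cochain_eval_add cochain_eval_cmul cochain_eval_diff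
            cochain_eval_minus)
      show ?thesis
      proof
        show "c s = ?ev (\<lambda>s. a s - k) n s" if "?S n U s" for s
          using a[OF that] k0[of s] by (simp add: cochain_eval_diff_left)
        show "a s - k = b s" if "?S p (U \<inter> V) s" for s
          using k[of s] that 0 by (simp add: e_def algebra_simps)
      qed
    next
      case (Suc r)
      \<comment> \<open>\<open>k\<close> has values on all simplices, so its coboundary can be
        subtracted from \<open>a\<close> on all of \<open>U\<close>. This leaves the coboundary of
        \<open>a\<close> unchanged, a boundary having no boundary.\<close>
      obtain k where k: "\<And>s. ?S p (U \<inter> V) s \<Longrightarrow> e s = ?ev k p s"
        using eB unfolding Suc reduced_coboundaries_Suc_iff by blast
      have k0: "?ev (\<lambda>t. ?ev k p t) n s = 0" if "?S n U s" for s
      proof -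
        have "?ev (\<lambda>t. ?ev k p t) n s = cochain_eval k (chain_boundary p (chain_boundary n (frag_of s)))"
          by (rule cochain_eval_additive) (auto simp: chain_boundary_diff)
        also have "chain_boundary p (chain_boundary n (frag_of s)) = 0"
          using chain_boundary_boundary[of n "subtopology X U" "frag_of s"] that \<open>n = Suc p\<close>
          by (simp add: singular_chain_of)
        finally show ?thesis
          by simp
      qed
      show ?thesis
      proof
        show "c s = ?ev (\<lambda>s. a s - ?ev k p s) n s" if "?S n U s" for s
          using a[OF that] k0[OF that] by (simp add: cochain_eval_diff_left)
        show "a s - ?ev k p s = b s" if "?S p (U \<inter> V) s" for s
          using k[OF that] that by (simp add: e_def algebra_simps)
      qed
    qed
    \<comment> \<open>Simplices in both sets get \<open>a'\<close>, which equals \<open>b\<close>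
      there; hence \<open>f\<close> acts as \<open>a'\<close> on \<open>U\<close> and as
      \<open>b\<close> on \<open>V\<close>.\<close>
    define f where "f = (\<lambda>s. if ?S p U s then a' s else b s)"
    show ?thesis
    proof (rule suffices)
      show "(\<lambda>s. if singular_simplex n X s then ?ev f n s else 0) \<in> reduced_coboundaries n X"
        unfolding Suc reduced_coboundaries_Suc_iff by auto
      show "c s = (if singular_simplex n X s then ?ev f n s else 0)"
        if A: "A \<in> {U, V}" and s: "?S n A s" for A s
      proof -
        have "A = U \<or> A = V"
          using A by blast
        then have "?ev f n s = c s"
        proof
          assume [simp]: "A = U"
          have "?ev f n s = ?ev a' n s"
            by (rule ev_cong[OF bd[OF s]]) (simp add: f_def)
          then show ?thesis
            using a'(1) s by simp
        next
          assume [simp]: "A = V"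
          have "?ev f n s = ?ev b n s"
            by (rule ev_cong[OF bd[OF s]]) (auto simp: f_def a'(2) S_Int)
          then show ?thesis
            using b s by simp
        qed
        then show ?thesis
          using S_X[OF s] by simp
      qed
    qed
  qed
qed

section \<open>The standard simplex is a disk\<close>

lemma continuous_on_Max:
  fixes f :: "'i \<Rightarrow> 'a::topological_space \<Rightarrow> real"
  assumes "finite I" "I \<noteq> {}" "\<And>i. i \<in> I \<Longrightarrow> continuous_on S (f i)"
  shows "continuous_on S (\<lambda>x. Max ((\<lambda>i. f i x) ` I))"
  using assms
proof (induction I rule: finite_ne_induct)
  case (insert i I)
  then have "continuous_on S (\<lambda>x. max (f i x) (Max ((\<lambda>i. f i x) ` I)))"
    by (intro continuous_on_max) auto
  then show ?case
    using insert.hyps by simp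
qed auto

text \<open>
  In coordinates centred at the barycentre, \<open>gauge n\<close> is the Minkowski functional of the standard
  simplex; the homeomorphism with the disk rescales every ray from the barycentre.
\<close>

definition centred :: "nat \<Rightarrow> (nat \<Rightarrow> real) \<Rightarrow> nat \<Rightarrow> real" where
  "centred n x = (\<lambda>i. if i \<le> n then x i - 1 / (real n + 1) else 0)"

text \<open>The barycentric coordinate y i + 1 / (n + 1) is nonnegative iff - (n + 1) * y i \<le> 1;
  hence the maximum and the factor.\<close>

definition simplex_gauge :: "nat \<Rightarrow> (nat \<Rightarrow> real) \<Rightarrow> real" where
  "simplex_gauge n y = (real n + 1) * Max ((\<lambda>i. - y i) ` {..n})"

text \<open>The last centred coordinate is minus the sum of the others, so the first
  \<open>n\<close> serve as Euclidean coordinates and vanish together only at the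
  barycentre.\<close>

definition radius :: "nat \<Rightarrow> (nat \<Rightarrow> real) \<Rightarrow> real" where
  "radius n y = sqrt (\<Sum>i<n. (y i)\<^sup>2)"

text \<open>At the barycentre the quotient is 0 / 0, which is 0 by convention: the centre of the
  disk.\<close>

definition simplex_to_disk :: "nat \<Rightarrow> (nat \<Rightarrow> real) \<Rightarrow> nat \<Rightarrow> real" where
  "simplex_to_disk n x =
     (\<lambda>i. if i < n then centred n x i * simplex_gauge n (centred n x) / radius n (centred n x) else 0)"

lemma simplex_gauge_ge: "i \<le> n \<Longrightarrow> - ((real n + 1) * y i) \<le> simplex_gauge n y"
  unfolding simplex_gauge_def
  using mult_left_mono[OF Max_ge[of "(\<lambda>i. - y i) ` {..n}" "- y i"], of "real n + 1"] by simp

lemma simplex_gauge_attained: "\<exists>i\<le>n. simplex_gauge n y = - ((real n + 1) * y i)"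
proof -
  have "Max ((\<lambda>i. - y i) ` {..n}) \<in> (\<lambda>i. - y i) ` {..n}"
    by (rule Max_in) auto
  then obtain i where "i \<le> n" "Max ((\<lambda>i. - y i) ` {..n}) = - y i"
    by (metis (mono_tags, lifting) atMost_iff imageE)
  then show ?thesis
    by (auto simp: simplex_gauge_def simp del: Max_eq_iff)
qed

lemma simplex_gauge_scale:
  assumes "0 \<le> s" "\<And>i. i \<le> n \<Longrightarrow> y' i = s * y i"
  shows "simplex_gauge n y' = s * simplex_gauge n y"
proof (rule antisym)
  obtain i where i: "i \<le> n" "simplex_gauge n y' = - ((real n + 1) * y' i)"
    using simplex_gauge_attained by blast
  then have "simplex_gauge n y' = s * (- ((real n + 1) * y i))"
    using assms by simp
  also have "\<dots> \<le> s * simplex_gauge n y"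
    using simplex_gauge_ge[OF i(1), of y] assms(1) by (rule mult_left_mono)
  finally show "simplex_gauge n y' \<le> s * simplex_gauge n y" .
next
  obtain i where i: "i \<le> n" "simplex_gauge n y = - ((real n + 1) * y i)"
    using simplex_gauge_attained by blast
  then have "s * simplex_gauge n y = - ((real n + 1) * y' i)"
    using assms by simp
  also have "\<dots> \<le> simplex_gauge n y'"
    using simplex_gauge_ge[OF i(1)] .
  finally show "s * simplex_gauge n y \<le> simplex_gauge n y'" .
qed

lemma sum_zero_nonneg_imp_zero:
  fixes y :: "nat \<Rightarrow> real"
  assumes "(\<Sum>i\<le>n. y i) = 0" "\<And>i. i \<le> n \<Longrightarrow> 0 \<le> y i" "i \<le> n"
  shows "y i = 0"
  using sum_nonneg_eq_0_iff[of "{..n}" y] assms by auto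

text \<open>If the maximum of the - y i were \<le> 0, all y i would be nonnegative with sum 0, hence
  all 0.\<close>

lemma simplex_gauge_pos:
  assumes y: "(\<Sum>i\<le>n. y i) = 0" and i: "i \<le> n" "y i \<noteq> 0"
  shows "0 < simplex_gauge n y"
proof (rule ccontr)
  assume "\<not> 0 < simplex_gauge n y"
  then have "- ((real n + 1) * y j) \<le> 0" if "j \<le> n" for j
    using simplex_gauge_ge[OF that, of y] by linarith
  then have "0 \<le> y j" if "j \<le> n" for j
    using that by (fastforce simp: zero_le_mult_iff)
  then show False
    using sum_zero_nonneg_imp_zero[OF y, of i] i by blast
qed

lemma sum_zero_last:
  fixes y :: "nat \<Rightarrow> real"
  assumes "(\<Sum>i\<le>n. y i) = 0"
  shows "y n = - (\<Sum>i<n. y i)"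
  using assms by (simp flip: lessThan_Suc_atMost)

lemma radius_eq_0_iff: "radius n y = 0 \<longleftrightarrow> (\<forall>i<n. y i = 0)"
  by (auto simp: radius_def sum_nonneg_eq_0_iff)

lemma radius_nonneg [simp]: "0 \<le> radius n y"
  by (simp add: radius_def sum_nonneg)

lemma radius_scale: "0 \<le> s \<Longrightarrow> (\<And>i. i < n \<Longrightarrow> y' i = s * y i) \<Longrightarrow> radius n y' = s * radius n y"
  by (simp add: radius_def power_mult_distrib real_sqrt_mult flip: sum_distrib_left)

lemma abs_le_radius: "i < n \<Longrightarrow> \<bar>y i\<bar> \<le> radius n y"
  unfolding radius_def using member_le_sum[of i "{..<n}" "\<lambda>i. (y i)\<^sup>2"]
  by (intro real_le_rsqrt) auto

lemma sum_centred: "x \<in> standard_simplex n \<Longrightarrow> (\<Sum>i\<le>n. centred n x i) = 0"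
  by (simp add: centred_def standard_simplex_def sum_subtractf add.commute)

lemma centred_eq_0_iff:
  assumes "x \<in> standard_simplex n"
  shows "radius n (centred n x) = 0 \<longleftrightarrow> (\<forall>i\<le>n. centred n x i = 0)"
  using sum_zero_last[OF sum_centred[OF assms]] by (auto simp: radius_eq_0_iff le_less)

lemma simplex_gauge_centred_nonneg:
  assumes "x \<in> standard_simplex n"
  shows "0 \<le> simplex_gauge n (centred n x)"
proof (cases "\<exists>i\<le>n. centred n x i \<noteq> 0")
  case True
  then show ?thesis
    using simplex_gauge_pos[OF sum_centred[OF assms]] by fastforce
next
  case False
  then show ?thesis
    using simplex_gauge_ge[of 0 n "centred n x"] by simp
qed

lemma simplex_gauge_centred_0:
  "(\<And>i. i \<le> n \<Longrightarrow> centred n x i = 0) \<Longrightarrow> simplex_gauge n (centred n x) = 0"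
  using simplex_gauge_attained[of n "centred n x"] by auto

text \<open>Rescaling a ray by gauge / radius turns the gauge into the Euclidean radius; at the
  barycentre both are 0.\<close>

lemma radius_simplex_to_disk:
  assumes x: "x \<in> standard_simplex n"
  shows "radius n (simplex_to_disk n x) = simplex_gauge n (centred n x)"
proof (cases "radius n (centred n x) = 0")
  case True
  then have "simplex_gauge n (centred n x) = 0"
    using centred_eq_0_iff[OF x] simplex_gauge_centred_0 by blast
  then show ?thesis
    by (simp add: simplex_to_disk_def radius_eq_0_iff)
next
  case False
  have "radius n (simplex_to_disk n x)
          = simplex_gauge n (centred n x) / radius n (centred n x) * radius n (centred n x)"
    by (rule radius_scale)
       (use simplex_gauge_centred_nonneg[OF x] in \<open>auto simp: simplex_to_disk_def\<close>)
  then show ?thesis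
    using False by simp
qed

text \<open>In terms of \<open>x\<close> the gauge is 1 - (n + 1) * min x i, so it reaches 1 exactly
  on the boundary faces. The strict inequality later matches the open cell with the open
  disk.\<close>

lemma simplex_gauge_centred:
  assumes x: "x \<in> standard_simplex n"
  shows "simplex_gauge n (centred n x) \<le> 1"
    and "simplex_gauge n (centred n x) < 1 \<longleftrightarrow> (\<forall>i\<le>n. 0 < x i)"
proof -
  have eq: "- ((real n + 1) * centred n x i) = 1 - (real n + 1) * x i" if "i \<le> n" for i
    using that by (simp add: centred_def field_simps)
  have pos: "0 \<le> (real n + 1) * x i" for i
    using x by (simp add: standard_simplex_def)
  obtain i where i: "i \<le> n" "simplex_gauge n (centred n x) = 1 - (real n + 1) * x i"
    using simplex_gauge_attained[of n "centred n x"] eq by metis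
  then show "simplex_gauge n (centred n x) \<le> 1"
    using pos by simp
  show "simplex_gauge n (centred n x) < 1 \<longleftrightarrow> (\<forall>i\<le>n. 0 < x i)"
  proof
    assume *: "simplex_gauge n (centred n x) < 1"
    show "\<forall>i\<le>n. 0 < x i"
    proof (intro allI impI)
      fix j assume "j \<le> n"
      then have "0 < (real n + 1) * x j"
        using * simplex_gauge_ge[of j n "centred n x"] eq by simp
      then show "0 < x j"
        by (simp add: zero_less_mult_iff)
    qed
  next
    assume "\<forall>i\<le>n. 0 < x i"
    then show "simplex_gauge n (centred n x) < 1"
      using i by simp
  qed
qed

text \<open>Only the barycentre is delicate. A centred coordinate divided by the radius is at most 1
  in absolute value, so the image is bounded coordinatewise by the gauge, which tends to 0
  there.\<close>

lemma continuous_on_simplex_to_disk: "continuous_on (standard_simplex n) (simplex_to_disk n)"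
proof (rule continuous_on_coordinatewise_then_product)
  fix i
  let ?S = "standard_simplex n" and ?g = "\<lambda>x. simplex_gauge n (centred n x)"
    and ?r = "\<lambda>x. radius n (centred n x)"
  have coord: "continuous_on ?S (\<lambda>x. x j)" for j
    by (rule continuous_on_subset[OF continuous_on_product_coordinates]) simp
  have cen: "continuous_on ?S (\<lambda>x. centred n x j)" for j
    unfolding centred_def by (cases "j \<le> n") (auto intro!: continuous_intros coord)
  have g: "continuous_on ?S ?g"
    unfolding simplex_gauge_def by (intro continuous_intros continuous_on_Max cen) auto
  have r: "continuous_on ?S ?r"
    unfolding radius_def by (intro continuous_intros cen)
  show "continuous_on ?S (\<lambda>x. simplex_to_disk n x i)"
  proof (cases "i < n")
    case True
    have "((\<lambda>x. centred n x i * ?g x / ?r x) \<longlongrightarrow> centred n z i * ?g z / ?r z) (at z within ?S)"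
      if z: "z \<in> ?S" for z
    proof (cases "?r z = 0")
      case False
      then show ?thesis
        using g r cen z by (intro tendsto_intros) (auto simp: continuous_on_def)
    next
      case True
      then have "?g z = 0"
        using centred_eq_0_iff[OF z] simplex_gauge_centred_0 by blast
      then have lim: "(?g \<longlongrightarrow> 0) (at z within ?S)"
        using g z by (auto simp: continuous_on_def)
      have bound: "norm (centred n x i * ?g x / ?r x) \<le> ?g x" if x: "x \<in> ?S" for x
      proof (cases "?r x = 0")
        case False
        then have "\<bar>centred n x i\<bar> / ?r x \<le> 1"
          using abs_le_radius[OF \<open>i < n\<close>, of "centred n x"] radius_nonneg[of n "centred n x"]
          using False by (auto simp: divide_le_eq_1 less_le)
        then show ?thesis
          using mult_left_le_one_le[of "?g x" "\<bar>centred n x i\<bar> / ?r x"]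
            simplex_gauge_centred_nonneg[OF x] by (simp add: abs_mult)
      qed (use simplex_gauge_centred_nonneg[OF x] in simp)
      have "((\<lambda>x. centred n x i * ?g x / ?r x) \<longlongrightarrow> 0) (at z within ?S)"
        by (rule Lim_null_comparison[OF _ lim], unfold eventually_at_filter)
           (rule always_eventually, use bound in blast)
      then show ?thesis
        using True by simp
    qed
    then show ?thesis
      using True by (simp add: continuous_on_def simplex_to_disk_def)
  qed (simp add: simplex_to_disk_def)
qed

lemma topspace_disk: "topspace (disk n) = {x. (\<forall>i\<ge>n. x i = 0) \<and> radius n x \<le> 1}"
  by (auto simp: disk_def topspace_Euclidean_space radius_def)

lemma inj_on_simplex_to_disk: "inj_on (simplex_to_disk n) (standard_simplex n)"
proof (rule inj_onI)
  fix x x' assume x: "x \<in> standard_simplex n" and x': "x' \<in> standard_simplex n"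
    and eq: "simplex_to_disk n x = simplex_to_disk n x'"
  let ?y = "centred n x" and ?y' = "centred n x'"
  let ?g = "simplex_gauge n ?y" and ?r = "radius n ?y" and ?r' = "radius n ?y'"
  have g: "?g = simplex_gauge n ?y'"
    using radius_simplex_to_disk[OF x] radius_simplex_to_disk[OF x'] eq by simp
  have "?y i = ?y' i" if "i \<le> n" for i
  proof (cases "?g = 0")
    case True
    then show ?thesis
      using that simplex_gauge_pos[OF sum_centred[OF x], of i]
        simplex_gauge_pos[OF sum_centred[OF x'], of i] g by fastforce
  next
    case False
    then have r: "?r \<noteq> 0" "?r' \<noteq> 0"
      using centred_eq_0_iff[OF x] centred_eq_0_iff[OF x'] simplex_gauge_centred_0 g by metis+
    \<comment> \<open>Points with the same image lie on one ray from the barycentre, with ratio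
      \<open>s\<close> of their radii. Their gauges agree, so homogeneity forces s = 1.\<close>
    define s where "s = ?r' / ?r"
    have s: "0 \<le> s"
      by (simp add: s_def)
    have *: "?y' i = s * ?y i" if "i < n" for i
      using fun_cong[OF eq, of i] that r False g by (simp add: simplex_to_disk_def s_def field_simps)
    moreover have "?y' n = s * ?y n"
      using sum_zero_last[OF sum_centred[OF x]] sum_zero_last[OF sum_centred[OF x']] *
      by (simp flip: sum_distrib_left)
    ultimately have **: "?y' i = s * ?y i" if "i \<le> n" for i
      using that by (cases "i = n") auto
    have "s = 1"
      using simplex_gauge_scale[OF s **] g False by simp
    then show ?thesis
      using **[OF that] by simp
  qed
  then have "x i = x' i" if "i \<le> n" for i
    using that by (simp add: centred_def)
  then show "x = x'"
    using x x' by (auto simp: standard_simplex_def fun_eq_iff) (metis not_le)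
qed

lemma simplex_to_disk_image: "simplex_to_disk n ` standard_simplex n = topspace (disk n)"
proof
  show "simplex_to_disk n ` standard_simplex n \<subseteq> topspace (disk n)"
    using radius_simplex_to_disk simplex_gauge_centred(1)
    by (auto simp: topspace_disk) (auto simp: simplex_to_disk_def)
next
  show "topspace (disk n) \<subseteq> simplex_to_disk n ` standard_simplex n"
  proof
    fix z assume z: "z \<in> topspace (disk n)"
    let ?N = "real n + 1"
    \<comment> \<open>The lift of \<open>z\<close> to the hyperplane of vectors with sum 0.\<close>
    define y where "y = (\<lambda>i. if i < n then z i else if i = n then - (\<Sum>i<n. z i) else 0)"
    have y0: "(\<Sum>i\<le>n. y i) = 0"
      by (simp add: y_def flip: lessThan_Suc_atMost)
    have ry: "radius n y = radius n z"
      by (simp add: radius_def y_def)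
    \<comment> \<open>The factor for which \<open>s * y\<close> has gauge \<open>radius n z\<close>.
      As this is at most 1, the translate of \<open>s * y\<close> to the barycentre lies in the
      simplex.\<close>
    define s where "s = (if radius n z = 0 then 0 else radius n z / simplex_gauge n y)"
    have gpos: "0 < simplex_gauge n y" if "radius n z \<noteq> 0"
    proof -
      obtain i where "i < n" "z i \<noteq> 0"
        using \<open>radius n z \<noteq> 0\<close> radius_eq_0_iff by blast
      then show ?thesis
        using simplex_gauge_pos[OF y0, of i] by (simp add: y_def)
    qed
    have s0: "0 \<le> s"
      using gpos by (auto simp: s_def)
    have sg: "s * simplex_gauge n y = radius n z"
      using gpos by (cases "radius n z = 0") (auto simp: s_def)
    define x where "x = (\<lambda>i. if i \<le> n then 1 / ?N + s * y i else 0)"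
    have cx: "centred n x i = s * y i" if "i \<le> n" for i
      using that by (simp add: centred_def x_def)
    have gx: "simplex_gauge n (centred n x) = radius n z"
      using simplex_gauge_scale[OF s0 cx] sg by simp
    have x0: "0 \<le> x i" for i
    proof (cases "i \<le> n")
      case True
      have "- (?N * centred n x i) \<le> 1"
        using simplex_gauge_ge[OF True, of "centred n x"] gx z by (simp add: topspace_disk)
      moreover have "?N * x i = 1 + ?N * centred n x i"
        using True by (simp add: centred_def field_simps)
      ultimately have "0 \<le> ?N * x i"
        by linarith
      then show ?thesis
        by (simp add: zero_le_mult_iff)
    qed (simp add: x_def)
    have x1: "(\<Sum>i\<le>n. x i) = 1"
      using y0 by (simp add: x_def sum.distrib add.commute flip: sum_distrib_left)
    have "x i \<le> 1" for i
    proof (cases "i \<le> n")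
      case True
      then show ?thesis
        using x1 member_le_sum[of i "{..n}" x] x0 by auto
    qed (simp add: x_def)
    then have x: "x \<in> standard_simplex n"
      using x0 x1 by (auto simp: standard_simplex_def x_def)
    have rx: "radius n (centred n x) = s * radius n z"
      using radius_scale[OF s0, of n "centred n x" y] cx ry by simp
    have "simplex_to_disk n x i = z i" for i
    proof (cases "i < n")
      case True
      show ?thesis
      proof (cases "radius n z = 0")
        case True
        then show ?thesis
          using \<open>i < n\<close> by (simp add: simplex_to_disk_def rx radius_eq_0_iff[of n z])
      next
        case False
        then have "s \<noteq> 0"
          using gpos by (auto simp: s_def)
        then show ?thesis
          using \<open>i < n\<close> False cx[of i] by (simp add: simplex_to_disk_def gx rx y_def)
      qed
    qed (use z in \<open>simp add: simplex_to_disk_def topspace_disk\<close>)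
    then show "z \<in> simplex_to_disk n ` standard_simplex n"
      using x by (metis ext image_eqI)
  qed
qed

text \<open>A continuous bijection from a compact space to a Hausdorff space; no inverse has to be
  written down.\<close>

lemma homeomorphic_map_simplex_to_disk:
  "homeomorphic_map (subtopology (powertop_real UNIV) (standard_simplex n)) (disk n) (simplex_to_disk n)"
proof (rule continuous_imp_homeomorphic_map)
  let ?S = "subtopology (powertop_real UNIV) (standard_simplex n)"
  show "compact_space ?S"
    using compactin_standard_simplex compactin_subspace by blast
  show "Hausdorff_space (disk n)"
    unfolding disk_def Euclidean_space_def
    by (intro Hausdorff_space_subtopology) (simp add: Hausdorff_space_product_topology)
  show "simplex_to_disk n ` topspace ?S = topspace (disk n)"
    by (simp add: simplex_to_disk_image)
  show "inj_on (simplex_to_disk n) (topspace ?S)"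
    by (simp add: inj_on_simplex_to_disk)
  have "continuous_map ?S (powertop_real UNIV) (simplex_to_disk n)"
    using continuous_on_simplex_to_disk by (simp add: euclidean_product_topology)
  then show "continuous_map ?S (disk n) (simplex_to_disk n)"
    using simplex_to_disk_image[of n] topspace_disk[of n]
    by (auto simp: disk_def Euclidean_space_def subtopology_subtopology continuous_map_in_subtopology
        topspace_Euclidean_space)
qed

section \<open>Geometric realizations\<close>

definition abstract_complex :: "'v set set \<Rightarrow> bool" where
  "abstract_complex K \<longleftrightarrow>
     (\<forall>\<sigma>\<in>K. finite \<sigma> \<and> \<sigma> \<noteq> {}) \<and> (\<forall>\<sigma>\<in>K. \<forall>\<tau>. \<tau> \<subseteq> \<sigma> \<and> \<tau> \<noteq> {} \<longrightarrow> \<tau> \<in> K)"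

definition simplex_topology :: "'v set \<Rightarrow> ('v \<Rightarrow> real) topology" where
  "simplex_topology \<sigma> = subtopology (powertop_real UNIV) (realized_simplex \<sigma>)"

lemma topspace_simplex_topology [simp]: "topspace (simplex_topology \<sigma>) = realized_simplex \<sigma>"
  by (simp add: simplex_topology_def)

lemma realized_simplex_mono:
  assumes "finite \<tau>" "\<sigma> \<subseteq> \<tau>"
  shows "realized_simplex \<sigma> \<subseteq> realized_simplex \<tau>"
proof
  fix \<alpha> assume \<alpha>: "\<alpha> \<in> realized_simplex \<sigma>"
  have "sum \<alpha> \<sigma> = sum \<alpha> \<tau>"
    by (rule sum.mono_neutral_left) (use assms \<alpha> in \<open>auto simp: realized_simplex_def\<close>)
  then show "\<alpha> \<in> realized_simplex \<tau>"
    using \<alpha> assms by (auto simp: realized_simplex_def)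
qed

lemma openin_realization:
  "openin (geometric_realization K) U \<longleftrightarrow>
     U \<subseteq> topspace (geometric_realization K) \<and>
     (\<forall>\<sigma>\<in>K. openin (simplex_topology \<sigma>) (U \<inter> realized_simplex \<sigma>))"
  by (simp add: openin_geometric_realization topspace_geometric_realization simplex_topology_def)

lemma realized_simplex_subset:
  "\<sigma> \<in> K \<Longrightarrow> realized_simplex \<sigma> \<subseteq> topspace (geometric_realization K)"
  by (auto simp: topspace_geometric_realization)

lemma closedin_realization:
  "closedin (geometric_realization K) C \<longleftrightarrow>
     C \<subseteq> topspace (geometric_realization K) \<and>
     (\<forall>\<sigma>\<in>K. closedin (simplex_topology \<sigma>) (C \<inter> realized_simplex \<sigma>))"
proof -
  have "(topspace (geometric_realization K) - C) \<inter> realized_simplex \<sigma>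
          = topspace (simplex_topology \<sigma>) - C \<inter> realized_simplex \<sigma>" if "\<sigma> \<in> K" for \<sigma>
    using realized_simplex_subset[OF that] by auto
  then show ?thesis
    by (auto simp: closedin_def openin_realization)
qed

lemma continuous_map_from_realization:
  "continuous_map (geometric_realization K) Y f \<longleftrightarrow>
     (\<forall>\<sigma>\<in>K. continuous_map (simplex_topology \<sigma>) Y f)"
proof -
  have *: "{x \<in> topspace (geometric_realization K). f x \<in> V} \<inter> realized_simplex \<sigma>
          = {x \<in> realized_simplex \<sigma>. f x \<in> V}" if "\<sigma> \<in> K" for \<sigma> V
    using realized_simplex_subset[OF that] by auto
  show ?thesis
  proof (intro iffI ballI)
    fix \<sigma> assume f: "continuous_map (geometric_realization K) Y f" and \<sigma>: "\<sigma> \<in> K"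
    show "continuous_map (simplex_topology \<sigma>) Y f"
      unfolding continuous_map_def topspace_simplex_topology
    proof (intro conjI allI impI)
      show "f \<in> realized_simplex \<sigma> \<rightarrow> topspace Y"
        using f realized_simplex_subset[OF \<sigma>] by (auto simp: continuous_map_def)
      show "openin (simplex_topology \<sigma>) {x \<in> realized_simplex \<sigma>. f x \<in> V}" if "openin Y V" for V
        using openin_continuous_map_preimage[OF f that] \<sigma>
        unfolding openin_realization *[OF \<sigma>, of V, symmetric] by blast
    qed
  next
    assume f: "\<forall>\<sigma>\<in>K. continuous_map (simplex_topology \<sigma>) Y f"
    show "continuous_map (geometric_realization K) Y f"
      unfolding continuous_map_def
    proof (intro conjI allI impI)
      show "f \<in> topspace (geometric_realization K) \<rightarrow> topspace Y"
        using f by (fastforce simp: topspace_geometric_realization continuous_map_def)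
      show "openin (geometric_realization K) {x \<in> topspace (geometric_realization K). f x \<in> V}"
        if "openin Y V" for V
        unfolding openin_realization
        using openin_continuous_map_preimage[OF _ that, of "simplex_topology _" f] f * by auto
    qed
  qed
qed

lemma continuous_map_into_simplex:
  "continuous_map X (simplex_topology \<sigma>) f \<longleftrightarrow>
     f \<in> topspace X \<rightarrow> realized_simplex \<sigma> \<and> (\<forall>v. continuous_map X euclideanreal (\<lambda>x. f x v))"
  by (auto simp: simplex_topology_def continuous_map_in_subtopology continuous_map_componentwise_UNIV
      image_subset_iff_funcset)

lemma continuous_map_simplex_inclusion:
  "\<sigma> \<in> K \<Longrightarrow> continuous_map (simplex_topology \<sigma>) (geometric_realization K) (\<lambda>\<alpha>. \<alpha>)"
  using continuous_map_from_realization[of K "geometric_realization K" "\<lambda>\<alpha>. \<alpha>"] by simp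

lemma continuous_map_simplex_coordinate:
  "continuous_map (simplex_topology \<sigma>) euclideanreal (\<lambda>\<alpha>. \<alpha> v)"
  unfolding simplex_topology_def
  using continuous_map_product_projection[of v UNIV "\<lambda>_. euclideanreal"]
  by (simp add: continuous_map_from_subtopology)

lemma continuous_map_realization_coordinate:
  "continuous_map (geometric_realization K) euclideanreal (\<lambda>\<alpha>. \<alpha> v)"
  by (simp add: continuous_map_from_realization continuous_map_simplex_coordinate)

text \<open>The weak topology is finer than that of the product, so the coordinates give a
  continuous injection into a Hausdorff space.\<close>

lemma Hausdorff_geometric_realization: "Hausdorff_space (geometric_realization K)"
proof -
  have "continuous_map (geometric_realization K) (powertop_real UNIV) (\<lambda>\<alpha>. \<alpha>)"
    by (simp add: continuous_map_componentwise_UNIV continuous_map_realization_coordinate)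
  then show ?thesis
    by (rule Hausdorff_space_injective_preimage[rotated])
       (auto simp: Hausdorff_space_product_topology)
qed

text \<open>An open subset of the closed simplex is the trace of an open set of the product, and
  that set is open on every simplex at once. So the weak topology induces nothing finer on a single
  simplex.\<close>

lemma subtopology_realized_simplex:
  assumes "\<sigma> \<in> K"
  shows "subtopology (geometric_realization K) (realized_simplex \<sigma>) = simplex_topology \<sigma>"
proof (rule topology_eq[THEN iffD2], intro allI iffI)
  fix U assume "openin (subtopology (geometric_realization K) (realized_simplex \<sigma>)) U"
  then obtain O' where "openin (geometric_realization K) O'" "U = O' \<inter> realized_simplex \<sigma>"
    by (auto simp: openin_subtopology)
  then show "openin (simplex_topology \<sigma>) U"
    using assms by (simp add: openin_realization)
next
  fix U assume "openin (simplex_topology \<sigma>) U"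
  then obtain O' where O': "openin (powertop_real UNIV) O'" "U = O' \<inter> realized_simplex \<sigma>"
    by (auto simp: simplex_topology_def openin_subtopology)
  let ?O = "O' \<inter> topspace (geometric_realization K)"
  have "?O \<inter> realized_simplex \<tau> = O' \<inter> realized_simplex \<tau>" if "\<tau> \<in> K" for \<tau>
    using realized_simplex_subset[OF that] by auto
  then have "openin (geometric_realization K) ?O"
    using O'(1) by (auto simp: openin_realization simplex_topology_def openin_subtopology_Int)
  moreover have "U = ?O \<inter> realized_simplex \<sigma>"
    using O'(2) realized_simplex_subset[OF assms] by auto
  ultimately show "openin (subtopology (geometric_realization K) (realized_simplex \<sigma>)) U"
    by (auto simp: openin_subtopology)
qed

subsection \<open>Cells\<close>

definition open_simplex :: "'v set \<Rightarrow> ('v \<Rightarrow> real) set" where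
  "open_simplex \<sigma> = {\<alpha> \<in> realized_simplex \<sigma>. \<forall>v\<in>\<sigma>. 0 < \<alpha> v}"

definition support :: "('v \<Rightarrow> real) \<Rightarrow> 'v set" where
  "support \<alpha> = {v. \<alpha> v \<noteq> 0}"

lemma support_subset: "\<alpha> \<in> realized_simplex \<sigma> \<Longrightarrow> support \<alpha> \<subseteq> \<sigma>"
  by (auto simp: support_def realized_simplex_def)

lemma support_open_simplex:
  assumes "\<alpha> \<in> open_simplex \<sigma>"
  shows "support \<alpha> = \<sigma>"
proof
  show "support \<alpha> \<subseteq> \<sigma>"
    using assms by (simp add: open_simplex_def support_subset)
  show "\<sigma> \<subseteq> support \<alpha>"
    using assms by (force simp: open_simplex_def support_def)
qed

lemma in_open_simplex_support:
  assumes \<alpha>: "\<alpha> \<in> realized_simplex \<sigma>" and fin: "finite \<sigma>"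
  shows "\<alpha> \<in> open_simplex (support \<alpha>)" "support \<alpha> \<noteq> {}"
proof -
  have "sum \<alpha> (support \<alpha>) = sum \<alpha> \<sigma>"
    by (rule sum.mono_neutral_left[OF fin support_subset[OF \<alpha>]]) (auto simp: support_def)
  then have "sum \<alpha> (support \<alpha>) = 1"
    using \<alpha> by (simp add: realized_simplex_def)
  moreover from this show "support \<alpha> \<noteq> {}"
    by auto
  ultimately show "\<alpha> \<in> open_simplex (support \<alpha>)"
    using \<alpha> by (auto simp: open_simplex_def realized_simplex_def support_def less_le)
qed

lemma open_simplex_nonempty:
  assumes "finite \<sigma>" "\<sigma> \<noteq> {}"
  shows "open_simplex \<sigma> \<noteq> {}"
proof -
  have "(\<lambda>v. if v \<in> \<sigma> then 1 / real (card \<sigma>) else 0) \<in> open_simplex \<sigma>"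
    using assms by (auto simp: open_simplex_def realized_simplex_def card_gt_0_iff)
  then show ?thesis
    by blast
qed

text \<open>Enumerating the vertices identifies \<sigma> with a standard simplex; \<Phi> inverts its
  homeomorphism to the disk. The second clause records which points of the disk go to the open
  cell.\<close>

lemma simplex_characteristic_map:
  assumes \<sigma>: "finite \<sigma>" "\<sigma> \<noteq> {}"
  obtains \<Phi> where "homeomorphic_map (disk (card \<sigma> - 1)) (simplex_topology \<sigma>) \<Phi>"
    "\<And>z. z \<in> topspace (disk (card \<sigma> - 1)) \<Longrightarrow> \<Phi> z \<in> open_simplex \<sigma> \<longleftrightarrow> radius (card \<sigma> - 1) z < 1"
proof -
  define n where "n = card \<sigma> - 1"
  have card: "card \<sigma> = card {..n}"
    using \<sigma> by (simp add: n_def card_gt_0_iff Suc_diff_1)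
  then obtain b where b: "bij_betw b {..n} \<sigma>"
    using \<sigma>(1) by (metis finite_atMost finite_same_card_bij)
  define c where "c = the_inv_into {..n} b"
  have c: "bij_betw c \<sigma> {..n}"
    unfolding c_def by (rule bij_betw_the_inv_into[OF b])
  have cb: "c (b i) = i" if "i \<le> n" for i
    using that b by (simp add: c_def the_inv_into_f_f bij_betw_imp_inj_on)
  have bc: "b (c v) = v" if "v \<in> \<sigma>" for v
    using that b by (simp add: c_def f_the_inv_into_f_bij_betw)
  have bmem: "b i \<in> \<sigma>" if "i \<le> n" for i
    using that b by (auto simp: bij_betw_def)
  have cmem: "c v \<le> n" if "v \<in> \<sigma>" for v
    using that c by (auto simp: bij_betw_def)
  let ?S = "subtopology (powertop_real UNIV) (standard_simplex n)"
  define f where "f = (\<lambda>x v. if v \<in> \<sigma> then x (c v) else 0 :: real)"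
  define g where "g = (\<lambda>\<alpha> i. if i \<le> n then \<alpha> (b i) else 0 :: real)"
  have f: "f x \<in> realized_simplex \<sigma>" if "x \<in> standard_simplex n" for x
  proof -
    have "sum (f x) \<sigma> = (\<Sum>v\<in>\<sigma>. x (c v))"
      by (rule sum.cong) (auto simp: f_def)
    also have "\<dots> = sum x {..n}"
      by (rule sum.reindex_bij_betw[OF c])
    finally show ?thesis
      using that by (auto simp: f_def realized_simplex_def standard_simplex_def)
  qed
  have g: "g \<alpha> \<in> standard_simplex n" if "\<alpha> \<in> realized_simplex \<sigma>" for \<alpha>
  proof -
    have "sum (g \<alpha>) {..n} = (\<Sum>i\<le>n. \<alpha> (b i))"
      by (rule sum.cong) (auto simp: g_def)
    also have "\<dots> = sum \<alpha> \<sigma>"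
      by (rule sum.reindex_bij_betw[OF b])
    finally have "sum (g \<alpha>) {..n} = 1"
      using that by (simp add: realized_simplex_def)
    moreover have "\<alpha> v \<le> 1" if "v \<in> \<sigma>" for v
      using member_le_sum[OF that, of \<alpha>] \<sigma>(1) \<open>\<alpha> \<in> realized_simplex \<sigma>\<close>
      by (auto simp: realized_simplex_def)
    ultimately show ?thesis
      using that by (auto simp: g_def standard_simplex_def realized_simplex_def bmem)
  qed
  have hg: "homeomorphic_map (simplex_topology \<sigma>) ?S g"
    unfolding homeomorphic_map_maps
  proof (intro exI[of _ f], unfold homeomorphic_maps_def, intro conjI ballI)
    show "continuous_map (simplex_topology \<sigma>) ?S g"
      unfolding continuous_map_in_subtopology continuous_map_componentwise_UNIV
      using g continuous_map_simplex_coordinate by (auto simp: g_def)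
    have "continuous_map ?S euclideanreal (\<lambda>x. x i)" for i
      using continuous_map_product_projection[of i UNIV "\<lambda>_. euclideanreal"]
      by (simp add: continuous_map_from_subtopology)
    then show "continuous_map ?S (simplex_topology \<sigma>) f"
      unfolding continuous_map_into_simplex using f by (auto simp: f_def)
    show "f (g \<alpha>) = \<alpha>" if "\<alpha> \<in> topspace (simplex_topology \<sigma>)" for \<alpha>
      using that by (auto simp: f_def g_def fun_eq_iff cmem bc realized_simplex_def)
    show "g (f x) = x" if "x \<in> topspace ?S" for x
      using that by (auto simp: f_def g_def fun_eq_iff cb bmem standard_simplex_def)
  qed
  then have "homeomorphic_map (simplex_topology \<sigma>) (disk n) (simplex_to_disk n \<circ> g)"
    using homeomorphic_map_compose homeomorphic_map_simplex_to_disk by blast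
  then obtain \<Phi> where \<Phi>: "homeomorphic_maps (simplex_topology \<sigma>) (disk n) (simplex_to_disk n \<circ> g) \<Phi>"
    by (auto simp: homeomorphic_map_maps)
  show thesis
  proof
    show "homeomorphic_map (disk (card \<sigma> - 1)) (simplex_topology \<sigma>) \<Phi>"
      using \<Phi> homeomorphic_maps_sym homeomorphic_map_maps unfolding n_def by blast
    show "\<Phi> z \<in> open_simplex \<sigma> \<longleftrightarrow> radius (card \<sigma> - 1) z < 1"
      if z: "z \<in> topspace (disk (card \<sigma> - 1))" for z
    proof -
      have \<Phi>z: "\<Phi> z \<in> realized_simplex \<sigma>" "simplex_to_disk n (g (\<Phi> z)) = z"
        using \<Phi> z by (auto simp: homeomorphic_maps_def n_def continuous_map_def)
      have "radius n z = simplex_gauge n (centred n (g (\<Phi> z)))"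
        using radius_simplex_to_disk[OF g[OF \<Phi>z(1)]] \<Phi>z(2) by simp
      then have "radius n z < 1 \<longleftrightarrow> (\<forall>i\<le>n. 0 < \<Phi> z (b i))"
        using simplex_gauge_centred(2)[OF g[OF \<Phi>z(1)]] by (simp add: g_def)
      also have "\<dots> \<longleftrightarrow> (\<forall>v\<in>\<sigma>. 0 < \<Phi> z v)"
        using bmem cmem bc by metis
      finally show ?thesis
        using \<Phi>z(1) by (simp add: open_simplex_def n_def)
    qed
  qed
qed

text \<open>The cells are the open simplices. The boundary of a cell lies in the open simplices of
  its finitely many proper faces. The weak topology is tested on closed simplices, onto which the
  characteristic maps are homeomorphisms and hence closed.\<close>

lemma cw_complex_geometric_realization:
  assumes K: "abstract_complex K"
  shows "cw_complex (geometric_realization K)"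
proof -
  let ?X = "geometric_realization K"
  have fin: "finite \<sigma>" "\<sigma> \<noteq> {}" if "\<sigma> \<in> K" for \<sigma>
    using K that by (auto simp: abstract_complex_def)
  have face: "\<tau> \<in> K" if "\<sigma> \<in> K" "\<tau> \<subseteq> \<sigma>" "\<tau> \<noteq> {}" for \<sigma> \<tau>
    using K that unfolding abstract_complex_def by blast
  have "\<exists>\<Phi>. homeomorphic_map (disk (card \<sigma> - 1)) (simplex_topology \<sigma>) \<Phi> \<and>
          (\<forall>z\<in>topspace (disk (card \<sigma> - 1)). \<Phi> z \<in> open_simplex \<sigma> \<longleftrightarrow> radius (card \<sigma> - 1) z < 1)"
    if "\<sigma> \<in> K" for \<sigma>
    by (rule simplex_characteristic_map[OF fin[OF that]]) blast
  then obtain \<Phi> where \<Phi>: "\<And>\<sigma>. \<sigma> \<in> K \<Longrightarrow>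
            homeomorphic_map (disk (card \<sigma> - 1)) (simplex_topology \<sigma>) (\<Phi> \<sigma>)"
    and \<Phi>_open: "\<And>\<sigma> z. \<sigma> \<in> K \<Longrightarrow> z \<in> topspace (disk (card \<sigma> - 1)) \<Longrightarrow>
            \<Phi> \<sigma> z \<in> open_simplex \<sigma> \<longleftrightarrow> radius (card \<sigma> - 1) z < 1"
    by metis
  \<comment> \<open>Cells are indexed by themselves as point sets, so the vertex set has to be
    recovered from the cell: it is the support of any of its points.\<close>
  define V where "V = (\<lambda>e :: ('a \<Rightarrow> real) set. support (SOME \<alpha>. \<alpha> \<in> e))"
  have V: "V (open_simplex \<sigma>) = \<sigma>" if "\<sigma> \<in> K" for \<sigma>
    unfolding V_def using support_open_simplex open_simplex_nonempty[OF fin[OF that]]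
    by (metis some_in_eq)
  let ?E = "open_simplex ` K"
  define dim where "dim = (\<lambda>e. card (V e) - 1)"
  have dim: "dim (open_simplex \<sigma>) = card \<sigma> - 1" if "\<sigma> \<in> K" for \<sigma>
    by (simp add: dim_def V that)
  have disk_open: "open_disk n = subtopology (disk n) {z. radius n z < 1}" for n
  proof -
    have "{x. (\<Sum>i<n. (x i)\<^sup>2) < (1::real)} = {x. (\<Sum>i<n. (x i)\<^sup>2) \<le> 1} \<inter> {z. radius n z < 1}"
      by (auto simp: radius_def)
    then show ?thesis
      by (simp add: open_disk_def disk_def subtopology_subtopology)
  qed
  have sphere: "z \<in> topspace (disk n) \<and> \<not> radius n z < 1" if "z \<in> disk_boundary n" for z n
    using that by (auto simp: disk_boundary_def disk_def radius_def)
  have \<Phi>im: "\<Phi> \<sigma> ` topspace (disk (card \<sigma> - 1)) = realized_simplex \<sigma>" if "\<sigma> \<in> K" for \<sigma>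
    using homeomorphic_imp_surjective_map[OF \<Phi>[OF that]] by simp
  have E: "pairwise disjnt ?E"
  proof (rule pairwiseI)
    fix e e' assume "e \<in> ?E" "e' \<in> ?E" "e \<noteq> e'"
    then obtain \<sigma> \<tau> where "e = open_simplex \<sigma>" "e' = open_simplex \<tau>" "\<sigma> \<noteq> \<tau>"
      by blast
    then show "disjnt e e'"
      using support_open_simplex[of _ \<sigma>] support_open_simplex[of _ \<tau>] by (fastforce simp: disjnt_iff)
  qed
  have union: "\<Union>?E = topspace ?X"
  proof
    show "\<Union>?E \<subseteq> topspace ?X"
      by (auto simp: topspace_geometric_realization open_simplex_def)
    show "topspace ?X \<subseteq> \<Union>?E"
    proof
      fix \<alpha> assume "\<alpha> \<in> topspace ?X"
      then obtain \<sigma> where \<sigma>: "\<sigma> \<in> K" "\<alpha> \<in> realized_simplex \<sigma>"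
        by (auto simp: topspace_geometric_realization)
      then have "support \<alpha> \<in> K"
        using face[OF \<sigma>(1) support_subset[OF \<sigma>(2)]] in_open_simplex_support(2)[OF \<sigma>(2) fin(1)[OF \<sigma>(1)]]
        by blast
      then show "\<alpha> \<in> \<Union>?E"
        using in_open_simplex_support(1)[OF \<sigma>(2) fin(1)[OF \<sigma>(1)]] by blast
    qed
  qed
  have charmap: "continuous_map (disk (dim e)) ?X (\<Phi> (V e)) \<and>
               homeomorphic_map (open_disk (dim e)) (subtopology ?X e) (\<Phi> (V e))" if e: "e \<in> ?E" for e
  proof -
    obtain \<sigma> where \<sigma>: "\<sigma> \<in> K" "e = open_simplex \<sigma>"
      using e by blast
    note h = \<Phi>[OF \<sigma>(1)]
    have "continuous_map (disk (card \<sigma> - 1)) ?X (\<Phi> \<sigma>)"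
      using continuous_map_compose[OF homeomorphic_imp_continuous_map[OF h]
          continuous_map_simplex_inclusion[OF \<sigma>(1)]] by (simp add: o_def)
    moreover have "homeomorphic_map (subtopology (disk (card \<sigma> - 1)) {z. radius (card \<sigma> - 1) z < 1})
        (subtopology (simplex_topology \<sigma>) (open_simplex \<sigma>)) (\<Phi> \<sigma>)"
    proof (rule homeomorphic_map_subtopologies[OF h])
      show "\<Phi> \<sigma> ` (topspace (disk (card \<sigma> - 1)) \<inter> {z. radius (card \<sigma> - 1) z < 1})
              = topspace (simplex_topology \<sigma>) \<inter> open_simplex \<sigma>"
      proof -
        have "\<Phi> \<sigma> z \<in> realized_simplex \<sigma>" if "z \<in> topspace (disk (card \<sigma> - 1))" for z
          using \<Phi>im[OF \<sigma>(1)] that by blast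
        moreover have "\<exists>z\<in>topspace (disk (card \<sigma> - 1)). \<alpha> = \<Phi> \<sigma> z" if "\<alpha> \<in> realized_simplex \<sigma>" for \<alpha>
          using \<Phi>im[OF \<sigma>(1)] that by blast
        ultimately show ?thesis
          using \<Phi>_open[OF \<sigma>(1)] by (auto simp: image_iff) blast
      qed
    qed
    moreover have "subtopology (simplex_topology \<sigma>) (open_simplex \<sigma>) = subtopology ?X (open_simplex \<sigma>)"
    proof -
      have "realized_simplex \<sigma> \<inter> open_simplex \<sigma> = open_simplex \<sigma>"
        by (auto simp: open_simplex_def)
      then show ?thesis
        unfolding subtopology_realized_simplex[OF \<sigma>(1), symmetric] subtopology_subtopology by simp
    qed
    ultimately show ?thesis
      using \<sigma> by (simp add: dim V disk_open)
  qed
  have bdry: "\<exists>F\<subseteq>?E. finite F \<and> (\<forall>e'\<in>F. dim e' < dim e) \<and>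
               \<Phi> (V e) ` disk_boundary (dim e) \<subseteq> \<Union>F" if e: "e \<in> ?E" for e
  proof -
    obtain \<sigma> where \<sigma>: "\<sigma> \<in> K" "e = open_simplex \<sigma>"
      using e by blast
    let ?T = "{\<tau>. \<tau> \<subset> \<sigma> \<and> \<tau> \<noteq> {}}"
    have T: "?T \<subseteq> K"
      using face[OF \<sigma>(1)] by blast
    have "finite ?T"
      by (rule finite_subset[of _ "Pow \<sigma>"]) (use fin[OF \<sigma>(1)] in auto)
    moreover have "dim (open_simplex \<tau>) < dim e" if "\<tau> \<in> ?T" for \<tau>
    proof -
      have "card \<tau> < card \<sigma>" "0 < card \<tau>"
        using that fin[OF \<sigma>(1)] psubset_card_mono[of \<sigma> \<tau>] finite_subset[of \<tau> \<sigma>]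
        by (auto simp: card_gt_0_iff)
      moreover have "\<tau> \<in> K"
        using T that by blast
      ultimately show ?thesis
        by (simp add: dim \<sigma>)
    qed
    moreover have "\<Phi> \<sigma> z \<in> \<Union>(open_simplex ` ?T)" if "z \<in> disk_boundary (card \<sigma> - 1)" for z
    proof -
      have z: "\<Phi> \<sigma> z \<in> realized_simplex \<sigma>" "\<Phi> \<sigma> z \<notin> open_simplex \<sigma>"
        using sphere[OF that] \<Phi>im[OF \<sigma>(1)] \<Phi>_open[OF \<sigma>(1)] by blast+
      then have "support (\<Phi> \<sigma> z) \<in> ?T"
        using support_subset[OF z(1)] in_open_simplex_support[OF z(1) fin(1)[OF \<sigma>(1)]] by auto
      then show ?thesis
        using in_open_simplex_support(1)[OF z(1) fin(1)[OF \<sigma>(1)]] by blast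
    qed
    moreover have "dim e = card \<sigma> - 1" "V e = \<sigma>"
      by (simp_all add: \<sigma> dim V)
    ultimately have "finite (open_simplex ` ?T)" "\<forall>e'\<in>open_simplex ` ?T. dim e' < dim e"
      "\<Phi> (V e) ` disk_boundary (dim e) \<subseteq> \<Union>(open_simplex ` ?T)"
      by (blast, blast, simp add: image_subset_iff)
    then show ?thesis
      using image_mono[OF T, of open_simplex] by blast
  qed
  have weak: "closedin ?X A" if "A \<subseteq> topspace ?X"
    and cl: "\<forall>e\<in>?E. closedin (disk (dim e)) {x \<in> topspace (disk (dim e)). \<Phi> (V e) x \<in> A}" for A
    unfolding closedin_realization
  proof (intro conjI ballI)
    fix \<sigma> assume \<sigma>: "\<sigma> \<in> K"
    let ?C = "{x \<in> topspace (disk (card \<sigma> - 1)). \<Phi> \<sigma> x \<in> A}"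
    have "closedin (disk (card \<sigma> - 1)) ?C"
      using cl \<sigma> by (auto simp: dim V)
    then have "closedin (simplex_topology \<sigma>) (\<Phi> \<sigma> ` ?C)"
      using homeomorphic_imp_closed_map[OF \<Phi>[OF \<sigma>]] unfolding closed_map_def by blast
    moreover have "\<Phi> \<sigma> ` ?C = A \<inter> realized_simplex \<sigma>"
      using \<Phi>im[OF \<sigma>] by auto
    ultimately show "closedin (simplex_topology \<sigma>) (A \<inter> realized_simplex \<sigma>)"
      by simp
  qed (use that in simp)
  show ?thesis
    unfolding cw_complex_def
  proof (intro conjI Hausdorff_geometric_realization exI[of _ ?E] exI[of _ dim]
        exI[of _ "\<lambda>e. \<Phi> (V e)"] E union)
    show "\<forall>e\<in>?E. continuous_map (disk (dim e)) ?X (\<Phi> (V e)) \<and>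
            homeomorphic_map (open_disk (dim e)) (subtopology ?X e) (\<Phi> (V e))"
      by (intro ballI charmap)
    show "\<forall>e\<in>?E. \<exists>F\<subseteq>?E. finite F \<and> (\<forall>e'\<in>F. dim e' < dim e) \<and>
            \<Phi> (V e) ` disk_boundary (dim e) \<subseteq> \<Union>F"
      by (intro ballI bdry)
    show "\<forall>A\<subseteq>topspace ?X.
            (\<forall>e\<in>?E. closedin (disk (dim e)) {x \<in> topspace (disk (dim e)). \<Phi> (V e) x \<in> A}) \<longrightarrow>
            closedin ?X A"
      by (intro allI impI weak)
  qed
qed

section \<open>Functoriality of cochains\<close>

lemma cochain_eval_pullback:
  assumes "singular_chain n X x"
  shows "cochain_eval (pullback_cochain n X f c) x = cochain_eval c (chain_map n f x)"
  using assms unfolding singular_chain_def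
  by (induction x rule: frag_induction)
     (auto simp: cochain_eval_diff chain_map_diff pullback_cochain_def)

lemma pullback_cocycle:
  assumes f: "continuous_map X Y f" and c: "c \<in> cocycles n Y"
  shows "pullback_cochain n X f c \<in> cocycles n X"
  unfolding cocycle_iff
proof (intro conjI allI impI)
  fix x assume x: "singular_chain (Suc n) X x"
  have "cochain_eval (pullback_cochain n X f c) (chain_boundary (Suc n) x)
          = cochain_eval c (chain_boundary (Suc n) (chain_map (Suc n) f x))"
    by (simp add: cochain_eval_pullback[OF singular_chain_boundary_alt[OF x]]
        chain_boundary_chain_map[OF x])
  also have "\<dots> = 0"
    using c singular_chain_chain_map[OF x f] by (simp add: cocycle_iff)
  finally show "cochain_eval (pullback_cochain n X f c) (chain_boundary (Suc n) x) = 0" .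
qed (simp add: pullback_cochain_def)

lemma pullback_reduced_coboundary:
  assumes f: "continuous_map X Y f" and c: "c \<in> reduced_coboundaries n Y"
  shows "pullback_cochain n X f c \<in> reduced_coboundaries n X"
proof -
  have map: "singular_simplex n Y (simplex_map n f s)" if "singular_simplex n X s" for s
    using singular_simplex_simplex_map[OF that f] .
  show ?thesis
  proof (cases n)
    case 0
    then show ?thesis
      using c map by (auto simp: reduced_coboundaries_0_iff pullback_cochain_def)
  next
    case (Suc p)
    then obtain b where b: "\<And>s. singular_simplex n Y s \<Longrightarrow>
        c s = cochain_eval b (chain_boundary n (frag_of s))"
      using c by (auto simp: reduced_coboundaries_Suc_iff)
    have "pullback_cochain n X f c s
            = cochain_eval (pullback_cochain p X f b) (chain_boundary n (frag_of s))"
      if s: "singular_simplex n X s" for s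
    proof -
      have s': "singular_chain n X (frag_of s)"
        by (simp add: singular_chain_of s)
      then have "singular_chain p X (chain_boundary n (frag_of s))"
        using singular_chain_boundary[OF s'] by (simp add: Suc)
      then have "cochain_eval (pullback_cochain p X f b) (chain_boundary n (frag_of s))
                   = cochain_eval b (chain_boundary n (frag_of (simplex_map n f s)))"
        using chain_boundary_chain_map[OF s', of f] by (simp add: cochain_eval_pullback Suc)
      then show ?thesis
        using s b[OF map[OF s]] by (simp add: pullback_cochain_def[of n])
    qed
    then show ?thesis
      unfolding Suc reduced_coboundaries_Suc_iff by (auto simp: Suc pullback_cochain_def)
  qed
qed

lemma pullback_cochain_compose:
  assumes "continuous_map X Y g"
  shows "pullback_cochain n X g (pullback_cochain n Y f c) = pullback_cochain n X (f \<circ> g) c"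
  using singular_simplex_simplex_map[OF _ assms]
  by (auto simp: pullback_cochain_def simplex_map_compose fun_eq_iff)

lemma pullback_cochain_cong:
  assumes "\<And>x. x \<in> topspace X \<Longrightarrow> f x = g x"
  shows "pullback_cochain n X f c = pullback_cochain n X g c"
proof -
  have "simplex_map n f s = simplex_map n g s" if "singular_simplex n X s" for s
    by (rule simplex_map_eq[OF that assms])
  then show ?thesis
    by (auto simp: pullback_cochain_def)
qed

section \<open>Simplicial maps and straight-line homotopies\<close>

text \<open>The linear extension of a vertex map, as push-forward of the weights. Summing over the
  support keeps the sum finite and independent of the simplex in which \<alpha> is
  considered.\<close>

definition push :: "('v \<Rightarrow> 'w) \<Rightarrow> ('v \<Rightarrow> real) \<Rightarrow> 'w \<Rightarrow> real" where
  "push g \<alpha> w = (\<Sum>v | \<alpha> v \<noteq> 0 \<and> g v = w. \<alpha> v)"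

definition vertex :: "'v \<Rightarrow> 'v \<Rightarrow> real" where
  "vertex w = (\<lambda>v. if v = w then 1 else 0)"

lemma vertex_in_realized_simplex: "finite \<sigma> \<Longrightarrow> w \<in> \<sigma> \<Longrightarrow> vertex w \<in> realized_simplex \<sigma>"
  by (auto simp: vertex_def realized_simplex_def)

lemma push_eq_sum:
  assumes "finite \<sigma>" "\<alpha> \<in> realized_simplex \<sigma>"
  shows "push g \<alpha> w = (\<Sum>v | v \<in> \<sigma> \<and> g v = w. \<alpha> v)"
  unfolding push_def
  by (rule sum.mono_neutral_left) (use assms in \<open>auto simp: realized_simplex_def\<close>)

lemma push_in_realized_simplex:
  assumes "finite \<sigma>" "\<alpha> \<in> realized_simplex \<sigma>"
  shows "push g \<alpha> \<in> realized_simplex (g ` \<sigma>)"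
proof -
  have "sum (push g \<alpha>) (g ` \<sigma>) = sum \<alpha> \<sigma>"
    unfolding push_eq_sum[OF assms] using sum.image_gen[OF assms(1), of \<alpha> g] by simp
  moreover have "push g \<alpha> w = 0" if "w \<notin> g ` \<sigma>" for w
    unfolding push_eq_sum[OF assms] by (rule sum.neutral) (use that in blast)
  moreover have "0 \<le> push g \<alpha> w" for w
    using assms(2) by (auto simp: push_def realized_simplex_def intro: sum_nonneg)
  ultimately show ?thesis
    using assms(2) by (simp add: realized_simplex_def)
qed

lemma push_compose:
  assumes "finite \<sigma>" "\<alpha> \<in> realized_simplex \<sigma>"
  shows "push h (push g \<alpha>) = push (h \<circ> g) \<alpha>"
proof
  fix u
  let ?S = "{v \<in> \<sigma>. h (g v) = u}"
  have "push h (push g \<alpha>) u = (\<Sum>w | w \<in> g ` \<sigma> \<and> h w = u. push g \<alpha> w)"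
    by (rule push_eq_sum[OF _ push_in_realized_simplex[OF assms]]) (simp add: assms)
  also have "{w. w \<in> g ` \<sigma> \<and> h w = u} = g ` ?S"
    by auto
  also have "(\<Sum>w\<in>g ` ?S. push g \<alpha> w) = (\<Sum>w\<in>g ` ?S. sum \<alpha> {v. v \<in> ?S \<and> g v = w})"
  proof (rule sum.cong[OF refl])
    fix w assume "w \<in> g ` ?S"
    then have "{v. v \<in> \<sigma> \<and> g v = w} = {v. v \<in> ?S \<and> g v = w}"
      by auto
    then show "push g \<alpha> w = sum \<alpha> {v. v \<in> ?S \<and> g v = w}"
      by (simp add: push_eq_sum[OF assms])
  qed
  also have "\<dots> = sum \<alpha> ?S"
    by (rule sum.image_gen[symmetric]) (simp add: assms)
  also have "\<dots> = push (h \<circ> g) \<alpha> u"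
    by (simp add: push_eq_sum[OF assms])
  finally show "push h (push g \<alpha>) u = push (h \<circ> g) \<alpha> u" .
qed

lemma push_cong:
  assumes "finite \<sigma>" "\<alpha> \<in> realized_simplex \<sigma>" "\<And>v. v \<in> \<sigma> \<Longrightarrow> g v = h v"
  shows "push g \<alpha> = push h \<alpha>"
  using assms(3) by (auto simp: push_eq_sum[OF assms(1,2)] fun_eq_iff intro!: sum.cong)

lemma push_ident:
  assumes "finite \<sigma>" "\<alpha> \<in> realized_simplex \<sigma>" "\<And>v. v \<in> \<sigma> \<Longrightarrow> g v = v"
  shows "push g \<alpha> = \<alpha>"
proof
  fix w
  have "{v. v \<in> \<sigma> \<and> g v = w} = (if w \<in> \<sigma> then {w} else {})"
    using assms(3) by auto
  then show "push g \<alpha> w = \<alpha> w"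
    using assms(2) by (simp add: push_eq_sum[OF assms(1,2)] realized_simplex_def)
qed

lemma push_const:
  assumes "finite \<sigma>" "\<alpha> \<in> realized_simplex \<sigma>" "\<And>v. v \<in> \<sigma> \<Longrightarrow> g v = w"
  shows "push g \<alpha> = vertex w"
proof
  fix u
  have "{v. v \<in> \<sigma> \<and> g v = u} = (if u = w then \<sigma> else {})"
    using assms(3) by auto
  then show "push g \<alpha> u = vertex w u"
    using assms(2) by (simp add: push_eq_sum[OF assms(1,2)] realized_simplex_def vertex_def)
qed

lemma continuous_map_push_coordinate:
  assumes "\<And>\<sigma>. \<sigma> \<in> K \<Longrightarrow> finite \<sigma>"
  shows "continuous_map (geometric_realization K) euclideanreal (\<lambda>\<alpha>. push g \<alpha> w)"
  unfolding continuous_map_from_realization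
proof
  fix \<sigma> assume \<sigma>: "\<sigma> \<in> K"
  have "continuous_map (simplex_topology \<sigma>) euclideanreal (\<lambda>\<alpha>. \<Sum>v | v \<in> \<sigma> \<and> g v = w. \<alpha> v)"
    by (intro continuous_map_sum continuous_map_simplex_coordinate) (simp add: assms[OF \<sigma>])
  then show "continuous_map (simplex_topology \<sigma>) euclideanreal (\<lambda>\<alpha>. push g \<alpha> w)"
    by (rule continuous_map_eq) (simp add: push_eq_sum[OF assms[OF \<sigma>]])
qed

lemma continuous_map_push:
  assumes fin: "\<And>\<sigma>. \<sigma> \<in> K \<Longrightarrow> finite \<sigma>" and g: "\<And>\<sigma>. \<sigma> \<in> K \<Longrightarrow> g ` \<sigma> \<in> L"
  shows "continuous_map (geometric_realization K) (geometric_realization L) (push g)"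
  unfolding continuous_map_from_realization
proof
  fix \<sigma> assume \<sigma>: "\<sigma> \<in> K"
  have "continuous_map (simplex_topology \<sigma>) (simplex_topology (g ` \<sigma>)) (push g)"
    unfolding continuous_map_into_simplex
    using push_in_realized_simplex[OF fin[OF \<sigma>]] \<sigma>
      continuous_map_push_coordinate[of K g, OF fin, unfolded continuous_map_from_realization]
    by (intro conjI allI) auto
  then show "continuous_map (simplex_topology \<sigma>) (geometric_realization L) (push g)"
    using continuous_map_compose[OF _ continuous_map_simplex_inclusion[OF g[OF \<sigma>]]]
    by (fastforce simp: o_def)
qed

lemma quotient_map_realization:
  "quotient_map (sum_topology simplex_topology K) (geometric_realization K) snd"
  unfolding quotient_map_def
proof (intro conjI allI impI)
  show "snd ` topspace (sum_topology simplex_topology K) = topspace (geometric_realization K)"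
    by (auto simp: topspace_geometric_realization image_iff)
  fix U assume U: "U \<subseteq> topspace (geometric_realization K)"
  have "{x. (\<sigma>, x) \<in> {z \<in> topspace (sum_topology simplex_topology K). snd z \<in> U}}
          = U \<inter> realized_simplex \<sigma>" if "\<sigma> \<in> K" for \<sigma>
    using that by auto
  then show "openin (sum_topology simplex_topology K)
               {z \<in> topspace (sum_topology simplex_topology K). snd z \<in> U}
             = openin (geometric_realization K) U"
    using U by (simp add: openin_sum_topology openin_realization del: topspace_sum_topology
                   cong: ball_cong) auto
qed

text \<open>
  Continuity on the cylinder is tested on the product of the interval with the disjoint union of the
  simplices, of which the cylinder is a quotient because the interval is locally compact.
\<close>

lemma straight_line_homotopy:
  fixes f g :: "('v \<Rightarrow> real) \<Rightarrow> 'w \<Rightarrow> real"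
  assumes U: "openin (geometric_realization K) U"
    and f: "\<And>v. continuous_map (subtopology (geometric_realization K) U) euclideanreal (\<lambda>\<alpha>. f \<alpha> v)"
    and g: "\<And>v. continuous_map (subtopology (geometric_realization K) U) euclideanreal (\<lambda>\<alpha>. g \<alpha> v)"
    and carrier: "\<And>\<sigma>. \<sigma> \<in> K \<Longrightarrow>
          \<exists>\<tau>\<in>L. \<forall>\<alpha>\<in>U \<inter> realized_simplex \<sigma>. f \<alpha> \<in> realized_simplex \<tau> \<and> g \<alpha> \<in> realized_simplex \<tau>"
  shows "homotopy_between (subtopology (geometric_realization K) U) (geometric_realization L) f g
           (\<lambda>(t, \<alpha>) v. (1 - t) * f \<alpha> v + t * g \<alpha> v)"
    (is "homotopy_between ?X ?Y f g ?H")
proof -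
  let ?I = "top_of_set {0..1::real}"
  let ?S = "sum_topology simplex_topology K"
  define S where "S = subtopology ?S {z \<in> topspace ?S. snd z \<in> U}"
  have tS: "topspace S = {(\<sigma>, \<alpha>). \<sigma> \<in> K \<and> \<alpha> \<in> U \<inter> realized_simplex \<sigma>}"
    by (auto simp: S_def)
  \<comment> \<open>A quotient map stays one when restricted to the preimage of an open set.\<close>
  have q: "quotient_map S ?X snd"
    unfolding S_def by (rule quotient_map_restriction[OF quotient_map_realization refl]) (use U in simp)
  have lc: "locally_compact_space ?I" and hs: "Hausdorff_space ?I"
    by (auto intro: compact_imp_locally_compact_space Hausdorff_space_subtopology
        simp: compact_space_subtopology)
  have q': "quotient_map (prod_topology ?I S) (cylinder ?X) (\<lambda>(t, z). (t, snd z))"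
    unfolding cylinder_def using quotient_map_prod_right[OF lc disjI1[OF hs] q] by simp
  have comp: "continuous_map (cylinder ?X) euclideanreal (\<lambda>z. ?H z v)" for v
  proof -
    have fst: "continuous_map (cylinder ?X) euclideanreal fst"
      unfolding cylinder_def using continuous_map_fst continuous_map_into_fulltopology by blast
    have snd: "continuous_map (cylinder ?X) ?X snd"
      unfolding cylinder_def by (rule continuous_map_snd)
    have "continuous_map (cylinder ?X) euclideanreal
            (\<lambda>z. (1 - fst z) * f (snd z) v + fst z * g (snd z) v)"
      using continuous_map_compose[OF snd f[of v]] continuous_map_compose[OF snd g[of v]] fst
      by (intro continuous_intros) (auto simp: o_def)
    then show ?thesis
      by (simp add: case_prod_unfold)
  qed
  \<comment> \<open>In the disjoint union the piece over \<sigma> is open, which a closed simplex of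
    the realization need not be. On this piece all values lie in one simplex \<tau>, where
    continuity can be checked by coordinates.\<close>
  have "continuous_map (prod_topology ?I S) ?Y (?H \<circ> (\<lambda>(t, z). (t, snd z)))" (is "continuous_map ?P ?Y ?G")
  proof (rule pasting_lemma[where I = K and f = "\<lambda>\<sigma>. ?G" and T = "\<lambda>\<sigma>. {z \<in> topspace ?P. fst (snd z) = \<sigma>}"])
    fix \<sigma> assume \<sigma>: "\<sigma> \<in> K"
    have "{\<alpha>. (\<tau>, \<alpha>) \<in> {z \<in> topspace ?S. fst z = \<sigma>}}
            = (if \<tau> = \<sigma> then topspace (simplex_topology \<tau>) else {})" if "\<tau> \<in> K" for \<tau>
      using that by auto
    then have "openin ?S {z \<in> topspace ?S. fst z = \<sigma>}"
      by (auto simp: openin_sum_topology simp del: topspace_simplex_topology)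
    then have "openin S {z \<in> topspace S. fst z = \<sigma>}"
      unfolding S_def by (auto simp: openin_subtopology)
    then have S\<sigma>: "openin S {z \<in> topspace S. fst z = \<sigma>}" .
    show "openin ?P {z \<in> topspace ?P. fst (snd z) = \<sigma>}"
    proof -
      from openin_continuous_map_preimage[OF continuous_map_snd S\<sigma>, of ?I]
      show ?thesis
        by (rule back_subst[of "openin ?P"]) auto
    qed
    let ?P\<sigma> = "subtopology ?P {z \<in> topspace ?P. fst (snd z) = \<sigma>}"
    obtain \<tau> where \<tau>: "\<tau> \<in> L"
      and fg: "\<And>\<alpha>. \<alpha> \<in> U \<inter> realized_simplex \<sigma> \<Longrightarrow> f \<alpha> \<in> realized_simplex \<tau> \<and> g \<alpha> \<in> realized_simplex \<tau>"
      using carrier[OF \<sigma>] by blast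
    have convex: "(\<lambda>v. (1 - t) * \<alpha> v + t * \<beta> v) \<in> realized_simplex \<tau>"
      if "0 \<le> t" "t \<le> 1" "\<alpha> \<in> realized_simplex \<tau>" "\<beta> \<in> realized_simplex \<tau>" for t \<alpha> \<beta>
      using that by (auto simp: realized_simplex_def sum.distrib simp flip: sum_distrib_left)
    have "continuous_map ?P\<sigma> (simplex_topology \<tau>) ?G"
      unfolding continuous_map_into_simplex
    proof (intro conjI allI)
      show "?G \<in> topspace ?P\<sigma> \<rightarrow> realized_simplex \<tau>"
        using fg by (auto simp: tS intro!: convex)
      show "continuous_map ?P\<sigma> euclideanreal (\<lambda>x. ?G x v)" for v
        using continuous_map_compose[OF quotient_imp_continuous_map[OF q'] comp[of v]]
        by (simp add: o_def continuous_map_from_subtopology)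
    qed
    then show "continuous_map ?P\<sigma> ?Y ?G"
      using continuous_map_compose[OF _ continuous_map_simplex_inclusion[OF \<tau>]]
      by (fastforce simp: o_def)
  qed (auto simp: tS)
  then have "continuous_map (cylinder ?X) ?Y ?H"
    using continuous_compose_quotient_map_eq[OF q'] by blast
  then show ?thesis
    by (simp add: homotopy_between_def)
qed

section \<open>Wedges of complexes\<close>

text \<open>The conditions are symmetric in \<open>A\<close> and \<open>B\<close>, so facts about
  one side transfer by \<open>swap\<close>. \<open>cone\<close> takes the place of a decomposition
  into two subcomplexes: a simplex contained in neither side is allowed if it can be coned off to
  the base vertex.\<close>

locale wedge_complex =
  fixes K :: "'v set set" and A B :: "'v set" and w0 :: 'v
  assumes complex: "abstract_complex K"
    and vertices: "\<And>\<sigma>. \<sigma> \<in> K \<Longrightarrow> \<sigma> \<subseteq> A \<union> B"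
    and base: "A \<inter> B = {w0}" "{w0} \<in> K"
    and cone: "\<And>\<sigma>. \<sigma> \<in> K \<Longrightarrow> \<sigma> \<subseteq> A \<or> \<sigma> \<subseteq> B \<or> insert w0 \<sigma> \<in> K"
begin

abbreviation space :: "('v \<Rightarrow> real) topology" where
  "space \<equiv> geometric_realization K"

definition collapse :: "'v \<Rightarrow> 'v" where
  "collapse v = (if v \<in> A then v else w0)"

text \<open>Pushing forward to the type \<^typ>\<open>bool\<close> sums the coordinates at the vertices outside \<open>A\<close>.\<close>

definition outer_mass :: "('v \<Rightarrow> real) \<Rightarrow> real" where
  "outer_mass \<alpha> = push (\<lambda>v. v \<notin> A) \<alpha> True"

definition side :: "('v \<Rightarrow> real) set" where
  "side = {\<alpha> \<in> topspace space. outer_mass \<alpha> < 1}"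

lemma fin: "\<sigma> \<in> K \<Longrightarrow> finite \<sigma>"
  using complex by (simp add: abstract_complex_def)

lemma openin_side: "openin space side"
  unfolding side_def outer_mass_def
  using openin_continuous_map_preimage[OF continuous_map_push_coordinate[OF fin],
      of K "{..<1}" "\<lambda>v. v \<notin> A" True]
  by simp

lemma outer_mass_eq:
  "\<sigma> \<in> K \<Longrightarrow> \<alpha> \<in> realized_simplex \<sigma> \<Longrightarrow> outer_mass \<alpha> = sum \<alpha> (\<sigma> - A)"
  unfolding outer_mass_def by (subst push_eq_sum[OF fin]) (auto intro: sum.cong)

text \<open>A simplex inside \<open>B\<close> without the base vertex is disjoint from
  \<open>A\<close>; all its points have outer mass 1, so \<open>side\<close> misses it.\<close>

lemma side_cases:
  assumes "\<sigma> \<in> K" "\<alpha> \<in> side \<inter> realized_simplex \<sigma>"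
  shows "\<sigma> \<subseteq> A \<or> insert w0 \<sigma> \<in> K"
proof (rule ccontr)
  assume not: "\<not> ?thesis"
  then have "\<sigma> \<subseteq> B" "w0 \<notin> \<sigma>"
    using cone[OF assms(1)] assms(1) by (auto simp: insert_absorb)
  moreover have "\<sigma> \<inter> A \<subseteq> {w0}"
    using base(1) \<open>\<sigma> \<subseteq> B\<close> by blast
  ultimately have "\<sigma> - A = \<sigma>"
    by blast
  then have "outer_mass \<alpha> = 1"
    using outer_mass_eq[of \<sigma> \<alpha>] assms by (simp add: realized_simplex_def)
  then show False
    using assms(2) by (simp add: side_def)
qed

text \<open>On a simplex inside \<open>A\<close> the collapse is the identity. Otherwise
  \<open>insert w0 \<sigma>\<close> is a simplex containing a point and its collapse, hence the
  segment between them. Simplices missing \<open>side\<close> impose no condition.\<close>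

lemma homotopy_side:
  "\<exists>H. homotopy_between (subtopology space side) space
         (\<lambda>\<alpha>. \<alpha>) (push collapse) H"
proof (rule exI, rule straight_line_homotopy[OF openin_side])
  show "continuous_map (subtopology space side) euclideanreal (\<lambda>\<alpha>. \<alpha> v)" for v
    by (intro continuous_map_from_subtopology continuous_map_realization_coordinate)
  show "continuous_map (subtopology space side) euclideanreal
          (\<lambda>\<alpha>. push collapse \<alpha> v)" for v
    by (intro continuous_map_from_subtopology continuous_map_push_coordinate fin)
  show "\<exists>\<tau>\<in>K. \<forall>\<alpha>\<in>side \<inter> realized_simplex \<sigma>.
          \<alpha> \<in> realized_simplex \<tau> \<and> push collapse \<alpha> \<in> realized_simplex \<tau>" if \<sigma>: "\<sigma> \<in> K" for \<sigma>
  proof (cases "side \<inter> realized_simplex \<sigma> = {}")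
    case False
    then consider "\<sigma> \<subseteq> A" | "insert w0 \<sigma> \<in> K"
      using side_cases[OF \<sigma>] by blast
    then show ?thesis
    proof cases
      case 1
      then have "push collapse \<alpha> = \<alpha>" if "\<alpha> \<in> realized_simplex \<sigma>" for \<alpha>
        using that by (intro push_ident[OF fin[OF \<sigma>]]) (auto simp: collapse_def)
      then show ?thesis
        using \<sigma> by auto
    next
      case 2
      have sub: "\<sigma> \<subseteq> insert w0 \<sigma>" "collapse ` \<sigma> \<subseteq> insert w0 \<sigma>"
        by (auto simp: collapse_def)
      show ?thesis
      proof (intro bexI[OF _ 2] ballI conjI)
        fix \<alpha> assume \<alpha>: "\<alpha> \<in> side \<inter> realized_simplex \<sigma>"
        show "\<alpha> \<in> realized_simplex (insert w0 \<sigma>)"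
          using realized_simplex_mono[OF fin[OF 2] sub(1)] \<alpha> by blast
        show "push collapse \<alpha> \<in> realized_simplex (insert w0 \<sigma>)"
          using realized_simplex_mono[OF fin[OF 2] sub(2)] push_in_realized_simplex[OF fin[OF \<sigma>]] \<alpha>
          by blast
      qed
    qed
  qed (use \<sigma> in blast)
qed

lemma swap: "wedge_complex K B A w0"
  using complex vertices base cone by unfold_locales (blast+)

text \<open>The inclusion of \<open>side\<close> is homotopic to its composite with the collapse,
  and along the latter the cocycle already becomes a reduced coboundary.\<close>

lemma restrict_side:
  fixes c :: "('v \<Rightarrow> real, 'k::field) cochain"
  assumes c: "c \<in> cocycles n space"
    and p: "pullback_cochain n space (push collapse) c
              \<in> reduced_coboundaries n space"
  shows "pullback_cochain n (subtopology space side) id c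
           \<in> reduced_coboundaries n (subtopology space side)"
proof -
  let ?X = "space" and ?U = "subtopology space side"
  have id: "continuous_map ?U ?X id"
    by (simp add: continuous_map_from_subtopology)
  obtain H where "homotopy_between ?U ?X (\<lambda>\<alpha>. \<alpha>) (push collapse) H"
    using homotopy_side by blast
  from homotopic_pullback_cochain[OF this c]
  have "(\<lambda>s. pullback_cochain n ?U (push collapse) c s - pullback_cochain n ?U id c s)
          \<in> reduced_coboundaries n ?U"
    by (simp add: id_def)
  moreover have "pullback_cochain n ?U (push collapse) c \<in> reduced_coboundaries n ?U"
    using pullback_reduced_coboundary[OF id p] pullback_cochain_compose[OF id, of n "push collapse" c]
    by simp
  ultimately show ?thesis
    using reduced_coboundaries_diff[of "pullback_cochain n ?U (push collapse) c" n ?U] by fastforce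
qed

end

context wedge_complex
begin

interpretation opp: wedge_complex K B A w0
  by (rule swap)

text \<open>The vertices off \<open>A\<close> and those off \<open>B\<close> are disjoint, so the
  two outer masses add up to at most 1 and cannot both equal 1.\<close>

lemma sides_cover: "topspace space \<subseteq> side \<union> opp.side"
proof
  fix \<alpha> assume \<alpha>: "\<alpha> \<in> topspace space"
  then obtain \<sigma> where \<sigma>: "\<sigma> \<in> K" "\<alpha> \<in> realized_simplex \<sigma>"
    by (auto simp: topspace_geometric_realization)
  have "sum \<alpha> (\<sigma> - A) + sum \<alpha> (\<sigma> - B) = sum \<alpha> ((\<sigma> - A) \<union> (\<sigma> - B))"
    by (rule sum.union_disjoint[symmetric]) (use vertices[OF \<sigma>(1)] fin[OF \<sigma>(1)] in auto)
  also have "\<dots> \<le> sum \<alpha> \<sigma>"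
    by (rule sum_mono2) (use \<sigma> fin in \<open>auto simp: realized_simplex_def\<close>)
  finally have "outer_mass \<alpha> + opp.outer_mass \<alpha> \<le> 1"
    using \<sigma> by (simp add: outer_mass_eq opp.outer_mass_eq realized_simplex_def)
  then show "\<alpha> \<in> side \<union> opp.side"
    using \<alpha> by (auto simp: side_def opp.side_def)
qed

text \<open>The base vertex lies in \<open>A\<close> and adds nothing to the outer mass, so moving
  towards it multiplies the outer mass by 1 - t.\<close>

lemma outer_mass_segment:
  assumes "\<sigma> \<in> K" "insert w0 \<sigma> \<in> K" "\<alpha> \<in> realized_simplex \<sigma>" "0 \<le> t" "t \<le> 1" "outer_mass \<alpha> < 1"
  shows "outer_mass (\<lambda>v. (1 - t) * \<alpha> v + t * vertex w0 v) < 1"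
proof -
  let ?\<tau> = "insert w0 \<sigma>"
  have w0: "w0 \<in> A"
    using base by blast
  have \<alpha>: "\<alpha> \<in> realized_simplex ?\<tau>"
    using realized_simplex_mono[OF fin[OF assms(2)], of \<sigma>] assms(3) by blast
  have "(\<lambda>v. (1 - t) * \<alpha> v + t * vertex w0 v) \<in> realized_simplex ?\<tau>"
    using \<alpha> assms(4,5) vertex_in_realized_simplex[OF fin[OF assms(2)], of w0]
    by (auto simp: realized_simplex_def sum.distrib simp del: sum.insert sum.insert_if
        simp flip: sum_distrib_left)
  then have "outer_mass (\<lambda>v. (1 - t) * \<alpha> v + t * vertex w0 v)
          = (\<Sum>v\<in>?\<tau> - A. (1 - t) * \<alpha> v + t * vertex w0 v)"
    by (rule outer_mass_eq[OF assms(2)])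
  also have "\<dots> = (\<Sum>v\<in>?\<tau> - A. (1 - t) * \<alpha> v)"
    by (rule sum.cong) (use w0 in \<open>auto simp: vertex_def\<close>)
  also have "\<dots> = (1 - t) * outer_mass \<alpha>"
    by (simp add: outer_mass_eq[OF assms(2) \<alpha>] sum_distrib_left)
  also have "\<dots> \<le> outer_mass \<alpha>"
    using assms(3,4,5) sum_nonneg[of "\<sigma> - A" \<alpha>] outer_mass_eq[OF assms(1,3)]
    by (intro mult_left_le_one_le) (auto simp: realized_simplex_def)
  finally show ?thesis
    using assms(6) by simp
qed

end

text \<open>Reopening the context makes \<open>outer_mass_segment\<close> available with the roles of \<open>A\<close> and \<open>B\<close> swapped.\<close>

context wedge_complex
begin

interpretation opp: wedge_complex K B A w0
  by (rule swap)

text \<open>If the cone over \<sigma> were missing, \<sigma> would lie in both \<open>A\<close> and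
  \<open>B\<close>, hence in \<open>{w0}\<close>, whose cone is \<open>{w0}\<close> itself.\<close>

lemma intersection_cases:
  assumes "\<sigma> \<in> K" "\<alpha> \<in> side \<inter> opp.side \<inter> realized_simplex \<sigma>"
  shows "insert w0 \<sigma> \<in> K"
proof (rule ccontr)
  assume not: "insert w0 \<sigma> \<notin> K"
  then have "\<sigma> \<subseteq> A \<inter> B"
    using side_cases[of \<sigma> \<alpha>] opp.side_cases[of \<sigma> \<alpha>] assms by auto
  then have "\<sigma> \<subseteq> {w0}"
    using base(1) by simp
  then have "insert w0 \<sigma> = {w0}"
    by blast
  then show False
    using not base(2) by metis
qed

text \<open>Each segment to the base vertex lies in the simplex \<open>insert w0 \<sigma>\<close>.
  It stays in the intersection because neither outer mass increases along it.\<close>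

lemma homotopy_intersection:
  "\<exists>H. homotopy_between (subtopology space (side \<inter> opp.side))
         (subtopology space (side \<inter> opp.side)) (\<lambda>\<alpha>. \<alpha>) (\<lambda>\<alpha>. vertex w0) H"
proof -
  let ?W = "side \<inter> opp.side"
  let ?X = "subtopology space ?W"
  let ?H = "\<lambda>(t, \<alpha>) v. (1 - t) * \<alpha> v + t * vertex w0 v"
  have h: "homotopy_between ?X space (\<lambda>\<alpha>. \<alpha>) (\<lambda>\<alpha>. vertex w0) ?H"
  proof (rule straight_line_homotopy)
    show "openin space ?W"
      by (intro openin_Int openin_side opp.openin_side)
    show "continuous_map ?X euclideanreal (\<lambda>\<alpha>. \<alpha> v)" for v
      by (intro continuous_map_from_subtopology continuous_map_realization_coordinate)
    show "\<exists>\<tau>\<in>K. \<forall>\<alpha>\<in>?W \<inter> realized_simplex \<sigma>.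
            \<alpha> \<in> realized_simplex \<tau> \<and> vertex w0 \<in> realized_simplex \<tau>" if \<sigma>: "\<sigma> \<in> K" for \<sigma>
    proof (cases "?W \<inter> realized_simplex \<sigma> = {}")
      case False
      then have \<tau>: "insert w0 \<sigma> \<in> K"
        using intersection_cases[OF \<sigma>] by blast
      show ?thesis
      proof (intro bexI[OF _ \<tau>] ballI conjI)
        fix \<alpha> assume "\<alpha> \<in> ?W \<inter> realized_simplex \<sigma>"
        then show "\<alpha> \<in> realized_simplex (insert w0 \<sigma>)"
          using realized_simplex_mono[OF fin[OF \<tau>], of \<sigma>] by blast
      qed (use vertex_in_realized_simplex[OF fin[OF \<tau>], of w0] in blast)
    qed (use \<sigma> in blast)
  qed simp
  have "?H z \<in> ?W" if "z \<in> topspace (cylinder ?X)" for z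
  proof -
    obtain t \<alpha> where z': "z = (t, \<alpha>)"
      by fastforce
    then have z: "z = (t, \<alpha>)" "0 \<le> t" "t \<le> 1" "\<alpha> \<in> ?W"
      using that by (auto simp: cylinder_def)
    then obtain \<sigma> where \<sigma>: "\<sigma> \<in> K" "\<alpha> \<in> realized_simplex \<sigma>"
      by (auto simp: side_def topspace_geometric_realization)
    have \<tau>: "insert w0 \<sigma> \<in> K"
      using intersection_cases[OF \<sigma>(1)] \<sigma>(2) z by blast
    have "?H z \<in> topspace space"
      using h that continuous_map_image_subset_topspace by (fastforce simp: homotopy_between_def)
    then show ?thesis
      using outer_mass_segment[OF \<sigma>(1) \<tau> \<sigma>(2)] opp.outer_mass_segment[OF \<sigma>(1) \<tau> \<sigma>(2)] z
      by (auto simp: side_def opp.side_def)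
  qed
  then have "homotopy_between ?X ?X (\<lambda>\<alpha>. \<alpha>) (\<lambda>\<alpha>. vertex w0) ?H"
    using h unfolding homotopy_between_def continuous_map_in_subtopology by blast
  then show ?thesis
    by (rule exI[of _ ?H])
qed

lemma vertex_in_intersection: "vertex w0 \<in> side \<inter> opp.side"
proof -
  have v: "vertex w0 \<in> realized_simplex {w0}"
    by (simp add: vertex_in_realized_simplex)
  moreover have "{w0} - A = {}" "{w0} - B = {}"
    using base by auto
  ultimately have "outer_mass (vertex w0) = 0" "opp.outer_mass (vertex w0) = 0"
    using outer_mass_eq[OF base(2) v] opp.outer_mass_eq[OF base(2) v] by simp_all
  then show ?thesis
    using v realized_simplex_subset[OF base(2)] by (auto simp: side_def opp.side_def)
qed

text \<open>Restriction to the summands enters only through the two collapses, so the statement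
  concerns \<open>K\<close> alone and not the complexes embedded in it.\<close>

lemma reduced_coboundary_from_sides:
  fixes c :: "('v \<Rightarrow> real, 'k::field) cochain"
  assumes "c \<in> cocycles n space"
    and "pullback_cochain n space (push collapse) c
              \<in> reduced_coboundaries n space"
    and "pullback_cochain n space (push opp.collapse) c
              \<in> reduced_coboundaries n space"
  shows "c \<in> reduced_coboundaries n space"
proof (rule mayer_vietoris_injective[OF openin_side opp.openin_side sides_cover])
  let ?X = "subtopology space (side \<inter> opp.side)"
  show "e \<in> reduced_coboundaries q ?X" if "e \<in> cocycles q ?X"
    for q and e :: "('v \<Rightarrow> real, 'k) cochain"
  proof -
    obtain H where "homotopy_between ?X ?X (\<lambda>\<alpha>. \<alpha>) (\<lambda>\<alpha>. vertex w0) H"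
      using homotopy_intersection by blast
    then show ?thesis
      using contractible_reduced_cohomology[OF _ _ that] vertex_in_intersection
      by (simp add: side_def)
  qed
qed (use vertex_in_intersection assms restrict_side opp.restrict_side in auto)

end

section \<open>Vector spaces of cohomology classes\<close>

text \<open>An elementary list of axioms that can be verified on representatives of classes.
  Negatives have no clause of their own: -1 times x is inverse to x by distributivity, as 0 times x
  is zero.\<close>

lemma vspace_iff:
  fixes V :: "('k::field, 'v) module"
  shows "vspace V \<longleftrightarrow>
     \<zero>\<^bsub>V\<^esub> \<in> carrier V \<and>
     (\<forall>x\<in>carrier V. \<forall>y\<in>carrier V. x \<oplus>\<^bsub>V\<^esub> y \<in> carrier V \<and> x \<oplus>\<^bsub>V\<^esub> y = y \<oplus>\<^bsub>V\<^esub> x) \<and>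
     (\<forall>x\<in>carrier V. \<forall>y\<in>carrier V. \<forall>z\<in>carrier V. (x \<oplus>\<^bsub>V\<^esub> y) \<oplus>\<^bsub>V\<^esub> z = x \<oplus>\<^bsub>V\<^esub> (y \<oplus>\<^bsub>V\<^esub> z)) \<and>
     (\<forall>a. \<forall>x\<in>carrier V. a \<odot>\<^bsub>V\<^esub> x \<in> carrier V) \<and>
     (\<forall>a b. \<forall>x\<in>carrier V. (a + b) \<odot>\<^bsub>V\<^esub> x = a \<odot>\<^bsub>V\<^esub> x \<oplus>\<^bsub>V\<^esub> b \<odot>\<^bsub>V\<^esub> x \<and>
                            (a * b) \<odot>\<^bsub>V\<^esub> x = a \<odot>\<^bsub>V\<^esub> (b \<odot>\<^bsub>V\<^esub> x)) \<and>
     (\<forall>a. \<forall>x\<in>carrier V. \<forall>y\<in>carrier V. a \<odot>\<^bsub>V\<^esub> (x \<oplus>\<^bsub>V\<^esub> y) = a \<odot>\<^bsub>V\<^esub> x \<oplus>\<^bsub>V\<^esub> a \<odot>\<^bsub>V\<^esub> y) \<and>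
     (\<forall>x\<in>carrier V. \<zero>\<^bsub>V\<^esub> \<oplus>\<^bsub>V\<^esub> x = x \<and> 1 \<odot>\<^bsub>V\<^esub> x = x \<and> 0 \<odot>\<^bsub>V\<^esub> x = \<zero>\<^bsub>V\<^esub>)"
    (is "_ \<longleftrightarrow> ?R")
proof
  let ?F = "field_record :: 'k ring"
  have F: "carrier ?F = UNIV" "\<one>\<^bsub>?F\<^esub> = 1" "\<zero>\<^bsub>?F\<^esub> = 0" "x \<oplus>\<^bsub>?F\<^esub> y = x + y" "x \<otimes>\<^bsub>?F\<^esub> y = x * y" for x y
    by (simp_all add: field_record_def)
  show ?R if "vspace V"
  proof -
    interpret Module.module ?F V
      using that by (simp add: vspace_def)
    show ?thesis
      using smult_closed smult_l_distr smult_r_distr smult_assoc1 smult_one smult_l_null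
      by (auto simp: F M.a_assoc intro: M.a_comm)
  qed
  show "vspace V" if R: ?R
    unfolding vspace_def
  proof (rule moduleI)
    show "cring ?F"
      using field_field_record unfolding field_def domain_def by blast
    show "abelian_group V"
    proof (rule abelian_groupI)
      show "\<exists>y\<in>carrier V. y \<oplus>\<^bsub>V\<^esub> x = \<zero>\<^bsub>V\<^esub>" if x: "x \<in> carrier V" for x
      proof (rule bexI)
        have "(-1 + 1) \<odot>\<^bsub>V\<^esub> x = -1 \<odot>\<^bsub>V\<^esub> x \<oplus>\<^bsub>V\<^esub> 1 \<odot>\<^bsub>V\<^esub> x"
          using R x by blast
        then show "-1 \<odot>\<^bsub>V\<^esub> x \<oplus>\<^bsub>V\<^esub> x = \<zero>\<^bsub>V\<^esub>"
          using R x by simp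
        show "-1 \<odot>\<^bsub>V\<^esub> x \<in> carrier V"
          using R x by blast
      qed
    qed (use R in blast)+
  qed (use R in \<open>simp_all add: F\<close>)
qed

lemma vspace_subspace:
  fixes V :: "('k::field, 'v) module"
  assumes V: "vspace V" and C: "C \<subseteq> carrier V" "\<zero>\<^bsub>V\<^esub> \<in> C"
    and add: "\<And>x y. x \<in> C \<Longrightarrow> y \<in> C \<Longrightarrow> x \<oplus>\<^bsub>V\<^esub> y \<in> C" and smult: "\<And>a x. x \<in> C \<Longrightarrow> a \<odot>\<^bsub>V\<^esub> x \<in> C"
  shows "vspace (V\<lparr>carrier := C\<rparr>)"
proof -
  let ?W = "V\<lparr>carrier := C\<rparr>"
  have eqs: "carrier ?W = C" "zero ?W = zero V" "add ?W = add V" "smult ?W = smult V"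
    by simp_all
  show ?thesis
    using V C add smult unfolding vspace_iff eqs by (intro conjI ballI allI) blast+
qed

lemma vspace_module_sum:
  assumes "vspace V" "vspace W"
  shows "vspace (module_sum V W)"
  using assms unfolding vspace_iff module_sum_def by auto

lemma vspace_closed:
  assumes "vspace V"
  shows "\<zero>\<^bsub>V\<^esub> \<in> carrier V"
    and "x \<in> carrier V \<Longrightarrow> y \<in> carrier V \<Longrightarrow> x \<oplus>\<^bsub>V\<^esub> y \<in> carrier V"
    and "x \<in> carrier V \<Longrightarrow> a \<odot>\<^bsub>V\<^esub> x \<in> carrier V"
  using assms unfolding vspace_iff by blast+

lemma linear_map_zero:
  assumes "vspace V" "vspace W" "linear_map V W f"
  shows "f \<zero>\<^bsub>V\<^esub> = \<zero>\<^bsub>W\<^esub>"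
proof -
  have z: "\<zero>\<^bsub>V\<^esub> \<in> carrier V"
    using assms(1) by (simp add: vspace_iff)
  then have "f (0 \<odot>\<^bsub>V\<^esub> \<zero>\<^bsub>V\<^esub>) = 0 \<odot>\<^bsub>W\<^esub> f \<zero>\<^bsub>V\<^esub>" "f \<zero>\<^bsub>V\<^esub> \<in> carrier W"
    using assms(3) by (auto simp: linear_map_def)
  then show ?thesis
    using assms(1,2) z by (simp add: vspace_iff)
qed

text \<open>Written with the coset operation of the quotient, so that \<open>cohomology\<close> and
  \<open>cohomology_map\<close> unfold to it; afterwards \<open>coh_class_eq_iff\<close> replaces
  cosets by differences of cochains.\<close>

definition coh_class ::
  "nat \<Rightarrow> 'a topology \<Rightarrow> ('a, 'k::field) cochain \<Rightarrow> ('a, 'k) cochain set" where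
  "coh_class n X c = reduced_coboundaries n X +>\<^bsub>cocycle_module n X\<^esub> c"

lemma coh_class_eq:
  "coh_class n X c = {\<lambda>s. h s + c s | h. h \<in> reduced_coboundaries n X}"
  unfolding coh_class_def a_r_coset_def r_coset_def
  by (auto simp: cocycle_module_def cochain_module_def)

lemma coh_class_mem_iff:
  "d \<in> coh_class n X c \<longleftrightarrow> (\<lambda>s. d s - c s) \<in> reduced_coboundaries n X"
proof
  assume "(\<lambda>s. d s - c s) \<in> reduced_coboundaries n X"
  then show "d \<in> coh_class n X c"
    unfolding coh_class_eq by (intro CollectI exI[of _ "\<lambda>s. d s - c s"]) simp
qed (auto simp: coh_class_eq)

lemma zero_reduced_coboundary: "(\<lambda>s. 0) \<in> reduced_coboundaries n X"
proof (cases n)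
  case (Suc p)
  then show ?thesis
    by (auto simp: reduced_coboundaries_Suc_iff intro!: exI[of _ "\<lambda>s. 0"] simp: cochain_eval_eq_0)
qed (auto simp: reduced_coboundaries_0_iff)

lemma coh_class_self: "c \<in> coh_class n X c"
  by (simp add: coh_class_mem_iff zero_reduced_coboundary)

lemma coh_class_eq_iff:
  "coh_class n X c = coh_class n X d \<longleftrightarrow>
     (\<lambda>s. c s - d s) \<in> reduced_coboundaries n X" (is "?L \<longleftrightarrow> ?R")
proof
  show "?L \<Longrightarrow> ?R"
    using coh_class_self[of c n X] by (simp add: coh_class_mem_iff)
  assume R: ?R
  have "(\<lambda>s. e s - d s) \<in> reduced_coboundaries n X"
    if "(\<lambda>s. e s - c s) \<in> reduced_coboundaries n X" for e
    using reduced_coboundaries_add[OF that R] by simp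
  moreover have "(\<lambda>s. e s - c s) \<in> reduced_coboundaries n X"
    if "(\<lambda>s. e s - d s) \<in> reduced_coboundaries n X" for e
    using reduced_coboundaries_diff[OF that R] by simp
  ultimately show ?L
    by (auto simp: coh_class_mem_iff)
qed

lemma carrier_cohomology:
  "carrier (cohomology n X) = coh_class n X ` cocycles n X"
  by (auto simp: cohomology_def quot_module_def A_RCOSETS_def RCOSETS_def coh_class_def
      a_r_coset_def)

lemma zero_cohomology: "\<zero>\<^bsub>cohomology n X\<^esub> = coh_class n X (\<lambda>s. 0)"
  by (simp add: cohomology_def quot_module_def coh_class_eq)

lemma add_cohomology:
  "coh_class n X c \<oplus>\<^bsub>cohomology n X\<^esub> coh_class n X d = coh_class n X (\<lambda>s. c s + d s)"
proof -
  have "coh_class n X c \<oplus>\<^bsub>cohomology n X\<^esub> coh_class n X d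
          = {\<lambda>s. c' s + d' s | c' d'. c' \<in> coh_class n X c \<and> d' \<in> coh_class n X d}"
    unfolding cohomology_def quot_module_def
    by (auto simp: set_add_def set_mult_def cocycle_module_def cochain_module_def)
  also have "\<dots> = coh_class n X (\<lambda>s. c s + d s)"
  proof (intro equalityI subsetI)
    fix e assume "e \<in> {\<lambda>s. c' s + d' s | c' d'. c' \<in> coh_class n X c \<and> d' \<in> coh_class n X d}"
    then obtain c' d' where "e = (\<lambda>s. c' s + d' s)"
      "(\<lambda>s. c' s - c s) \<in> reduced_coboundaries n X" "(\<lambda>s. d' s - d s) \<in> reduced_coboundaries n X"
      by (auto simp: coh_class_mem_iff)
    then show "e \<in> coh_class n X (\<lambda>s. c s + d s)"
      using reduced_coboundaries_add[of "\<lambda>s. c' s - c s" n X "\<lambda>s. d' s - d s"]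
      by (simp add: coh_class_mem_iff algebra_simps)
  next
    fix e assume "e \<in> coh_class n X (\<lambda>s. c s + d s)"
    then have "(\<lambda>s. e s - d s) \<in> coh_class n X c"
      by (simp add: coh_class_mem_iff algebra_simps)
    then show "e \<in> {\<lambda>s. c' s + d' s | c' d'. c' \<in> coh_class n X c \<and> d' \<in> coh_class n X d}"
      by (intro CollectI exI[of _ "\<lambda>s. e s - d s"] exI[of _ d]) (auto simp: coh_class_self)
  qed
  finally show ?thesis .
qed

lemma smult_cohomology:
  "a \<odot>\<^bsub>cohomology n X\<^esub> coh_class n X c = coh_class n X (\<lambda>s. a * c s)"
proof -
  have "a \<odot>\<^bsub>cohomology n X\<^esub> coh_class n X c
          = (\<Union>x\<in>coh_class n X c. coh_class n X (\<lambda>s. a * x s))"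
    by (simp add: cohomology_def quot_module_def coh_class_def[of n X "\<lambda>s. a * _ s"]
        cocycle_module_def cochain_module_def)
  also have "\<dots> = (\<Union>x\<in>coh_class n X c. coh_class n X (\<lambda>s. a * c s))"
  proof (rule SUP_cong[OF refl])
    fix x assume "x \<in> coh_class n X c"
    then show "coh_class n X (\<lambda>s. a * x s) = coh_class n X (\<lambda>s. a * c s)"
      using reduced_coboundaries_cmul[of "\<lambda>s. x s - c s" n X a]
      by (simp add: coh_class_eq_iff coh_class_mem_iff algebra_simps)
  qed
  also have "\<dots> = coh_class n X (\<lambda>s. a * c s)"
    using coh_class_self by blast
  finally show ?thesis .
qed

text \<open>Reduced coboundaries pull back to reduced coboundaries, so all representatives give one
  coset, and the union over them is this coset.\<close>

lemma cohomology_map_class: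
  assumes f: "continuous_map X Y f"
  shows "cohomology_map n X f (coh_class n Y c) = coh_class n X (pullback_cochain n X f c)"
proof -
  have "cohomology_map n X f (coh_class n Y c)
          = (\<Union>x\<in>coh_class n Y c. coh_class n X (pullback_cochain n X f c))"
    unfolding cohomology_map_def coh_class_def[symmetric]
  proof (rule SUP_cong[OF refl])
    fix x assume "x \<in> coh_class n Y c"
    moreover have "pullback_cochain n X f (\<lambda>s. x s - c s)
                     = (\<lambda>s. pullback_cochain n X f x s - pullback_cochain n X f c s)"
      by (auto simp: pullback_cochain_def)
    ultimately show "coh_class n X (pullback_cochain n X f x)
                       = coh_class n X (pullback_cochain n X f c)"
      using pullback_reduced_coboundary[OF f, of "\<lambda>s. x s - c s" n]
      by (simp add: coh_class_eq_iff coh_class_mem_iff)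
  qed
  then show ?thesis
    using coh_class_self by blast
qed

lemma cocycle_add:
  "c \<in> cocycles n X \<Longrightarrow> d \<in> cocycles n X \<Longrightarrow>
     (\<lambda>s. c s + d s) \<in> cocycles n X"
  and cocycle_cmul: "c \<in> cocycles n X \<Longrightarrow> (\<lambda>s. a * c s) \<in> cocycles n X"
  by (simp_all add: cocycle_iff cochain_eval_add_left cochain_eval_cmul_left)

lemma zero_cocycle: "(\<lambda>s. 0) \<in> cocycles n X"
  using zero_reduced_coboundary reduced_coboundaries_subset_cocycles by blast

lemma vspace_cohomology: "vspace (cohomology n X)"
  unfolding vspace_iff carrier_cohomology zero_cohomology
  by (simp add: ball_simps add_cohomology smult_cohomology cocycle_add cocycle_cmul zero_cocycle
      algebra_simps)

lemma linear_map_cohomology_map: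
  assumes "continuous_map X Y f"
  shows "linear_map (cohomology n Y :: ('k::field, _) module) (cohomology n X) (cohomology_map n X f)"
proof -
  have "pullback_cochain n X f c \<in> cocycles n X"
    if "c \<in> cocycles n Y" for c :: "(_, 'k) cochain"
    by (rule pullback_cocycle[OF assms that])
  moreover
  have "pullback_cochain n X f (\<lambda>s. c s + d s)
          = (\<lambda>s. pullback_cochain n X f c s + pullback_cochain n X f d s)"
    "pullback_cochain n X f (\<lambda>s. a * c s) = (\<lambda>s. a * pullback_cochain n X f c s)"
    for a :: 'k and c d
    by (auto simp: pullback_cochain_def)
  ultimately show ?thesis
    by (auto simp: linear_map_def carrier_cohomology cohomology_map_class[OF assms] add_cohomology
        smult_cohomology)
qed

lemma cohomology_map_ident:
  assumes A: "A \<in> carrier (cohomology n X)" and f: "\<And>x. x \<in> topspace X \<Longrightarrow> f x = x"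
  shows "cohomology_map n X f A = A"
proof -
  have "continuous_map X X f"
    by (rule continuous_map_eq[OF continuous_map_id]) (simp add: f)
  then show ?thesis
    using A by (auto simp: carrier_cohomology cohomology_map_class pullback_cochain_ident f)
qed

lemma cohomology_map_compose:
  fixes A :: "('c, 'k::field) cochain set"
  assumes A: "A \<in> carrier (cohomology n Z)" and f: "continuous_map X Y f" and g: "continuous_map Y Z g"
    and h: "\<And>x. x \<in> topspace X \<Longrightarrow> h x = g (f x)"
  shows "cohomology_map n X f (cohomology_map n Y g A) = cohomology_map n X h A"
proof -
  have "continuous_map X Z h"
    by (rule continuous_map_eq[OF continuous_map_compose[OF f g]]) (simp add: h)
  moreover have "pullback_cochain n X f (pullback_cochain n Y g c) = pullback_cochain n X h c"
    for c :: "('c, 'k) cochain"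
    unfolding pullback_cochain_compose[OF f] by (rule pullback_cochain_cong) (simp add: h)
  ultimately show ?thesis
    using A by (auto simp: carrier_cohomology cohomology_map_class f g)
qed

section \<open>Image and kernel persistence modules\<close>

lemma persistence_module_sum:
  assumes "persistence_module M" "persistence_module N"
  shows "persistence_module (pmodule_sum M N)"
  using assms unfolding persistence_module_def
  by (auto simp: pmodule_sum_def vspace_module_sum)
     (auto simp: linear_map_def module_sum_def Pi_iff)

lemma operation_linear:
  "linear_cohomology_operation l m \<theta> \<Longrightarrow> cw_complex X \<Longrightarrow>
     linear_map (cohomology l X) (cohomology m X) (\<theta> X)"
  by (simp add: linear_cohomology_operation_def)

lemma operation_natural:
  "linear_cohomology_operation l m \<theta> \<Longrightarrow> cw_complex X \<Longrightarrow> cw_complex Y \<Longrightarrow> continuous_map X Y f \<Longrightarrow>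
     A \<in> carrier (cohomology l Y) \<Longrightarrow>
     cohomology_map m X f (\<theta> Y A) = \<theta> X (cohomology_map l X f A)"
  by (simp add: linear_cohomology_operation_def)

lemma linear_map_closed: "linear_map V W f \<Longrightarrow> x \<in> carrier V \<Longrightarrow> f x \<in> carrier W"
  by (auto simp: linear_map_def)

text \<open>Image and kernel are both families of subspaces stable under the structure maps;
  linearity and functoriality are inherited from cohomology.\<close>

lemma persistence_submodule:
  fixes C :: "real \<Rightarrow> ('u, 'k::field) cochain set set"
  assumes X: "cellular_rspace X"
    and V: "\<And>r. vspace ((cohomology n (robj X r))\<lparr>carrier := C r\<rparr>)"
    and C: "\<And>r. C r \<subseteq> carrier (cohomology n (robj X r))"
    and closed: "\<And>s t A. s \<le> t \<Longrightarrow> A \<in> C t \<Longrightarrow> cohomology_map n (robj X s) (rmap X s t) A \<in> C s"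
  shows "persistence_module
           \<lparr>pobj = \<lambda>r. (cohomology n (robj X r))\<lparr>carrier := C r\<rparr>,
            pmap = \<lambda>s t. cohomology_map n (robj X s) (rmap X s t)\<rparr>"
proof -
  have cont: "continuous_map (robj X s) (robj X t) (rmap X s t)" if "s \<le> t" for s t
    using X that by (simp add: cellular_rspace_def)
  have "linear_map ((cohomology n (robj X t))\<lparr>carrier := C t\<rparr>) ((cohomology n (robj X s))\<lparr>carrier := C s\<rparr>)
          (cohomology_map n (robj X s) (rmap X s t))" if "s \<le> t" for s t
    using linear_map_cohomology_map[OF cont[OF that], of n, where ?'k = 'k] C[of t] closed[OF that]
    by (auto simp: linear_map_def subset_iff)
  moreover have "cohomology_map n (robj X r) (rmap X r r) A = A" if "A \<in> C r" for r A
    using X C that by (intro cohomology_map_ident) (auto simp: cellular_rspace_def)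
  moreover have "cohomology_map n (robj X r) (rmap X r s) (cohomology_map n (robj X s) (rmap X s t) A)
                   = cohomology_map n (robj X r) (rmap X r t) A"
    if "A \<in> C t" "r \<le> s" "s \<le> t" for r s t A
    using X C that cont by (intro cohomology_map_compose) (auto simp: cellular_rspace_def)
  ultimately show ?thesis
    using V by (simp add: persistence_module_def)
qed

lemma persistence_module_im:
  assumes X: "cellular_rspace X" and \<theta>: "linear_cohomology_operation l m \<theta>"
  shows "persistence_module (im_pmodule l m \<theta> X)"
  unfolding im_pmodule_def
proof (rule persistence_submodule[OF X])
  fix r
  let ?H = "\<lambda>n. cohomology n (robj X r)"
  let ?I = "\<theta> (robj X r) ` carrier (?H l)"
  have lin: "linear_map (?H l) (?H m) (\<theta> (robj X r))"
    using X \<theta> by (intro operation_linear) (auto simp: cellular_rspace_def)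
  show C: "?I \<subseteq> carrier (?H m)"
    using linear_map_closed[OF lin] by blast
  show "vspace ((?H m)\<lparr>carrier := ?I\<rparr>)"
  proof (rule vspace_subspace[OF vspace_cohomology C])
    show "\<zero>\<^bsub>?H m\<^esub> \<in> ?I"
    proof (rule image_eqI)
      show "\<zero>\<^bsub>?H m\<^esub> = \<theta> (robj X r) \<zero>\<^bsub>?H l\<^esub>"
        using linear_map_zero[OF vspace_cohomology vspace_cohomology lin] by simp
      show "\<zero>\<^bsub>?H l\<^esub> \<in> carrier (?H l)"
        by (rule vspace_closed[OF vspace_cohomology])
    qed
    fix A B a assume "A \<in> ?I"
    then obtain A' where A': "A = \<theta> (robj X r) A'" "A' \<in> carrier (?H l)"
      by blast
    have "\<theta> (robj X r) (a \<odot>\<^bsub>?H l\<^esub> A') = a \<odot>\<^bsub>?H m\<^esub> A"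
      using lin A' by (simp add: linear_map_def)
    moreover have "a \<odot>\<^bsub>?H l\<^esub> A' \<in> carrier (?H l)"
      by (rule vspace_closed(3)[OF vspace_cohomology A'(2)])
    ultimately show "a \<odot>\<^bsub>?H m\<^esub> A \<in> ?I"
      by (metis image_eqI)
    assume "B \<in> ?I"
    then obtain B' where B': "B = \<theta> (robj X r) B'" "B' \<in> carrier (?H l)"
      by blast
    have "\<theta> (robj X r) (A' \<oplus>\<^bsub>?H l\<^esub> B') = A \<oplus>\<^bsub>?H m\<^esub> B"
      using lin A' B' by (simp add: linear_map_def)
    moreover have "A' \<oplus>\<^bsub>?H l\<^esub> B' \<in> carrier (?H l)"
      by (rule vspace_closed(2)[OF vspace_cohomology A'(2) B'(2)])
    ultimately show "A \<oplus>\<^bsub>?H m\<^esub> B \<in> ?I"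
      by (metis image_eqI)
  qed
next
  fix s t A assume st: "s \<le> t" and "A \<in> \<theta> (robj X t) ` carrier (cohomology l (robj X t))"
  then obtain A' where A': "A = \<theta> (robj X t) A'" "A' \<in> carrier (cohomology l (robj X t))"
    by blast
  have cont: "continuous_map (robj X s) (robj X t) (rmap X s t)"
    using X st by (simp add: cellular_rspace_def)
  have "cohomology_map m (robj X s) (rmap X s t) A
          = \<theta> (robj X s) (cohomology_map l (robj X s) (rmap X s t) A')"
    unfolding A'(1) by (rule operation_natural[OF \<theta> _ _ cont A'(2)])
      (use X in \<open>auto simp: cellular_rspace_def\<close>)
  then show "cohomology_map m (robj X s) (rmap X s t) A \<in> \<theta> (robj X s) ` carrier (cohomology l (robj X s))"
    using linear_map_closed[OF linear_map_cohomology_map[OF cont] A'(2)] by blast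
qed

lemma persistence_module_ker:
  assumes X: "cellular_rspace X" and \<theta>: "linear_cohomology_operation l m \<theta>"
  shows "persistence_module (ker_pmodule l m \<theta> X)"
  unfolding ker_pmodule_def
proof (rule persistence_submodule[OF X])
  fix r
  let ?H = "\<lambda>n. cohomology n (robj X r)"
  let ?C = "{A \<in> carrier (?H l). \<theta> (robj X r) A = \<zero>\<^bsub>?H m\<^esub>}"
  have lin: "linear_map (?H l) (?H m) (\<theta> (robj X r))"
    using X \<theta> by (intro operation_linear) (auto simp: cellular_rspace_def)
  show C: "?C \<subseteq> carrier (?H l)"
    by blast
  have V: "vspace (?H l)" "vspace (?H m)"
    by (rule vspace_cohomology)+
  have z: "\<zero>\<^bsub>?H m\<^esub> \<oplus>\<^bsub>?H m\<^esub> \<zero>\<^bsub>?H m\<^esub> = \<zero>\<^bsub>?H m\<^esub>" "a \<odot>\<^bsub>?H m\<^esub> \<zero>\<^bsub>?H m\<^esub> = \<zero>\<^bsub>?H m\<^esub>" for a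
    by (simp_all add: zero_cohomology add_cohomology smult_cohomology)
  show "vspace ((?H l)\<lparr>carrier := ?C\<rparr>)"
    by (rule vspace_subspace[OF V(1) C])
       (use linear_map_zero[OF V lin] V lin z in \<open>auto simp: vspace_iff linear_map_def\<close>)
next
  fix s t A assume st: "s \<le> t"
    and A: "A \<in> {A \<in> carrier (cohomology l (robj X t)). \<theta> (robj X t) A = \<zero>\<^bsub>cohomology m (robj X t)\<^esub>}"
  have cont: "continuous_map (robj X s) (robj X t) (rmap X s t)"
    using X st by (simp add: cellular_rspace_def)
  note lin = linear_map_cohomology_map[OF cont]
  have "\<theta> (robj X s) (cohomology_map l (robj X s) (rmap X s t) A)
          = cohomology_map m (robj X s) (rmap X s t) (\<theta> (robj X t) A)"
    by (rule operation_natural[OF \<theta> _ _ cont, symmetric]) (use X A in \<open>auto simp: cellular_rspace_def\<close>)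
  also have "\<dots> = \<zero>\<^bsub>cohomology m (robj X s)\<^esub>"
    using A linear_map_zero[OF vspace_cohomology vspace_cohomology lin] by simp
  finally show "cohomology_map l (robj X s) (rmap X s t) A
      \<in> {A \<in> carrier (cohomology l (robj X s)). \<theta> (robj X s) A = \<zero>\<^bsub>cohomology m (robj X s)\<^esub>}"
    using linear_map_closed[OF lin] A by blast
qed

section \<open>Splitting of image and kernel from a splitting of cohomology\<close>

text \<open>By \<open>iff\<close>, \<open>C\<close> is the preimage of
  \<open>C\<^sub>1 \<times> C\<^sub>2\<close> under the bijection, which therefore
  restricts.\<close>

lemma bij_betw_Pair_images:
  assumes bij: "bij_betw (\<lambda>A. (i A, j A)) H (P \<times> Q)" and C: "C \<subseteq> H"
    and iff: "\<And>A. A \<in> H \<Longrightarrow> A \<in> C \<longleftrightarrow> i A \<in> C\<^sub>1 \<and> j A \<in> C\<^sub>2" and sub: "C\<^sub>1 \<subseteq> P" "C\<^sub>2 \<subseteq> Q"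
  shows "bij_betw (\<lambda>A. (i A, j A)) C (C\<^sub>1 \<times> C\<^sub>2)"
  unfolding bij_betw_def
proof
  show "inj_on (\<lambda>A. (i A, j A)) C"
    using bij C by (meson bij_betw_def inj_on_subset)
  show "(\<lambda>A. (i A, j A)) ` C = C\<^sub>1 \<times> C\<^sub>2"
  proof
    show "(\<lambda>A. (i A, j A)) ` C \<subseteq> C\<^sub>1 \<times> C\<^sub>2"
      using iff C by auto
    show "C\<^sub>1 \<times> C\<^sub>2 \<subseteq> (\<lambda>A. (i A, j A)) ` C"
    proof
      fix p assume p: "p \<in> C\<^sub>1 \<times> C\<^sub>2"
      then have "p \<in> (\<lambda>A. (i A, j A)) ` H"
        using sub bij by (auto simp: bij_betw_def)
      then obtain A where "A \<in> H" "p = (i A, j A)"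
        by blast
      then show "p \<in> (\<lambda>A. (i A, j A)) ` C"
        using p iff[of A] by blast
    qed
  qed
qed

text \<open>The restriction maps commute with \<theta>. For the kernel, the bijection in degree
  \<open>l\<close> is cut down by means of injectivity in degree \<open>m\<close>; for the image,
  the bijection in degree \<open>m\<close> is cut down by means of surjectivity in degree
  \<open>l\<close>.\<close>

lemma operation_modules_iso:
  fixes \<theta> :: "'u topology \<Rightarrow> ('u, 'k::field) cochain set \<Rightarrow> ('u, 'k) cochain set"
  assumes X: "cellular_rspace X" and Y: "cellular_rspace Y" and W: "cellular_rspace W"
    and \<theta>: "linear_cohomology_operation l m \<theta>"
    and i: "\<And>r. continuous_map (robj X r) (robj W r) (i r)"
    and j: "\<And>r. continuous_map (robj Y r) (robj W r) (j r)"
    and i_nat: "\<And>s t x. s \<le> t \<Longrightarrow> x \<in> topspace (robj X s) \<Longrightarrow> rmap W s t (i s x) = i t (rmap X s t x)"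
    and j_nat: "\<And>s t y. s \<le> t \<Longrightarrow> y \<in> topspace (robj Y s) \<Longrightarrow> rmap W s t (j s y) = j t (rmap Y s t y)"
    and bij: "\<And>n r. bij_betw (\<lambda>A. (cohomology_map n (robj X r) (i r) A, cohomology_map n (robj Y r) (j r) A))
          (carrier (cohomology n (robj W r) :: ('k, _) module))
          (carrier (cohomology n (robj X r)) \<times> carrier (cohomology n (robj Y r)))"
  shows "pmodule_iso (im_pmodule l m \<theta> W) (pmodule_sum (im_pmodule l m \<theta> X) (im_pmodule l m \<theta> Y))"
    and "pmodule_iso (ker_pmodule l m \<theta> W) (pmodule_sum (ker_pmodule l m \<theta> X) (ker_pmodule l m \<theta> Y))"
proof -
  have cw: "cw_complex (robj X r)" "cw_complex (robj Y r)" "cw_complex (robj W r)" for r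
    using X Y W by (auto simp: cellular_rspace_def)
  have maps: "continuous_map (robj X s) (robj X t) (rmap X s t)"
    "continuous_map (robj Y s) (robj Y t) (rmap Y s t)"
    "continuous_map (robj W s) (robj W t) (rmap W s t)" if "s \<le> t" for s t
    using X Y W that by (auto simp: cellular_rspace_def)
  let ?I = "\<lambda>Z r. \<theta> (robj Z r) ` carrier (cohomology l (robj Z r))"
  let ?N = "\<lambda>Z r. {A \<in> carrier (cohomology l (robj Z r)). \<theta> (robj Z r) A = \<zero>\<^bsub>cohomology m (robj Z r)\<^esub>}"
  define \<phi> :: "nat \<Rightarrow> real \<Rightarrow> ('u, 'k) cochain set \<Rightarrow> ('u, 'k) cochain set \<times> ('u, 'k) cochain set"
    where "\<phi> = (\<lambda>n r A. (cohomology_map n (robj X r) (i r) A, cohomology_map n (robj Y r) (j r) A))"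
  have bij\<phi>: "bij_betw (\<phi> n r) (carrier (cohomology n (robj W r)))
      (carrier (cohomology n (robj X r)) \<times> carrier (cohomology n (robj Y r)))" for n r
    unfolding \<phi>_def by (rule bij)
  have lin_i: "linear_map (cohomology n (robj W r) :: ('k, _) module) (cohomology n (robj X r))
                 (cohomology_map n (robj X r) (i r))" for n r
    by (rule linear_map_cohomology_map[OF i])
  have lin_j: "linear_map (cohomology n (robj W r) :: ('k, _) module) (cohomology n (robj Y r))
                 (cohomology_map n (robj Y r) (j r))" for n r
    by (rule linear_map_cohomology_map[OF j])
  have nat_i: "cohomology_map n (robj X s) (i s) (cohomology_map n (robj W s) (rmap W s t) A)
             = cohomology_map n (robj X s) (rmap X s t) (cohomology_map n (robj X t) (i t) A)"
    if "s \<le> t" "A \<in> carrier (cohomology n (robj W t))" for n s t and A :: "('u, 'k) cochain set"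
    using cohomology_map_compose[OF that(2) i[of s] maps(3)[OF that(1)] refl]
      cohomology_map_compose[OF that(2) maps(1)[OF that(1)] i[of t], of "\<lambda>x. rmap W s t (i s x)"]
      i_nat[OF that(1)] by simp
  have nat_j: "cohomology_map n (robj Y s) (j s) (cohomology_map n (robj W s) (rmap W s t) A)
             = cohomology_map n (robj Y s) (rmap Y s t) (cohomology_map n (robj Y t) (j t) A)"
    if "s \<le> t" "A \<in> carrier (cohomology n (robj W t))" for n s t and A :: "('u, 'k) cochain set"
    using cohomology_map_compose[OF that(2) j[of s] maps(3)[OF that(1)] refl]
      cohomology_map_compose[OF that(2) maps(2)[OF that(1)] j[of t], of "\<lambda>x. rmap W s t (j s x)"]
      j_nat[OF that(1)] by simp
  have op_i: "cohomology_map m (robj X r) (i r) (\<theta> (robj W r) A)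
                = \<theta> (robj X r) (cohomology_map l (robj X r) (i r) A)"
    and op_j: "cohomology_map m (robj Y r) (j r) (\<theta> (robj W r) A)
                = \<theta> (robj Y r) (cohomology_map l (robj Y r) (j r) A)"
    if "A \<in> carrier (cohomology l (robj W r))" for r A
    using operation_natural[OF \<theta> cw(1,3) i that] operation_natural[OF \<theta> cw(2,3) j that] by auto
  \<comment> \<open>The part common to image and kernel: for subspaces of the cohomology in one
    degree \<open>n\<close>, only the restricted bijection remains to be supplied.\<close>
  have iso: "pmodule_iso M (pmodule_sum M1 M2)"
    if "persistence_module M" "persistence_module M1" "persistence_module M2"
      and M: "M = \<lparr>pobj = \<lambda>r. (cohomology n (robj W r))\<lparr>carrier := C r\<rparr>,
                   pmap = \<lambda>s t. cohomology_map n (robj W s) (rmap W s t)\<rparr>"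
      and M1: "M1 = \<lparr>pobj = \<lambda>r. (cohomology n (robj X r))\<lparr>carrier := C1 r\<rparr>,
                   pmap = \<lambda>s t. cohomology_map n (robj X s) (rmap X s t)\<rparr>"
      and M2: "M2 = \<lparr>pobj = \<lambda>r. (cohomology n (robj Y r))\<lparr>carrier := C2 r\<rparr>,
                   pmap = \<lambda>s t. cohomology_map n (robj Y s) (rmap Y s t)\<rparr>"
      and C: "\<And>r. C r \<subseteq> carrier (cohomology n (robj W r))"
      and b: "\<And>r. bij_betw (\<phi> n r) (C r) (C1 r \<times> C2 r)"
    for n :: nat and M M1 M2 :: "('k, ('u, 'k) cochain set) pmodule" and C C1 C2
    unfolding pmodule_iso_def
  proof (intro conjI exI[of _ "\<phi> n"] allI impI ballI)
    show "persistence_module M" "persistence_module (pmodule_sum M1 M2)"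
      using that(1,2,3) persistence_module_sum by auto
    fix r
    have im: "\<phi> n r A \<in> C1 r \<times> C2 r" if "A \<in> C r" for A
      using b[of r] that by (auto simp: bij_betw_def)
    show "linear_map (pobj M r) (pobj (pmodule_sum M1 M2) r) (\<phi> n r)"
      using lin_i[of n r] lin_j[of n r] C[of r] im
      by (auto simp: linear_map_def M M1 M2 pmodule_sum_def module_sum_def \<phi>_def subset_iff)
    show "bij_betw (\<phi> n r) (carrier (pobj M r)) (carrier (pobj (pmodule_sum M1 M2) r))"
      using b[of r] by (simp add: M M1 M2 pmodule_sum_def module_sum_def)
  next
    fix s t :: real and A assume st: "s \<le> t" and A: "A \<in> carrier (pobj M t)"
    then have "A \<in> carrier (cohomology n (robj W t))"
      using C by (auto simp: M)
    then show "\<phi> n s (pmap M s t A) = pmap (pmodule_sum M1 M2) s t (\<phi> n t A)"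
      using nat_i[OF st] nat_j[OF st] by (simp add: M M1 M2 pmodule_sum_def \<phi>_def)
  qed
  have \<theta>_closed: "(?I Z r) \<subseteq> carrier (cohomology m (robj Z r))"
    if "cw_complex (robj Z r)" for Z r
    using linear_map_closed[OF operation_linear[OF \<theta> that]] by blast
  show "pmodule_iso (im_pmodule l m \<theta> W) (pmodule_sum (im_pmodule l m \<theta> X) (im_pmodule l m \<theta> Y))"
  proof (rule iso[OF persistence_module_im[OF W \<theta>] persistence_module_im[OF X \<theta>]
          persistence_module_im[OF Y \<theta>] im_pmodule_def im_pmodule_def im_pmodule_def \<theta>_closed[OF cw(3)]])
    fix r
    show "bij_betw (\<phi> m r) ((?I W r))
            ((?I X r)
               \<times> (?I Y r))"
      unfolding \<phi>_def
    proof (rule bij_betw_Pair_images[OF bij \<theta>_closed[OF cw(3)] _ \<theta>_closed[OF cw(1)] \<theta>_closed[OF cw(2)]])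
      fix A :: "('u, 'k) cochain set" assume A: "A \<in> carrier (cohomology m (robj W r))"
      let ?i = "\<lambda>n. cohomology_map n (robj X r) (i r)" and ?j = "\<lambda>n. cohomology_map n (robj Y r) (j r)"
      show "A \<in> (?I W r) \<longleftrightarrow>
              ?i m A \<in> (?I X r) \<and>
              ?j m A \<in> (?I Y r)"
      proof (intro iffI conjI)
        assume "A \<in> (?I W r)"
        then show "?i m A \<in> (?I X r)"
          "?j m A \<in> (?I Y r)"
          using op_i op_j linear_map_closed[OF lin_i] linear_map_closed[OF lin_j] by auto
      next
        assume "?i m A \<in> (?I X r) \<and>
              ?j m A \<in> (?I Y r)"
        then obtain B1 B2 where B: "B1 \<in> carrier (cohomology l (robj X r))" "?i m A = \<theta> (robj X r) B1"
          "B2 \<in> carrier (cohomology l (robj Y r))" "?j m A = \<theta> (robj Y r) B2"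
          by blast
        \<comment> \<open>A class \<open>B\<close> lifting both preimages exists by surjectivity;
          its image under \<theta> and \<open>A\<close> have the same restrictions, hence are
          equal.\<close>
        then have "(B1, B2) \<in> (\<phi> l r) ` carrier (cohomology l (robj W r))"
          using bij\<phi>[of l r] by (simp add: bij_betw_def)
        then obtain B where B': "B \<in> carrier (cohomology l (robj W r))" "?i l B = B1" "?j l B = B2"
          by (auto simp: \<phi>_def)
        then have "\<phi> m r (\<theta> (robj W r) B) = \<phi> m r A"
          using op_i op_j B by (simp add: \<phi>_def)
        then have "\<theta> (robj W r) B = A"
          using bij\<phi>[of m r] A B'(1) \<theta>_closed[OF cw(3)] unfolding bij_betw_def
          by (meson image_subset_iff inj_onD)
        then show "A \<in> (?I W r)"
          using B'(1) by blast
      qed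
    qed
  qed
  show "pmodule_iso (ker_pmodule l m \<theta> W) (pmodule_sum (ker_pmodule l m \<theta> X) (ker_pmodule l m \<theta> Y))"
  proof (rule iso[OF persistence_module_ker[OF W \<theta>] persistence_module_ker[OF X \<theta>]
          persistence_module_ker[OF Y \<theta>] ker_pmodule_def ker_pmodule_def ker_pmodule_def])
    fix r
    show "(?N W r)
            \<subseteq> carrier (cohomology l (robj W r))"
      by blast
    show "bij_betw (\<phi> l r)
       (?N W r)
       ((?N X r) \<times>
        (?N Y r))"
      unfolding \<phi>_def
    proof (rule bij_betw_Pair_images[OF bij])
      fix A :: "('u, 'k) cochain set" assume A: "A \<in> carrier (cohomology l (robj W r))"
      let ?i = "\<lambda>n. cohomology_map n (robj X r) (i r)" and ?j = "\<lambda>n. cohomology_map n (robj Y r) (j r)"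
      let ?H = "\<lambda>Z. cohomology m (robj Z r) :: ('k, ('u, 'k) cochain set) module"
      have z: "?i m \<zero>\<^bsub>?H W\<^esub> = \<zero>\<^bsub>?H X\<^esub>" "?j m \<zero>\<^bsub>?H W\<^esub> = \<zero>\<^bsub>?H Y\<^esub>"
        by (rule linear_map_zero[OF vspace_cohomology vspace_cohomology lin_i]
                 linear_map_zero[OF vspace_cohomology vspace_cohomology lin_j])+
      have zW: "\<zero>\<^bsub>?H W\<^esub> \<in> carrier (?H W)"
        by (rule vspace_closed[OF vspace_cohomology])
      have \<theta>A: "\<theta> (robj W r) A \<in> carrier (?H W)"
        using A \<theta>_closed[OF cw(3)] by blast
      have "\<theta> (robj W r) A = \<zero>\<^bsub>?H W\<^esub> \<longleftrightarrow> \<phi> m r (\<theta> (robj W r) A) = \<phi> m r \<zero>\<^bsub>?H W\<^esub>"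
        using bij\<phi>[of m r] zW \<theta>A unfolding bij_betw_def by (metis inj_onD)
      also have "\<dots> \<longleftrightarrow> \<theta> (robj X r) (?i l A) = \<zero>\<^bsub>?H X\<^esub> \<and> \<theta> (robj Y r) (?j l A) = \<zero>\<^bsub>?H Y\<^esub>"
        by (simp add: \<phi>_def op_i[OF A] op_j[OF A] z)
      finally show "A \<in> (?N W r) \<longleftrightarrow>
         ?i l A \<in> (?N X r) \<and>
         ?j l A \<in> (?N Y r)"
        using A linear_map_closed[OF lin_i A] linear_map_closed[OF lin_j A] by simp
    qed auto
  qed
qed

section \<open>Cohomology of a wedge of complexes\<close>

text \<open>The summands are complexes on vertex types of their own: \<open>gX\<close>,
  \<open>gY\<close> are the inclusions, and \<open>qX\<close>, \<open>qY\<close> the retractions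
  that send the other summand to the base point. The identities between them are asked only at
  vertices of simplices, since the maps are uncontrolled elsewhere.\<close>

lemma (in wedge_complex) cohomology_wedge_bij:
  fixes KX :: "'x set set" and KY :: "'y set set"
    and gX :: "'x \<Rightarrow> 'v" and gY :: "'y \<Rightarrow> 'v"
  assumes KX: "abstract_complex KX" and KY: "abstract_complex KY"
    and gX: "\<And>\<sigma>. \<sigma> \<in> KX \<Longrightarrow> gX ` \<sigma> \<in> K" and gY: "\<And>\<sigma>. \<sigma> \<in> KY \<Longrightarrow> gY ` \<sigma> \<in> K"
    and qX: "\<And>\<sigma>. \<sigma> \<in> K \<Longrightarrow> qX ` \<sigma> \<in> KX" and qY: "\<And>\<sigma>. \<sigma> \<in> K \<Longrightarrow> qY ` \<sigma> \<in> KY"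
    and qgX: "\<And>\<sigma> v. \<sigma> \<in> KX \<Longrightarrow> v \<in> \<sigma> \<Longrightarrow> qX (gX v) = v" and qgY: "\<And>\<sigma> v. \<sigma> \<in> KY \<Longrightarrow> v \<in> \<sigma> \<Longrightarrow> qY (gY v) = v"
    and qXY: "\<And>\<sigma> v. \<sigma> \<in> KY \<Longrightarrow> v \<in> \<sigma> \<Longrightarrow> qX (gY v) = x0" and qYX: "\<And>\<sigma> v. \<sigma> \<in> KX \<Longrightarrow> v \<in> \<sigma> \<Longrightarrow> qY (gX v) = y0"
    and gqX: "\<And>\<sigma> v. \<sigma> \<in> K \<Longrightarrow> v \<in> \<sigma> \<Longrightarrow> gX (qX v) = (if v \<in> A then v else w0)"
    and gqY: "\<And>\<sigma> v. \<sigma> \<in> K \<Longrightarrow> v \<in> \<sigma> \<Longrightarrow> gY (qY v) = (if v \<in> B then v else w0)"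
    and base': "{x0} \<in> KX" "{y0} \<in> KY"
  shows "bij_betw (\<lambda>C. (cohomology_map n (geometric_realization KX) (push gX) C,
                        cohomology_map n (geometric_realization KY) (push gY) C))
           (carrier (cohomology n (geometric_realization K) :: ('k::field, _) module))
           (carrier (cohomology n (geometric_realization KX)) \<times> carrier (cohomology n (geometric_realization KY)))"
proof -
  interpret opp: wedge_complex K B A w0
    by (rule swap)
  let ?W = "geometric_realization K" and ?X = "geometric_realization KX" and ?Y = "geometric_realization KY"
  let ?\<phi> = "\<lambda>C. (cohomology_map n ?X (push gX) C, cohomology_map n ?Y (push gY) C)"
  have finX: "\<sigma> \<in> KX \<Longrightarrow> finite \<sigma>" and finY: "\<tau> \<in> KY \<Longrightarrow> finite \<tau>" for \<sigma> \<tau>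
    using KX KY by (auto simp: abstract_complex_def)
  have i: "continuous_map ?X ?W (push gX)" and j: "continuous_map ?Y ?W (push gY)"
    and p: "continuous_map ?W ?X (push qX)" and q: "continuous_map ?W ?Y (push qY)"
    by (rule continuous_map_push; use fin finX finY gX gY qX qY in blast)+
  have pull_add: "pullback_cochain n T f (\<lambda>s. c s + d s)
                    = (\<lambda>s. pullback_cochain n T f c s + pullback_cochain n T f d s)"
    and pull_diff: "pullback_cochain n T f (\<lambda>s. c s - d s)
                    = (\<lambda>s. pullback_cochain n T f c s - pullback_cochain n T f d s)"
    for T :: "'t topology" and f :: "'t \<Rightarrow> 's" and c d :: "('s, 'k) cochain"
    by (auto simp: pullback_cochain_def)
  show ?thesis
    unfolding bij_betw_def
  proof
    show "inj_on ?\<phi> (carrier (cohomology n ?W :: ('k, _) module))"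
    proof (rule inj_onI)
      fix C D :: "('v \<Rightarrow> real, 'k) cochain set" assume "C \<in> carrier (cohomology n ?W :: ('k, _) module)" "D \<in> carrier (cohomology n ?W :: ('k, _) module)"
        and eq: "(cohomology_map n ?X (push gX) C, cohomology_map n ?Y (push gY) C)
               = (cohomology_map n ?X (push gX) D, cohomology_map n ?Y (push gY) D)"
      then obtain c d where c: "c \<in> cocycles n ?W" "C = coh_class n ?W c"
        and d: "d \<in> cocycles n ?W" "D = coh_class n ?W d"
        by (auto simp: carrier_cohomology)
      let ?e = "\<lambda>s. c s - d s"
      have e: "?e \<in> cocycles n ?W"
        using cocycle_add[OF c(1) cocycle_cmul[OF d(1), of "-1"]] by simp
      have eX: "pullback_cochain n ?X (push gX) ?e \<in> reduced_coboundaries n ?X"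
        and eY: "pullback_cochain n ?Y (push gY) ?e \<in> reduced_coboundaries n ?Y"
        using eq by (simp_all add: c(2) d(2) cohomology_map_class[OF i] cohomology_map_class[OF j]
            coh_class_eq_iff pull_diff)
      \<comment> \<open>Retraction followed by inclusion is the collapse, so vanishing on a summand
        becomes vanishing of the pullback along the collapse.\<close>
      have "(push gX \<circ> push qX) \<alpha> = push collapse \<alpha>" "(push gY \<circ> push qY) \<alpha> = push opp.collapse \<alpha>"
        if \<alpha>: "\<alpha> \<in> topspace ?W" for \<alpha>
      proof -
        obtain \<sigma> where \<sigma>: "\<sigma> \<in> K" "\<alpha> \<in> realized_simplex \<sigma>"
          using \<alpha> by (auto simp: topspace_geometric_realization)
        show "(push gX \<circ> push qX) \<alpha> = push collapse \<alpha>"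
          using push_compose[OF fin[OF \<sigma>(1)] \<sigma>(2), of gX qX]
            push_cong[OF fin[OF \<sigma>(1)] \<sigma>(2), of "gX \<circ> qX" collapse] gqX[OF \<sigma>(1)]
          by (simp add: collapse_def)
        show "(push gY \<circ> push qY) \<alpha> = push opp.collapse \<alpha>"
          using push_compose[OF fin[OF \<sigma>(1)] \<sigma>(2), of gY qY]
            push_cong[OF fin[OF \<sigma>(1)] \<sigma>(2), of "gY \<circ> qY" opp.collapse] gqY[OF \<sigma>(1)]
          by (simp add: opp.collapse_def)
      qed
      then have "pullback_cochain n ?W (push collapse) ?e \<in> reduced_coboundaries n ?W"
        "pullback_cochain n ?W (push opp.collapse) ?e \<in> reduced_coboundaries n ?W"
        using pullback_reduced_coboundary[OF p eX] pullback_reduced_coboundary[OF q eY]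
          pullback_cochain_cong[of ?W "push gX \<circ> push qX" "push collapse" n ?e]
          pullback_cochain_cong[of ?W "push gY \<circ> push qY" "push opp.collapse" n ?e]
        by (simp_all add: pullback_cochain_compose[OF p] pullback_cochain_compose[OF q])
      then show "C = D"
        using reduced_coboundary_from_sides[OF e] by (simp add: c(2) d(2) coh_class_eq_iff)
    qed
    show "?\<phi> ` carrier (cohomology n ?W :: ('k, _) module)
            = carrier (cohomology n ?X) \<times> carrier (cohomology n ?Y)"
    proof
      show "?\<phi> ` carrier (cohomology n ?W :: ('k, _) module)
              \<subseteq> carrier (cohomology n ?X) \<times> carrier (cohomology n ?Y)"
        using linear_map_closed[OF linear_map_cohomology_map[OF i]]
          linear_map_closed[OF linear_map_cohomology_map[OF j]] by auto
      show "carrier (cohomology n ?X) \<times> carrier (cohomology n ?Y)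
              \<subseteq> ?\<phi> ` carrier (cohomology n ?W :: ('k, _) module)"
      proof clarify
        fix C :: "('x \<Rightarrow> real, 'k) cochain set" and D :: "('y \<Rightarrow> real, 'k) cochain set"
        assume "C \<in> carrier (cohomology n ?X)" "D \<in> carrier (cohomology n ?Y)"
        then obtain c d where c: "c \<in> cocycles n ?X" "C = coh_class n ?X c"
          and d: "d \<in> cocycles n ?Y" "D = coh_class n ?Y d"
          by (auto simp: carrier_cohomology)
        \<comment> \<open>The sum of the pullbacks along the two retractions. Restricted to one
          summand, the foreign term is a pullback along a constant map and so a reduced
          coboundary.\<close>
        let ?e = "\<lambda>s. pullback_cochain n ?W (push qX) c s + pullback_cochain n ?W (push qY) d s"
        have e: "?e \<in> cocycles n ?W"
          by (rule cocycle_add[OF pullback_cocycle[OF p c(1)] pullback_cocycle[OF q d(1)]])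
        have X_eq: "(push qX \<circ> push gX) \<alpha> = \<alpha>" "(push qY \<circ> push gX) \<alpha> = vertex y0"
          if \<alpha>: "\<alpha> \<in> topspace ?X" for \<alpha>
        proof -
          obtain \<sigma> where \<sigma>: "\<sigma> \<in> KX" "\<alpha> \<in> realized_simplex \<sigma>"
            using \<alpha> by (auto simp: topspace_geometric_realization)
          show "(push qX \<circ> push gX) \<alpha> = \<alpha>"
            using push_compose[OF finX[OF \<sigma>(1)] \<sigma>(2), of qX gX]
              push_ident[OF finX[OF \<sigma>(1)] \<sigma>(2), of "qX \<circ> gX"] qgX[OF \<sigma>(1)] by simp
          show "(push qY \<circ> push gX) \<alpha> = vertex y0"
            using push_compose[OF finX[OF \<sigma>(1)] \<sigma>(2), of qY gX]
              push_const[OF finX[OF \<sigma>(1)] \<sigma>(2), of "qY \<circ> gX"] qYX[OF \<sigma>(1)] by simp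
        qed
        have Y_eq: "(push qY \<circ> push gY) \<alpha> = \<alpha>" "(push qX \<circ> push gY) \<alpha> = vertex x0"
          if \<alpha>: "\<alpha> \<in> topspace ?Y" for \<alpha>
        proof -
          obtain \<sigma> where \<sigma>: "\<sigma> \<in> KY" "\<alpha> \<in> realized_simplex \<sigma>"
            using \<alpha> by (auto simp: topspace_geometric_realization)
          show "(push qY \<circ> push gY) \<alpha> = \<alpha>"
            using push_compose[OF finY[OF \<sigma>(1)] \<sigma>(2), of qY gY]
              push_ident[OF finY[OF \<sigma>(1)] \<sigma>(2), of "qY \<circ> gY"] qgY[OF \<sigma>(1)] by simp
          show "(push qX \<circ> push gY) \<alpha> = vertex x0"
            using push_compose[OF finY[OF \<sigma>(1)] \<sigma>(2), of qX gY]
              push_const[OF finY[OF \<sigma>(1)] \<sigma>(2), of "qX \<circ> gY"] qXY[OF \<sigma>(1)] by simp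
        qed
        have vx: "vertex x0 \<in> topspace ?X"
          using realized_simplex_subset[OF base'(1)] vertex_in_realized_simplex[of "{x0}" x0]
          by blast
        have vy: "vertex y0 \<in> topspace ?Y"
          using realized_simplex_subset[OF base'(2)] vertex_in_realized_simplex[of "{y0}" y0]
          by blast
        have "pullback_cochain n ?X (push gX) ?e
                = (\<lambda>s. c s + pullback_cochain n ?X (\<lambda>_. vertex y0) d s)"
          unfolding pull_add pullback_cochain_compose[OF i]
          using X_eq pullback_cochain_ident[OF c(1)]
            pullback_cochain_cong[of ?X "push qY \<circ> push gX" "\<lambda>_. vertex y0" n d] by simp
        then have 1: "cohomology_map n ?X (push gX) (coh_class n ?W ?e) = C"
          using pullback_const_coboundary[OF vy d(1)]
          by (simp add: cohomology_map_class[OF i] c(2) coh_class_eq_iff)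
        have "pullback_cochain n ?Y (push gY) ?e
                = (\<lambda>s. pullback_cochain n ?Y (\<lambda>_. vertex x0) c s + d s)"
          unfolding pull_add pullback_cochain_compose[OF j]
          using Y_eq pullback_cochain_ident[OF d(1)]
            pullback_cochain_cong[of ?Y "push qX \<circ> push gY" "\<lambda>_. vertex x0" n c] by simp
        then have 2: "cohomology_map n ?Y (push gY) (coh_class n ?W ?e) = D"
          using pullback_const_coboundary[OF vx c(1)]
          by (simp add: cohomology_map_class[OF j] d(2) coh_class_eq_iff)
        show "(C, D) \<in> ?\<phi>
                          ` carrier (cohomology n ?W :: ('k, _) module)"
          using 1 2 e by (intro image_eqI[of _ _ "coh_class n ?W ?e"])
            (auto simp: carrier_cohomology)
      qed
    qed
  qed
qed

section \<open>Vietoris--Rips complexes of wedge sums\<close>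

text \<open>The supremum over a finite nonempty set is attained, so even a strict bound can be
  tested on pairs.\<close>

lemma mdiameter_less_iff:
  assumes "finite \<sigma>" "\<sigma> \<noteq> {}"
  shows "mdiameter X \<sigma> < r \<longleftrightarrow> (\<forall>x\<in>\<sigma>. \<forall>y\<in>\<sigma>. mdist X x y < r)"
proof -
  let ?D = "(\<lambda>(x, y). mdist X x y) ` (\<sigma> \<times> \<sigma>)"
  have D: "finite ?D" "?D \<noteq> {}"
    using assms by auto
  have "mdiameter X \<sigma> = Max ?D"
    unfolding mdiameter_def by (rule cSup_eq_Max[OF D])
  then have "mdiameter X \<sigma> < r \<longleftrightarrow> (\<forall>d\<in>?D. d < r)"
    using Max_less_iff[OF D] by simp
  then show ?thesis
    by auto
qed

lemma in_vr_simplices_iff: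
  "\<sigma> \<in> vr_simplices X r \<longleftrightarrow>
     finite \<sigma> \<and> \<sigma> \<noteq> {} \<and> \<sigma> \<subseteq> mspace X \<and> (\<forall>x\<in>\<sigma>. \<forall>y\<in>\<sigma>. mdist X x y < r)"
  using mdiameter_less_iff[of \<sigma> X r] by (auto simp: vr_simplices_def)

lemma abstract_complex_vr_simplices: "abstract_complex (vr_simplices X r)"
  unfolding abstract_complex_def
proof (intro conjI ballI allI impI)
  fix \<sigma> \<tau> assume "\<sigma> \<in> vr_simplices X r" "\<tau> \<subseteq> \<sigma> \<and> \<tau> \<noteq> {}"
  then show "\<tau> \<in> vr_simplices X r"
    unfolding in_vr_simplices_iff using finite_subset by blast
qed (simp_all add: in_vr_simplices_iff)

lemma vr_simplices_image:
  assumes "\<sigma> \<in> vr_simplices X r" "g ` mspace X \<subseteq> mspace Y"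
    and "\<And>x y. x \<in> mspace X \<Longrightarrow> y \<in> mspace X \<Longrightarrow> mdist Y (g x) (g y) \<le> mdist X x y"
  shows "g ` \<sigma> \<in> vr_simplices Y r"
proof -
  have "mdist Y (g x) (g y) < r" if "x \<in> \<sigma>" "y \<in> \<sigma>" for x y
    using assms(1) assms(3)[of x y] that unfolding in_vr_simplices_iff by (meson le_less_trans subsetD)
  moreover have "g ` \<sigma> \<subseteq> mspace Y"
    using assms(1,2) unfolding in_vr_simplices_iff by blast
  ultimately show ?thesis
    using assms(1) by (simp add: in_vr_simplices_iff)
qed

lemma cellular_rspace_VR: "cellular_rspace (VR X)"
proof -
  have "continuous_map (geometric_realization (vr_simplices X s)) (geometric_realization (vr_simplices X t)) id"
    if "s \<le> t" for s t
  proof -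
    have "vr_simplices X s \<subseteq> vr_simplices X t"
      using that by (auto simp: vr_simplices_def)
    then show ?thesis
      unfolding continuous_map_from_realization using continuous_map_simplex_inclusion
      by (auto simp: id_def)
  qed
  then show ?thesis
    by (simp add: cellular_rspace_def VR_def cw_complex_geometric_realization abstract_complex_vr_simplices)
qed

text \<open>For scales \<le> 0, where \<open>{w0}\<close> is not a simplex and the wedge argument
  has no base point; all the spaces of classes are zero.\<close>

lemma cohomology_empty_bij:
  assumes "topspace X = {}" "topspace Y = {}" "topspace W = {}"
    and i: "continuous_map X W i" and j: "continuous_map Y W j"
  shows "bij_betw (\<lambda>C. (cohomology_map n X i C, cohomology_map n Y j C))
           (carrier (cohomology n W :: ('k::field, _) module))
           (carrier (cohomology n X) \<times> carrier (cohomology n Y))"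
proof -
  have *: "carrier (cohomology n Z :: ('k, _) module) = {coh_class n Z (\<lambda>s. 0)}"
    if "topspace Z = {}" for Z :: "'z topology"
  proof -
    have "cocycles n Z = {\<lambda>s. 0 :: 'k}"
      using zero_cocycle[of n Z] singular_simplex_empty[OF that] by (auto simp: cocycle_iff)
    then show ?thesis
      by (simp add: carrier_cohomology)
  qed
  show ?thesis
    unfolding *[OF assms(1)] *[OF assms(2)] *[OF assms(3)]
    by (auto simp: bij_betw_def cohomology_map_class[OF i] cohomology_map_class[OF j] pullback_cochain_def)
qed

text \<open>The vertex maps \<open>gX\<close> and \<open>gY\<close> are chosen once for all scales.
  As the structure maps of the complexes are inclusions, this makes the isomorphism natural in the
  scale.\<close>

lemma VR_wedge_cohomology:
  fixes X :: "'x metric" and Y :: "'y metric" and W :: "'w metric"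
  assumes x0: "x0 \<in> mspace X" and y0: "y0 \<in> mspace Y" and iso: "isometric W (wedge_metric X x0 Y y0)"
  obtains gX gY where
    "\<And>r. continuous_map (robj (VR X) r) (robj (VR W) r) (push gX)"
    "\<And>r. continuous_map (robj (VR Y) r) (robj (VR W) r) (push gY)"
    "\<And>n r. bij_betw (\<lambda>C. (cohomology_map n (robj (VR X) r) (push gX) C,
                            cohomology_map n (robj (VR Y) r) (push gY) C))
           (carrier (cohomology n (robj (VR W) r) :: ('k::field, _) module))
           (carrier (cohomology n (robj (VR X) r)) \<times> carrier (cohomology n (robj (VR Y) r)))"
proof -
  let ?M = "Inl ` mspace X \<union> Inr ` (mspace Y - {y0})"
  obtain f where f: "bij_betw f (mspace W) ?M"
    and df: "\<And>u v. u \<in> mspace W \<Longrightarrow> v \<in> mspace W \<Longrightarrow> mdist W u v = gluing_dist X x0 Y y0 (f u) (f v)"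
    using iso unfolding isometric_def mspace_wedge_metric[OF x0 y0] mdist_wedge_metric[OF x0 y0] by auto
  define h where "h = the_inv_into (mspace W) f"
  have h: "bij_betw h ?M (mspace W)"
    unfolding h_def by (rule bij_betw_the_inv_into[OF f])
  have fh: "f (h p) = p" if "p \<in> ?M" for p
    unfolding h_def using f that by (rule f_the_inv_into_f_bij_betw)
  have hf: "h (f u) = u" if "u \<in> mspace W" for u
    unfolding h_def using f that by (simp add: bij_betw_def the_inv_into_f_f)
  have hW: "h p \<in> mspace W" if "p \<in> ?M" for p
    using h that by (auto simp: bij_betw_def)
  have fW: "f u \<in> ?M" if "u \<in> mspace W" for u
    using f that by (auto simp: bij_betw_def)
  define gX where "gX = (\<lambda>x. h (Inl x))"
  \<comment> \<open>The base point of \<open>Y\<close> is not present as \<open>Inr y0\<close> in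
    the wedge; its place is taken by \<open>Inl x0\<close>.\<close>
  define gY where "gY = (\<lambda>y. if y = y0 then h (Inl x0) else h (Inr y))"
  define qX where "qX = (\<lambda>u. case f u of Inl x \<Rightarrow> x | Inr y \<Rightarrow> x0)"
  define qY where "qY = (\<lambda>u. case f u of Inl x \<Rightarrow> y0 | Inr y \<Rightarrow> y)"
  define w0 where "w0 = h (Inl x0)"
  define A where "A = gX ` mspace X"
  define B where "B = gY ` mspace Y"
  have fgX: "f (gX x) = Inl x" if "x \<in> mspace X" for x
    using that by (simp add: gX_def fh)
  have fgY: "f (gY y) = (if y = y0 then Inl x0 else Inr y)" if "y \<in> mspace Y" for y
    using that x0 by (simp add: gY_def fh)
  have gX_W: "gX ` mspace X \<subseteq> mspace W" and gY_W: "gY ` mspace Y \<subseteq> mspace W"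
    using hW x0 by (auto simp: gX_def gY_def)
  have self: "mdist X x0 x0 = 0" "mdist Y y0 y0 = 0"
    using x0 y0 by simp_all
  have dX: "mdist W (gX x) (gX x') = mdist X x x'" if "x \<in> mspace X" "x' \<in> mspace X" for x x'
    using that gX_W by (subst df) (auto simp: fgX)
  have dY: "mdist W (gY y) (gY y') = mdist Y y y'" if "y \<in> mspace Y" "y' \<in> mspace Y" for y y'
    using that gY_W x0 y0 by (subst df) (auto simp: fgY mdist_commute self)
  have dXY: "mdist W (gX x) (gY y) = mdist X x x0 + mdist Y y y0" if "x \<in> mspace X" "y \<in> mspace Y" for x y
    using that gX_W gY_W x0 y0 by (subst df) (auto simp: fgX fgY)
  have dYX: "mdist W (gY y) (gX x) = mdist X x0 x + mdist Y y0 y" if "x \<in> mspace X" "y \<in> mspace Y" for x y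
    using dXY[OF that] by (simp add: mdist_commute)
  have w0_eq: "w0 = gX x0" "w0 = gY y0"
    by (simp_all add: w0_def gX_def gY_def)
  have union: "A \<union> B = mspace W"
  proof
    show "mspace W \<subseteq> A \<union> B"
    proof
      fix u assume u: "u \<in> mspace W"
      from fW[OF u] show "u \<in> A \<union> B"
      proof
        assume "f u \<in> Inl ` mspace X"
        then obtain x where "x \<in> mspace X" "f u = Inl x"
          by blast
        then have "u = gX x"
          using hf[OF u] by (simp add: gX_def)
        then show ?thesis
          using \<open>x \<in> mspace X\<close> by (simp add: A_def)
      next
        assume "f u \<in> Inr ` (mspace Y - {y0})"
        then obtain y where "y \<in> mspace Y - {y0}" "f u = Inr y"
          by blast
        then have "u = gY y"
          using hf[OF u] by (simp add: gY_def)
        then show ?thesis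
          using \<open>y \<in> mspace Y - {y0}\<close> by (simp add: B_def)
      qed
    qed
  qed (use gX_W gY_W in \<open>auto simp: A_def B_def\<close>)
  have inter: "A \<inter> B = {w0}"
  proof
    show "A \<inter> B \<subseteq> {w0}"
    proof
      fix u assume "u \<in> A \<inter> B"
      then obtain x y where xy: "x \<in> mspace X" "y \<in> mspace Y" "u = gX x" "u = gY y"
        by (auto simp: A_def B_def)
      then have "Inl x = (if y = y0 then Inl x0 else Inr y)"
        using fgX fgY by metis
      then show "u \<in> {w0}"
        using xy w0_eq by (auto split: if_splits)
    qed
    show "{w0} \<subseteq> A \<inter> B"
      unfolding A_def B_def using w0_eq x0 y0 by blast
  qed
  have qgX: "qX (gX x) = x" "qY (gX x) = y0" if "x \<in> mspace X" for x
    by (simp_all add: qX_def qY_def fgX[OF that])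
  have qgY: "qY (gY y) = y" "qX (gY y) = x0" if "y \<in> mspace Y" for y
    by (simp_all add: qX_def qY_def fgY[OF that])
  have gqX: "gX (qX u) = (if u \<in> A then u else w0)" if "u \<in> mspace W" for u
  proof (cases "u \<in> A")
    case True
    then show ?thesis
      using qgX by (auto simp: A_def)
  next
    case False
    then obtain y where "y \<in> mspace Y" "u = gY y"
      using \<open>u \<in> mspace W\<close> union unfolding B_def by blast
    then show ?thesis
      using False qgY(2) w0_eq(1) by simp
  qed
  have gqY: "gY (qY u) = (if u \<in> B then u else w0)" if "u \<in> mspace W" for u
  proof (cases "u \<in> B")
    case True
    then show ?thesis
      using qgY by (auto simp: B_def)
  next
    case False
    then obtain x where "x \<in> mspace X" "u = gX x"
      using \<open>u \<in> mspace W\<close> union unfolding A_def by blast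
    then show ?thesis
      using False qgX(2) w0_eq(2) by simp
  qed
  have qX_X: "qX ` mspace W \<subseteq> mspace X" and qY_Y: "qY ` mspace W \<subseteq> mspace Y"
    using qgX qgY x0 y0 by (auto simp: union[symmetric] A_def B_def)
  have cases: "(\<exists>x\<in>mspace X. u = gX x) \<or> (\<exists>y\<in>mspace Y. u = gY y)" if "u \<in> mspace W" for u
    using that unfolding union[symmetric] A_def B_def by blast
  \<comment> \<open>Sending a point of the other summand to the base point drops a nonnegative term
    of the gluing distance, and two such points end up at distance 0.\<close>
  have qX_dist: "mdist X (qX u) (qX v) \<le> mdist W u v" if uv: "u \<in> mspace W" "v \<in> mspace W" for u v
    using cases[OF uv(1)] cases[OF uv(2)]
    by (elim disjE bexE) (simp_all add: qgX qgY dX dY dXY dYX self mdist_commute)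
  have qY_dist: "mdist Y (qY u) (qY v) \<le> mdist W u v" if uv: "u \<in> mspace W" "v \<in> mspace W" for u v
    using cases[OF uv(1)] cases[OF uv(2)]
    by (elim disjE bexE) (simp_all add: qgX qgY dX dY dXY dYX self mdist_commute)
  have gX_simp: "gX ` \<sigma> \<in> vr_simplices W r" if "\<sigma> \<in> vr_simplices X r" for \<sigma> r
    by (rule vr_simplices_image[OF that gX_W]) (simp add: dX)
  have gY_simp: "gY ` \<sigma> \<in> vr_simplices W r" if "\<sigma> \<in> vr_simplices Y r" for \<sigma> r
    by (rule vr_simplices_image[OF that gY_W]) (simp add: dY)
  have qX_simp: "qX ` \<sigma> \<in> vr_simplices X r" if "\<sigma> \<in> vr_simplices W r" for \<sigma> r
    by (rule vr_simplices_image[OF that qX_X qX_dist])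
  have qY_simp: "qY ` \<sigma> \<in> vr_simplices Y r" if "\<sigma> \<in> vr_simplices W r" for \<sigma> r
    by (rule vr_simplices_image[OF that qY_Y qY_dist])
  have cX: "continuous_map (robj (VR X) r) (robj (VR W) r) (push gX)" for r
    unfolding VR_def rspace.simps
    by (rule continuous_map_push) (use gX_simp in \<open>auto simp: in_vr_simplices_iff\<close>)
  have cY: "continuous_map (robj (VR Y) r) (robj (VR W) r) (push gY)" for r
    unfolding VR_def rspace.simps
    by (rule continuous_map_push) (use gY_simp in \<open>auto simp: in_vr_simplices_iff\<close>)
  have mem: "v \<in> mspace Z" if "\<sigma> \<in> vr_simplices Z r" "v \<in> \<sigma>" for v \<sigma> r and Z :: "'z metric"
    using that by (auto simp: in_vr_simplices_iff)
  have "bij_betw (\<lambda>C. (cohomology_map n (robj (VR X) r) (push gX) C,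
                        cohomology_map n (robj (VR Y) r) (push gY) C))
           (carrier (cohomology n (robj (VR W) r) :: ('k, _) module))
           (carrier (cohomology n (robj (VR X) r)) \<times> carrier (cohomology n (robj (VR Y) r)))" for n r
  proof (cases "r \<le> 0")
    case True
    show ?thesis
      by (rule cohomology_empty_bij[OF _ _ _ cX cY])
         (simp_all add: VR_def topspace_geometric_realization vr_simplices_nonpos True)
  next
    case False
    have point: "{p} \<in> vr_simplices Z r" if "p \<in> mspace Z" for p and Z :: "'z metric"
    proof -
      have "mdist Z p p < r"
        using mdist_zero[of p Z p] that False by (metis not_le)
      then show ?thesis
        using that by (simp add: in_vr_simplices_iff)
    qed
    interpret wedge_complex "vr_simplices W r" A B w0
    proof
      show "abstract_complex (vr_simplices W r)"
        by (rule abstract_complex_vr_simplices)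
      show "\<sigma> \<subseteq> A \<union> B" if "\<sigma> \<in> vr_simplices W r" for \<sigma>
        using that by (simp add: union in_vr_simplices_iff)
      show "A \<inter> B = {w0}"
        by (rule inter)
      show "{w0} \<in> vr_simplices W r"
        using inter union by (intro point) blast
      show "\<sigma> \<subseteq> A \<or> \<sigma> \<subseteq> B \<or> insert w0 \<sigma> \<in> vr_simplices W r" if \<sigma>: "\<sigma> \<in> vr_simplices W r" for \<sigma>
      proof (rule ccontr)
        assume not: "\<not> ?thesis"
        then obtain a b where ab: "a \<in> \<sigma>" "a \<notin> B" "b \<in> \<sigma>" "b \<notin> A"
          by blast
        then have "a \<in> A" "b \<in> B"
          using mem[OF \<sigma>] union by blast+
        then obtain x y where xy: "x \<in> mspace X" "a = gX x" "y \<in> mspace Y" "b = gY y"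
          by (auto simp: A_def B_def)
        \<comment> \<open>The distance from \<open>z\<close> to a point of the opposite summand is
          the sum of their distances to the base point. For \<open>z\<close> in \<open>A\<close> the
          point \<open>b\<close> serves, for \<open>z\<close> in \<open>B\<close> the point
          \<open>a\<close>.\<close>
        have near: "mdist W z w0 < r" if "z \<in> \<sigma>" for z
        proof -
          have less: "mdist W z a < r" "mdist W z b < r"
            using \<sigma> ab that by (auto simp: in_vr_simplices_iff)
          have "z \<in> A \<or> z \<in> B"
            using mem[OF \<sigma> that] union by blast
          then show ?thesis
          proof
            assume "z \<in> A"
            then obtain x' where "x' \<in> mspace X" "z = gX x'"
              by (auto simp: A_def)
            then show ?thesis
              using less(2) xy x0 by (simp add: dXY w0_eq(1) dX) (smt (verit) mdist_nonneg)
          next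
            assume "z \<in> B"
            then obtain y' where "y' \<in> mspace Y" "z = gY y'"
              by (auto simp: B_def)
            then show ?thesis
              using less(1) xy y0
              by (simp add: dXY w0_eq(2) dY mdist_commute) (smt (verit) mdist_nonneg)
          qed
        qed
        have w0W: "w0 \<in> mspace W"
          using inter union by blast
        then have "mdist W w0 w0 < r"
          using point[OF w0W] by (simp add: in_vr_simplices_iff)
        moreover have "mdist W w0 z < r" if "z \<in> \<sigma>" for z
          using near[OF that] by (metis mdist_commute)
        ultimately have "insert w0 \<sigma> \<in> vr_simplices W r"
          using \<sigma> w0W near by (auto simp: in_vr_simplices_iff)
        then show False
          using not by blast
      qed
    qed
    show ?thesis
      unfolding VR_def rspace.simps
      by (rule cohomology_wedge_bij[where qX = qX and qY = qY and ?x0.0 = x0 and ?y0.0 = y0])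
         (rule abstract_complex_vr_simplices point x0 y0
          | erule gX_simp gY_simp qX_simp qY_simp
          | rule qgX qgY gqX gqY, erule (1) mem)+
  qed
  then show thesis
    using that cX cY by blast
qed

text \<open>An operation acts on spaces with one fixed type of points, so the three metric spaces
  share the type \<open>'v\<close>. The wedge metric lives on a sum type and enters through an
  isometric copy \<open>W\<close>.\<close>

theorem theorem1:
  fixes X Y W :: "'v metric" and x0 y0 :: 'v and l m :: nat
    and \<theta> :: "('v \<Rightarrow> real) topology \<Rightarrow> ('v \<Rightarrow> real, 'k::field) cochain set \<Rightarrow>
              ('v \<Rightarrow> real, 'k) cochain set"
  assumes "x0 \<in> mspace X" and "y0 \<in> mspace Y"
    and "linear_cohomology_operation l m \<theta>"
    and "isometric W (wedge_metric X x0 Y y0)"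
  shows "pmodule_iso (im_pmodule l m \<theta> (VR W))
           (pmodule_sum (im_pmodule l m \<theta> (VR X)) (im_pmodule l m \<theta> (VR Y))) \<and>
         pmodule_iso (ker_pmodule l m \<theta> (VR W))
           (pmodule_sum (ker_pmodule l m \<theta> (VR X)) (ker_pmodule l m \<theta> (VR Y)))"
proof -
  obtain gX gY where g:
    "\<And>r. continuous_map (robj (VR X) r) (robj (VR W) r) (push gX)"
    "\<And>r. continuous_map (robj (VR Y) r) (robj (VR W) r) (push gY)"
    "\<And>n r. bij_betw (\<lambda>C. (cohomology_map n (robj (VR X) r) (push gX) C,
                            cohomology_map n (robj (VR Y) r) (push gY) C))
           (carrier (cohomology n (robj (VR W) r) :: ('k, _) module))
           (carrier (cohomology n (robj (VR X) r)) \<times> carrier (cohomology n (robj (VR Y) r)))"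
    using VR_wedge_cohomology[OF assms(1,2,4), where ?'k = 'k] by blast
  \<comment> \<open>With this, both naturality conditions become trivial, since
    \<open>push gX\<close> and \<open>push gY\<close> do not depend on the scale.\<close>
  have r: "rmap (VR Z) s t = id" for Z :: "'v metric" and s t
    by (simp add: VR_def)
  show ?thesis
    using operation_modules_iso[OF cellular_rspace_VR cellular_rspace_VR cellular_rspace_VR assms(3)
        g(1,2) _ _ g(3)] by (simp add: r)
qed

end
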